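(* Let $\Omega=\{\omega_k\}_{k\in\mathbb{Z}}$ be an arbitrary family of intervals in $\mathbb{R}$ with $\sum_{k}\mathbf 1_{\omega_k}(x)\le B$ for all $x\in\mathbb{R}$, and let $T$ be the associated Littlewood--Paley square function. Then there is a constant $C$, depending only on $B$, such that for every weight $w\in A_1$ $$ \|T\|_{L^2(w)\to L^{2,\infty}(w)}\le C\,[w]_{A_1}^{\frac12}\,[w]_{A_\infty}^{\frac12}\,\log\big(e+[w]_{A_\infty}\big). $$
   Context: $\mathbf 1_E$ is the characteristic function of $E$, and $\check h(x)=\int_{\mathbb{R}}h(\xi)e^{2\pi i x\xi}\,d\xi$ is the inverse Fourier transform. The Littlewood--Paley square function associated with $\Omega$ is $$Tf(x):=\Big(\sum_{k\in\mathbb{Z}}|f*\check{\mathbf 1}_{\omega_k}(x)|^2\Big)^{1/2},$$ initially defined on test functions, which are dense in $L^2(w)$. A weight is a nonnegative locally integrable function on $\mathbb{R}$. Let $M$ be the classical Hardy--Littlewood maximal function. $A_1$ is the class of weights $w$ with $[w]_{A_1}:=\operatorname{ess\,sup}\frac{M(w)}{w}<\infty$. The $A_\infty$ constant is $$[w]_{A_\infty}:=\sup_Q\frac1{w(Q)}\int_Q M(w\mathbf 1_Q)(x)\,dx,\qquad w(Q):=\int_Qw(x)\,dx,$$ the supremum being over all intervals $Q\subset\mathbb{R}$. $L^{2,\infty}(w)$ is the weak $L^2$ space with respect to the measure $w(x)\,dx$. *)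

theory Defs
  imports "HOL-Probability.Essential_Supremum"
begin

definition ennreal_sqrt :: "ennreal \<Rightarrow> ennreal" where
  "ennreal_sqrt x = (if x = \<infinity> then \<infinity> else ennreal (sqrt (enn2real x)))"


subsection \<open>Weights\<close>

definition weight :: "(real \<Rightarrow> real) \<Rightarrow> bool" where
  "weight w \<longleftrightarrow> w \<in> borel_measurable lebesgue \<and> (\<forall>x. 0 \<le> w x) \<and>
    (\<forall>K. compact K \<longrightarrow> set_integrable lebesgue K w)"

definition weight_measure :: "(real \<Rightarrow> real) \<Rightarrow> real measure" where
  "weight_measure w = density lebesgue (\<lambda>x. ennreal (w x))"

text \<open>The uncentered maximal function. Endpoints are Lebesgue-null, so it suffices to let \<^term>\<open>Q\<close>
  range over open intervals, here and in the \<open>A\<^sub>\<infinity>\<close> constant.\<close>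

definition maximal :: "(real \<Rightarrow> real) \<Rightarrow> real \<Rightarrow> ennreal" where
  "maximal f x = (SUP (a, b) \<in> {(a, b). a < b \<and> x \<in> {a<..<b}}.
     (\<integral>\<^sup>+ y \<in> {a<..<b}. ennreal \<bar>f y\<bar> \<partial>lebesgue) / ennreal (b - a))"

lemma borel_measurable_maximal [measurable]: "maximal f \<in> borel_measurable borel"
proof (rule borel_measurableI_greater)
  fix t :: ennreal
  have "{x. t < maximal f x} = (\<Union>(a, b) \<in> {(a, b). a < b \<and>
      t < (\<integral>\<^sup>+ y \<in> {a<..<b}. ennreal \<bar>f y\<bar> \<partial>lebesgue) / ennreal (b - a)}. {a<..<b})"
    by (auto simp: maximal_def less_SUP_iff) (meson order.strict_trans)
  then have "open {x. t < maximal f x}" by auto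
  then show "{x \<in> space borel. t < maximal f x} \<in> sets borel" by simp
qed

text \<open>Division on \<^typ>\<open>ennreal\<close> satisfies \<open>0 / 0 = 0\<close> and \<open>c / 0 = \<infinity>\<close> for \<open>c \<noteq> 0\<close>. So a weight that is
  not a.e. zero but vanishes on a set of positive measure has infinite \<open>A\<^sub>1\<close> constant, and an
  interval with \<open>w(Q) = 0\<close> does not affect the \<open>A\<^sub>\<infinity>\<close> constant.\<close>

definition A1_const :: "(real \<Rightarrow> real) \<Rightarrow> ennreal" where
  "A1_const w = esssup lebesgue (\<lambda>x. maximal w x / ennreal (w x))"

definition A1_class :: "(real \<Rightarrow> real) set" where
  "A1_class = {w. weight w \<and> A1_const w < \<infinity>}"

definition Ainf_const :: "(real \<Rightarrow> real) \<Rightarrow> ennreal" where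
  "Ainf_const w = (SUP (a, b) \<in> {(a, b). a < b}.
     (\<integral>\<^sup>+ x \<in> {a<..<b}. maximal (\<lambda>y. w y * indicator {a<..<b} y) x \<partial>lebesgue)
       / emeasure (weight_measure w) {a<..<b})"

lemma Ainf_const_le_A1_const:
  assumes "w \<in> A1_class"
  shows "Ainf_const w \<le> A1_const w"
proof -
  have w: "weight w" and fin: "A1_const w < \<infinity>"
    using assms by (auto simp: A1_class_def)
  have meas [measurable]: "w \<in> borel_measurable lebesgue" and nn: "\<And>x. 0 \<le> w x"
    using w by (auto simp: weight_def)
  have "AE x in lebesgue. maximal w x / ennreal (w x) \<le> A1_const w"
    unfolding A1_const_def by (rule esssup_AE)
  then have ae: "AE x in lebesgue. maximal w x \<le> A1_const w * ennreal (w x)"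
  proof eventually_elim
    case (elim x)
    show ?case
    proof (cases "w x = 0")
      case True
      then have "maximal w x = 0"
        using elim fin by (auto simp: ennreal_divide_zero split: if_splits)
      then show ?thesis by simp
    next
      case False
      then have "0 < w x" using nn[of x] by simp
      then have "maximal w x = maximal w x / ennreal (w x) * ennreal (w x)"
        by (simp add: ennreal_divide_times ennreal_times_divide mult_divide_eq_ennreal)
      also have "\<dots> \<le> A1_const w * ennreal (w x)"
        using elim by (rule mult_right_mono) simp
      finally show ?thesis .
    qed
  qed
  have "(\<integral>\<^sup>+ x \<in> {a<..<b}. maximal (\<lambda>y. w y * indicator {a<..<b} y) x \<partial>lebesgue)
       / emeasure (weight_measure w) {a<..<b} \<le> A1_const w" if "a < b" for a b
  proof -
    have meas' [measurable]: "(\<lambda>x. ennreal (w x) * indicator {a<..<b} x) \<in> borel_measurable lebesgue"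
      by (intro borel_measurable_times_ennreal borel_measurable_indicator) (use meas in auto)
    have mono: "maximal (\<lambda>y. w y * indicator {a<..<b} y) x \<le> maximal w x" for x
      unfolding maximal_def
      by (intro SUP_mono') (auto intro!: divide_right_mono_ennreal nn_integral_mono simp: nn indicator_def)
    have "(\<integral>\<^sup>+ x \<in> {a<..<b}. maximal (\<lambda>y. w y * indicator {a<..<b} y) x \<partial>lebesgue)
        \<le> (\<integral>\<^sup>+ x. A1_const w * (ennreal (w x) * indicator {a<..<b} x) \<partial>lebesgue)"
    proof (intro nn_integral_mono_AE, use ae in eventually_elim)
      case (elim x)
      then show ?case
        using order_trans[OF mono elim] by (cases "x \<in> {a<..<b}") simp_all
    qed
    also have "\<dots> = A1_const w * emeasure (weight_measure w) {a<..<b}"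
      by (subst nn_integral_cmult) (simp_all add: weight_measure_def emeasure_density meas')
    finally have *: "(\<integral>\<^sup>+ x \<in> {a<..<b}. maximal (\<lambda>y. w y * indicator {a<..<b} y) x \<partial>lebesgue)
        \<le> A1_const w * emeasure (weight_measure w) {a<..<b}" .
    have "emeasure (weight_measure w) {a<..<b} < \<infinity>"
    proof -
      have "set_integrable lebesgue {a..b} w"
        using w by (auto simp: weight_def)
      then have "set_integrable lebesgue {a<..<b} w"
        by (rule set_integrable_subset) auto
      then have "(\<integral>\<^sup>+ x. ennreal (norm (indicator {a<..<b} x *\<^sub>R w x)) \<partial>lebesgue) < \<infinity>"
        unfolding set_integrable_def integrable_iff_bounded by auto
      also have "(\<integral>\<^sup>+ x. ennreal (norm (indicator {a<..<b} x *\<^sub>R w x)) \<partial>lebesgue)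
          = (\<integral>\<^sup>+ x. ennreal (w x) * indicator {a<..<b} x \<partial>lebesgue)"
        by (intro nn_integral_cong) (auto simp: indicator_def nn)
      finally show ?thesis
        by (simp add: weight_measure_def emeasure_density)
    qed
    then show ?thesis
    proof (cases "emeasure (weight_measure w) {a<..<b} = 0")
      case True
      then show ?thesis using * by simp
    next
      case False
      then show ?thesis
        using * by (intro divide_le_posI_ennreal) (auto simp: mult.commute zero_less_iff_neq_zero)
    qed
  qed
  then show ?thesis
    unfolding Ainf_const_def by (auto intro!: SUP_least)
qed


subsection \<open>The square function\<close>

text \<open>Smooth and compactly supported; \<open>D n\<close> is the \<open>n\<close>-th derivative.\<close>

definition test_function :: "(real \<Rightarrow> complex) \<Rightarrow> bool" where
  "test_function f \<longleftrightarrow>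
    (\<exists>D. D 0 = f \<and> (\<forall>n::nat. \<forall>x. (D n has_vector_derivative D (Suc n) x) (at x))) \<and>
    compact (closure {x. f x \<noteq> 0})"

definition inverse_fourier :: "(real \<Rightarrow> complex) \<Rightarrow> real \<Rightarrow> complex" where
  "inverse_fourier h x = (LINT \<xi>|lborel. h \<xi> * exp (2 * of_real pi * \<i> * of_real x * of_real \<xi>))"

text \<open>The integral above diverges for the indicator of an unbounded interval, whose inverse Fourier
  transform is only a tempered distribution. Hence the inverse Fourier transform of \<open>h\<close> is taken
  in the sense of distributions, \<open>\<phi> \<mapsto> \<langle>h, inverse_fourier \<phi>\<rangle>\<close>, and the convolution of a test
  function \<open>f\<close> with a distribution \<open>u\<close> is \<open>x \<mapsto> \<langle>u, f(x - \<cdot>)\<rangle>\<close>. For integrable \<open>h\<close>, so in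
  particular for indicators of bounded intervals, this is the pointwise convolution with
  \<^term>\<open>inverse_fourier h\<close>, see \<open>conv_inverse_fourier_integrable\<close>.\<close>

definition distr_inverse_fourier :: "(real \<Rightarrow> complex) \<Rightarrow> (real \<Rightarrow> complex) \<Rightarrow> complex" where
  "distr_inverse_fourier h \<phi> = (LINT \<xi>|lborel. h \<xi> * inverse_fourier \<phi> \<xi>)"

definition distr_conv :: "(real \<Rightarrow> complex) \<Rightarrow> ((real \<Rightarrow> complex) \<Rightarrow> complex) \<Rightarrow> real \<Rightarrow> complex" where
  "distr_conv f u x = u (\<lambda>y. f (x - y))"

lemma conv_inverse_fourier_integrable:
  assumes f: "integrable lborel f" and h: "integrable lborel h"
  shows "distr_conv f (distr_inverse_fourier h) x = (LINT y|lborel. f (x - y) * inverse_fourier h y)"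
proof -
  define e where "e = (\<lambda>\<xi> y::real. exp (2 * of_real pi * \<i> * of_real \<xi> * of_real y) :: complex)"
  have [measurable]: "f \<in> borel_measurable borel" "h \<in> borel_measurable borel"
    using f h by (auto dest: borel_measurable_integrable)
  have norm_e: "norm (e \<xi> y) = 1" for \<xi> y
    unfolding e_def by (simp add: norm_exp_eq_Re)
  have e_comm: "e \<xi> y = e y \<xi>" for \<xi> y
    unfolding e_def by (simp add: mult_ac)
  have meas_e [measurable]: "(\<lambda>(\<xi>, y). e \<xi> y) \<in> borel_measurable (lborel \<Otimes>\<^sub>M lborel)"
    unfolding e_def by measurable
  have f': "integrable lborel (\<lambda>y. f (x - y))"
    using lborel_integrable_real_affine[OF f, of "-1" x] by simp
  have "integrable (lborel \<Otimes>\<^sub>M lborel) (\<lambda>(\<xi>, y). h \<xi> * f (x - y))"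
    using lborel_pair.integrable_fst by (intro lborel_pair.Fubini_integrable) (auto simp: norm_mult h f')
  then have int: "integrable (lborel \<Otimes>\<^sub>M lborel) (\<lambda>(\<xi>, y). h \<xi> * f (x - y) * e \<xi> y)"
    by (rule Bochner_Integration.integrable_bound) (auto simp: norm_mult norm_e split_beta')
  have "distr_conv f (distr_inverse_fourier h) x = (LINT \<xi>|lborel. LINT y|lborel. h \<xi> * f (x - y) * e \<xi> y)"
    unfolding distr_conv_def distr_inverse_fourier_def inverse_fourier_def e_def
    by (simp add: mult.assoc)
  also have "\<dots> = (LINT y|lborel. LINT \<xi>|lborel. h \<xi> * f (x - y) * e \<xi> y)"
    using lborel_pair.Fubini_integral[OF int] by simp
  also have "\<dots> = (LINT y|lborel. f (x - y) * inverse_fourier h y)"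
  proof (intro Bochner_Integration.integral_cong refl)
    fix y
    have "(LINT \<xi>|lborel. h \<xi> * f (x - y) * e \<xi> y) = (LINT \<xi>|lborel. f (x - y) * (h \<xi> * e y \<xi>))"
      by (intro Bochner_Integration.integral_cong refl) (simp add: e_comm mult_ac)
    then show "(LINT \<xi>|lborel. h \<xi> * f (x - y) * e \<xi> y) = f (x - y) * inverse_fourier h y"
      unfolding inverse_fourier_def e_def by simp
  qed
  finally show ?thesis .
qed

definition square_function :: "(int \<Rightarrow> real set) \<Rightarrow> (real \<Rightarrow> complex) \<Rightarrow> real \<Rightarrow> ennreal" where
  "square_function \<omega> f x = ennreal_sqrt (\<Sum>\<^sub>\<infinity>k.
     ennreal ((cmod (distr_conv f (distr_inverse_fourier (indicator (\<omega> k))) x))\<^sup>2))"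


subsection \<open>Weighted norms\<close>

definition L2_norm :: "(real \<Rightarrow> real) \<Rightarrow> (real \<Rightarrow> complex) \<Rightarrow> ennreal" where
  "L2_norm w f = ennreal_sqrt (\<integral>\<^sup>+ x. ennreal ((cmod (f x))\<^sup>2) \<partial>weight_measure w)"

definition weak_L2_norm :: "(real \<Rightarrow> real) \<Rightarrow> (real \<Rightarrow> ennreal) \<Rightarrow> ennreal" where
  "weak_L2_norm w g = (SUP t \<in> {0<..}.
     ennreal t * ennreal_sqrt (emeasure (weight_measure w) {x. ennreal t < g x}))"

text \<open>Norm from \<open>L\<^sup>2(w)\<close> to \<open>L\<^sup>2\<^sup>,\<^sup>\<infinity>(w)\<close> of a sublinear operator that is given on test functions, which
  are dense in \<open>L\<^sup>2(w)\<close>.\<close>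

definition weak_op_norm :: "(real \<Rightarrow> real) \<Rightarrow> ((real \<Rightarrow> complex) \<Rightarrow> real \<Rightarrow> ennreal) \<Rightarrow> ennreal" where
  "weak_op_norm w T = Inf {N. \<forall>f. test_function f \<longrightarrow> weak_L2_norm w (T f) \<le> N * L2_norm w f}"

end

theory Submission
  imports Defs "HOL-Probability.Probability"
begin

text \<open>
  A frequency projection to an interval is the sum of two multipliers whose symbols are linear ramps. After
  demodulation at the endpoint where its symbol jumps, a ramp multiplier has a kernel that varies slowly at all scales,
  because the symbol vanishes at the other endpoint. By the inequality of Plancherel and a large
  sieve inequality, the vector of all demodulated ramps is bounded on \<open>L\<^sup>2\<close>, and away from the support of
  the function its oscillation on an interval is controlled by local \<open>L\<^sup>2\<close>-averages.
  A stopping-time argument therefore dominates it pointwise by a sparse sum of the averages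
  \<open>\<alpha> Q = (|3Q|\<^sup>-\<^sup>1 \<integral>\<^bsub>3Q\<^esub> |f|\<^sup>2)\<^sup>1\<^sup>/\<^sup>2\<close>.

  Two facts about sparse families suffice for the weighted bound. The \<open>A\<^sub>\<infinity>\<close> constant is a Carleson constant:
  the selected subintervals of \<open>Q\<close> have total weight at most \<open>2 [w]\<^bsub>A\<^sub>\<infinity>\<^esub> w(Q)\<close>. And the intervals with
  \<open>\<alpha> Q \<ge> t\<close> have total weight at most a multiple of \<open>[w]\<^bsub>A\<^sub>1\<^esub> t\<^sup>-\<^sup>2 \<integral> |f|\<^sup>2 w\<close>. Taking first moments
  of the part of the sparse sum with \<open>\<alpha> Q \<ge> 1 / [w]\<^bsub>A\<^sub>\<infinity>\<^esub>\<close> and third moments of the rest, one obtains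
  the bound even without the logarithm.
\<close>

subsection \<open>An inequality of Plancherel type\<close>

text \<open>A sharp projection to (a, b) has a kernel with two terms of size 1/z, modulated at a and
  at b; no single demodulation smooths both, which is why the symbol is cut into ramps. For a ramp
  of length L the term at the vanishing end has size 1/(L z^2), and the factor 1/L pays for its
  faster phase. The demodulations differ from one k to the next, so there is no common kernel: the
  oscillation is expanded so that k enters only through the points at which a few fixed functions
  have their Fourier transform evaluated. Orthogonality enters through \<open>plancherel_le\<close>
  and the overlap bound alone, hence averages of |f|^2 rather than of |f|. For the moments, let
  \<Lambda> be the Carleson constant. The selected intervals with average about 2^(-j) have total
  weight at most a multiple of 4^j G, and an r-th moment at height 2^j bounds the weight of the
  points they cover too often by about \<Lambda>^(r-1) 2^((2-r)j) G. This sums to \<Lambda> G for r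
  = 1 up to 2^j = \<Lambda> and for r = 3 beyond it; r = 2 would cost the number of levels.\<close>

lemma integral_norm_bound_ennreal':
  fixes f :: "'a \<Rightarrow> 'b :: {banach, second_countable_topology}"
  shows "ennreal (norm (integral\<^sup>L M f)) \<le> (\<integral>\<^sup>+x. ennreal (norm (f x)) \<partial>M)"
  by (cases "integrable M f") (auto simp: not_integrable_integral_eq intro: integral_norm_bound_ennreal)

definition fourier :: "(real \<Rightarrow> complex) \<Rightarrow> real \<Rightarrow> complex" where
  "fourier g \<xi> = (LINT y|lborel. g y * cis (- (2 * pi * y * \<xi>)))"

lemma measurable_cis [measurable]: "cis \<in> borel_measurable borel"
  by (intro borel_measurable_continuous_onI continuous_intros)

lemma borel_measurable_cnj [measurable (raw)]:
  assumes "f \<in> borel_measurable M"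
  shows "(\<lambda>x. cnj (f x)) \<in> borel_measurable M"
proof -
  have "cnj \<in> borel_measurable borel"
    by (intro borel_measurable_continuous_onI continuous_intros)
  from measurable_compose[OF assms this] show ?thesis .
qed

lemma integrable_mult_cis:
  fixes g :: "real \<Rightarrow> complex"
  assumes "integrable lborel g" and [measurable]: "\<phi> \<in> borel_measurable borel"
  shows "integrable lborel (\<lambda>y. g y * cis (\<phi> y))"
proof (rule Bochner_Integration.integrable_bound[OF assms(1)])
  have [measurable]: "g \<in> borel_measurable borel" using assms(1) by auto
  show "(\<lambda>y. g y * cis (\<phi> y)) \<in> borel_measurable lborel" by measurable
qed (auto simp: norm_mult)

lemma borel_measurable_fourier [measurable]:
  assumes "g \<in> borel_measurable borel"
  shows "fourier g \<in> borel_measurable borel"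
proof -
  note [measurable] = assms
  show ?thesis unfolding fourier_def[abs_def] by measurable
qed

lemma norm_fourier_le:
  assumes "integrable lborel g"
  shows "cmod (fourier g \<xi>) \<le> (LINT y|lborel. cmod (g y))"
  unfolding fourier_def
  by (rule order.trans[OF integral_norm_bound]) (simp add: norm_mult)

text \<open>Read off the characteristic function of the standard normal distribution by the
  substitution with factor \<open>2 * pi * \<sigma>\<close>. The transform is a probability density,
  which is what the Schur test below exploits.\<close>

lemma fourier_gaussian:
  assumes "0 < \<sigma>"
  shows "integrable lborel (\<lambda>\<xi>::real. exp (- (2 * pi * \<sigma> * \<xi>)\<^sup>2 / 2))"
    and "(LINT \<xi>|lborel. complex_of_real (exp (- (2 * pi * \<sigma> * \<xi>)\<^sup>2 / 2)) * cis (- (2 * pi * u * \<xi>)))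
      = normal_density 0 \<sigma> u"
proof -
  let ?c = "2 * pi * \<sigma>"
  have c: "?c > 0" "?c \<noteq> 0" using assms by auto
  have eq: "exp (- (?c * \<xi>)\<^sup>2 / 2) = sqrt (2 * pi) * std_normal_density (0 + ?c * \<xi>)" for \<xi>
    by (simp add: std_normal_density_def)
  have "integrable lborel std_normal_density"
    by simp
  from lborel_integrable_real_affine[OF this c(2), of 0]
  show "integrable lborel (\<lambda>\<xi>::real. exp (- (?c * \<xi>)\<^sup>2 / 2))"
    unfolding eq by (rule integrable_mult_right)
  let ?t = "- (u / \<sigma>)"
  have "complex_of_real (exp (- (?t^2) / 2)) = char std_normal_distribution ?t"
    by (simp add: char_std_normal_distribution)
  also have "\<dots> = (LINT x|lborel. complex_of_real (std_normal_density x) * cis (?t * x))"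
    unfolding char_def
    by (subst integral_density) (auto simp: cis_conv_exp scaleR_conv_of_real)
  also have "\<dots> = ?c *\<^sub>R (LINT \<xi>|lborel. complex_of_real (std_normal_density (0 + ?c * \<xi>)) * cis (?t * (0 + ?c * \<xi>)))"
    using c by (subst lborel_integral_real_affine[OF c(2), of _ 0]) simp
  also have "(LINT \<xi>|lborel. complex_of_real (std_normal_density (0 + ?c * \<xi>)) * cis (?t * (0 + ?c * \<xi>)))
     = (LINT \<xi>|lborel. (1 / complex_of_real (sqrt (2 * pi))) * (complex_of_real (exp (- (2 * pi * \<sigma> * \<xi>)\<^sup>2 / 2)) * cis (- (2 * pi * u * \<xi>))))"
  proof (intro Bochner_Integration.integral_cong refl)
    fix \<xi>
    have "?t * (0 + ?c * \<xi>) = - (2 * pi * u * \<xi>)" using assms by (simp add: field_simps)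
    then show "complex_of_real (std_normal_density (0 + ?c * \<xi>)) * cis (?t * (0 + ?c * \<xi>))
      = (1 / complex_of_real (sqrt (2 * pi))) * (complex_of_real (exp (- (2 * pi * \<sigma> * \<xi>)\<^sup>2 / 2)) * cis (- (2 * pi * u * \<xi>)))"
      unfolding eq by simp
  qed
  finally have *: "complex_of_real (exp (- (?t^2) / 2)) = complex_of_real (?c / sqrt (2 * pi)) *
     (LINT \<xi>|lborel. complex_of_real (exp (- (2 * pi * \<sigma> * \<xi>)\<^sup>2 / 2)) * cis (- (2 * pi * u * \<xi>)))" (is "_ = _ * ?I")
    by (simp add: scaleR_conv_of_real)
  have "?I = complex_of_real (sqrt (2 * pi) / ?c) * (complex_of_real (?c / sqrt (2 * pi)) * ?I)"
    using c by simp
  also have "\<dots> = complex_of_real (sqrt (2 * pi) / ?c * exp (- (?t^2) / 2))"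
    unfolding *[symmetric] by simp
  also have "sqrt (2 * pi) / ?c * exp (- (?t^2) / 2) = normal_density 0 \<sigma> u"
    using assms unfolding normal_density_def
    by (simp add: real_sqrt_mult field_simps power2_eq_square)
  finally show "?I = normal_density 0 \<sigma> u" .
qed

text \<open>Schur test: the product of the two values is at most half the sum of their squares, and
  the normal density has mass 1 in each variable.\<close>

lemma nn_integral_normal_schur:
  assumes [measurable]: "g \<in> borel_measurable borel" and "0 < \<sigma>"
  shows "(\<integral>\<^sup>+y. \<integral>\<^sup>+z. ennreal (cmod (g y) * cmod (g z) * normal_density 0 \<sigma> (y - z)) \<partial>lborel \<partial>lborel)
    \<le> (\<integral>\<^sup>+y. ennreal ((cmod (g y))\<^sup>2) \<partial>lborel)"
proof -
  let ?G = "\<lambda>u. ennreal (normal_density 0 \<sigma> u)" and ?q = "\<lambda>y. ennreal ((cmod (g y))\<^sup>2)"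
  have one: "(\<integral>\<^sup>+z. ?G z \<partial>lborel) = 1"
    using integral_normal_density[OF assms(2), of 0] integrable_normal_density[OF assms(2), of 0]
    by (simp add: nn_integral_eq_integral)
  have one1: "(\<integral>\<^sup>+z. ?G (y - z) \<partial>lborel) = 1" for y
    using nn_integral_real_affine[of ?G "-1" y] one by simp
  have one2: "(\<integral>\<^sup>+y. ?G (y - z) \<partial>lborel) = 1" for z
    using nn_integral_real_affine[of ?G "1" "-z"] one by simp
  have "(\<integral>\<^sup>+y. \<integral>\<^sup>+z. ennreal (cmod (g y) * cmod (g z) * normal_density 0 \<sigma> (y - z)) \<partial>lborel \<partial>lborel)
    \<le> (\<integral>\<^sup>+y. \<integral>\<^sup>+z. ennreal (1/2) * (?q y * ?G (y - z)) + ennreal (1/2) * (?q z * ?G (y - z)) \<partial>lborel \<partial>lborel)"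
  proof (intro nn_integral_mono)
    fix y z
    let ?a = "cmod (g y)" and ?b = "cmod (g z)" and ?n = "normal_density 0 \<sigma> (y - z)"
    have "0 \<le> (?a - ?b)\<^sup>2" by simp
    then have "?a * ?b \<le> 1/2 * ?a\<^sup>2 + 1/2 * ?b\<^sup>2" by (simp add: power2_diff)
    then have "?a * ?b * ?n \<le> (1/2 * ?a\<^sup>2 + 1/2 * ?b\<^sup>2) * ?n"
      by (rule mult_right_mono) simp
    then have "ennreal (?a * ?b * ?n) \<le> ennreal (1/2 * (?a\<^sup>2 * ?n) + 1/2 * (?b\<^sup>2 * ?n))"
      by (intro ennreal_leI) (simp add: algebra_simps)
    also have "\<dots> = ennreal (1/2) * (?q y * ?G (y - z)) + ennreal (1/2) * (?q z * ?G (y - z))"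
      by (subst ennreal_plus) (simp_all only: ennreal_mult' ennreal_mult'' zero_le_power2 normal_density_nonneg mult_nonneg_nonneg zero_le_divide_1_iff zero_le_numeral)
    finally show "ennreal (?a * ?b * ?n) \<le> \<dots>" .
  qed
  also have "\<dots> = ennreal (1/2) * (\<integral>\<^sup>+y. \<integral>\<^sup>+z. ?q y * ?G (y - z) \<partial>lborel \<partial>lborel)
      + ennreal (1/2) * (\<integral>\<^sup>+y. \<integral>\<^sup>+z. ?q z * ?G (y - z) \<partial>lborel \<partial>lborel)"
    by (simp add: nn_integral_add nn_integral_cmult)
  also have "(\<integral>\<^sup>+y. \<integral>\<^sup>+z. ?q y * ?G (y - z) \<partial>lborel \<partial>lborel) = (\<integral>\<^sup>+y. ?q y \<partial>lborel)"
    by (subst nn_integral_cmult) (simp_all add: one1)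
  also have "(\<integral>\<^sup>+y. \<integral>\<^sup>+z. ?q z * ?G (y - z) \<partial>lborel \<partial>lborel) = (\<integral>\<^sup>+z. \<integral>\<^sup>+y. ?q z * ?G (y - z) \<partial>lborel \<partial>lborel)"
    by (rule lborel_pair.Fubini') measurable
  also have "\<dots> = (\<integral>\<^sup>+z. ?q z \<partial>lborel)"
    by (subst nn_integral_cmult) (simp_all add: one2)
  also have "ennreal (1/2) * (\<integral>\<^sup>+z. ?q z \<partial>lborel) + ennreal (1/2) * (\<integral>\<^sup>+z. ?q z \<partial>lborel) = (\<integral>\<^sup>+z. ?q z \<partial>lborel)"
    unfolding distrib_right[symmetric] by (subst ennreal_plus[symmetric]) auto
  finally show ?thesis .
qed

text \<open>Gaussian damping makes the double integral absolutely convergent, so Fubini turns the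
  damped left side into a quadratic form in \<open>g\<close> with a normal density as kernel. The
  Schur test bounds it uniformly in \<open>\<sigma>\<close>, and Fatou removes the damping.\<close>

theorem plancherel_le:
  assumes int: "integrable lborel g"
  shows "(\<integral>\<^sup>+\<xi>. ennreal ((cmod (fourier g \<xi>))\<^sup>2) \<partial>lborel) \<le> (\<integral>\<^sup>+y. ennreal ((cmod (g y))\<^sup>2) \<partial>lborel)"
proof -
  have [measurable]: "g \<in> borel_measurable borel" using int by auto
  have damped: "(\<integral>\<^sup>+\<xi>. ennreal (exp (- (2 * pi * \<sigma> * \<xi>)\<^sup>2 / 2) * (cmod (fourier g \<xi>))\<^sup>2) \<partial>lborel)
     \<le> (\<integral>\<^sup>+y. ennreal ((cmod (g y))\<^sup>2) \<partial>lborel)" if \<sigma>: "0 < \<sigma>" for \<sigma>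
  proof -
    let ?\<gamma> = "\<lambda>\<xi>::real. exp (- (2 * pi * \<sigma> * \<xi>)\<^sup>2 / 2)"
    let ?G = "\<lambda>u. normal_density 0 \<sigma> u"
    have g\<gamma>: "integrable lborel ?\<gamma>" by (rule fourier_gaussian(1)[OF \<sigma>])
    let ?N = "LINT y|lborel. cmod (g y)"
    have bnd: "cmod (fourier g \<xi>) \<le> ?N" for \<xi> by (rule norm_fourier_le[OF int])
    have N0: "?N \<ge> 0" by simp
    have int1: "integrable lborel (\<lambda>\<xi>. ?\<gamma> \<xi> * (cmod (fourier g \<xi>))\<^sup>2)"
    proof (rule Bochner_Integration.integrable_bound[OF integrable_mult_right[OF g\<gamma>, of "?N\<^sup>2"]])
      show "AE \<xi> in lborel. norm (?\<gamma> \<xi> * (cmod (fourier g \<xi>))\<^sup>2) \<le> norm (?N\<^sup>2 * ?\<gamma> \<xi>)"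
        using bnd by (intro AE_I2) (auto simp: abs_mult intro!: power_mono)
    qed measurable
    have int2: "integrable (lborel \<Otimes>\<^sub>M lborel) (\<lambda>(\<xi>, y). ?\<gamma> \<xi> * cnj (fourier g \<xi>) * (g y * cis (- (2 * pi * y * \<xi>))))"
    proof (rule lborel_pair.Fubini_integrable)
      have *: "(LINT y|lborel. norm (?\<gamma> \<xi> * cnj (fourier g \<xi>) * (g y * cis (- (2 * pi * y * \<xi>)))))
          = ?\<gamma> \<xi> * cmod (fourier g \<xi>) * ?N" for \<xi>
        by (simp add: norm_mult)
      show "integrable lborel (\<lambda>\<xi>. LINT y|lborel. norm (case (\<xi>, y) of (\<xi>, y) \<Rightarrow> ?\<gamma> \<xi> * cnj (fourier g \<xi>) * (g y * cis (- (2 * pi * y * \<xi>)))))"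
        unfolding prod.case *
      proof (rule Bochner_Integration.integrable_bound[OF integrable_mult_right[OF g\<gamma>, of "?N\<^sup>2"]])
        show "AE \<xi> in lborel. norm (?\<gamma> \<xi> * cmod (fourier g \<xi>) * ?N) \<le> norm (?N\<^sup>2 * ?\<gamma> \<xi>)"
          using bnd by (intro AE_I2) (auto simp: abs_mult power2_eq_square mult.assoc intro!: mult_right_mono)
      qed measurable
      show "AE \<xi> in lborel. integrable lborel (\<lambda>y. case (\<xi>, y) of (\<xi>, y) \<Rightarrow> ?\<gamma> \<xi> * cnj (fourier g \<xi>) * (g y * cis (- (2 * pi * y * \<xi>))))"
        unfolding prod.case by (intro AE_I2 integrable_mult_right integrable_mult_cis int) measurable
      show "(\<lambda>(\<xi>, y). ?\<gamma> \<xi> * cnj (fourier g \<xi>) * (g y * cis (- (2 * pi * y * \<xi>)))) \<in> borel_measurable (lborel \<Otimes>\<^sub>M lborel)"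
        by measurable
    qed
    have int3: "integrable (lborel \<Otimes>\<^sub>M lborel) (\<lambda>(\<xi>, z). ?\<gamma> \<xi> * cis (- (2 * pi * (y - z) * \<xi>)) * cnj (g z))" for y
    proof (rule lborel_pair.Fubini_integrable)
      have *: "(LINT z|lborel. norm (?\<gamma> \<xi> * cis (- (2 * pi * (y - z) * \<xi>)) * cnj (g z))) = ?N * ?\<gamma> \<xi>" for \<xi>
        by (simp add: norm_mult)
      show "integrable lborel (\<lambda>\<xi>. LINT z|lborel. norm (case (\<xi>, z) of (\<xi>, z) \<Rightarrow> ?\<gamma> \<xi> * cis (- (2 * pi * (y - z) * \<xi>)) * cnj (g z)))"
        unfolding prod.case * by (rule integrable_mult_right[OF g\<gamma>])
      have "integrable lborel (\<lambda>z. cnj (g z) * cis (- (2 * pi * (y - z) * \<xi>)))" for \<xi>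
        using int by (intro integrable_mult_cis) auto
      from integrable_mult_right[OF this, where c="complex_of_real (?\<gamma> _)"]
      show "AE \<xi> in lborel. integrable lborel (\<lambda>z. case (\<xi>, z) of (\<xi>, z) \<Rightarrow> ?\<gamma> \<xi> * cis (- (2 * pi * (y - z) * \<xi>)) * cnj (g z))"
        unfolding prod.case by (intro AE_I2) (simp only: mult_ac)
      show "(\<lambda>(\<xi>, z). ?\<gamma> \<xi> * cis (- (2 * pi * (y - z) * \<xi>)) * cnj (g z)) \<in> borel_measurable (lborel \<Otimes>\<^sub>M lborel)"
        by measurable
    qed
    have inner: "(LINT \<xi>|lborel. ?\<gamma> \<xi> * cnj (fourier g \<xi>) * (g y * cis (- (2 * pi * y * \<xi>))))
        = g y * (LINT z|lborel. cnj (g z) * ?G (y - z))" for y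
    proof -
      have "(LINT \<xi>|lborel. ?\<gamma> \<xi> * cnj (fourier g \<xi>) * (g y * cis (- (2 * pi * y * \<xi>))))
         = (LINT \<xi>|lborel. g y * (LINT z|lborel. ?\<gamma> \<xi> * cis (- (2 * pi * (y - z) * \<xi>)) * cnj (g z)))"
      proof (intro Bochner_Integration.integral_cong refl)
        fix \<xi>
        have "cnj (fourier g \<xi>) = (LINT z|lborel. cnj (g z) * cis (2 * pi * z * \<xi>))"
          unfolding fourier_def Bochner_Integration.integral_cnj[symmetric] by (simp add: cis_cnj del: Bochner_Integration.integral_cnj)
        then have "?\<gamma> \<xi> * cnj (fourier g \<xi>) * (g y * cis (- (2 * pi * y * \<xi>)))
           = g y * (LINT z|lborel. (?\<gamma> \<xi> * cis (- (2 * pi * y * \<xi>))) * (cnj (g z) * cis (2 * pi * z * \<xi>)))"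
          unfolding integral_mult_right_zero by (simp only: mult_ac)
        also have "(\<lambda>z. (?\<gamma> \<xi> * cis (- (2 * pi * y * \<xi>))) * (cnj (g z) * cis (2 * pi * z * \<xi>)))
          = (\<lambda>z. ?\<gamma> \<xi> * cis (- (2 * pi * (y - z) * \<xi>)) * cnj (g z))"
        proof
          fix z
          have "cis (- (2 * pi * (y - z) * \<xi>)) = cis (- (2 * pi * y * \<xi>)) * cis (2 * pi * z * \<xi>)"
            unfolding cis_mult by (simp add: algebra_simps)
          then show "(?\<gamma> \<xi> * cis (- (2 * pi * y * \<xi>))) * (cnj (g z) * cis (2 * pi * z * \<xi>))
            = ?\<gamma> \<xi> * cis (- (2 * pi * (y - z) * \<xi>)) * cnj (g z)" by (simp add: mult_ac)
        qed
        finally show "?\<gamma> \<xi> * cnj (fourier g \<xi>) * (g y * cis (- (2 * pi * y * \<xi>)))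
          = g y * (LINT z|lborel. ?\<gamma> \<xi> * cis (- (2 * pi * (y - z) * \<xi>)) * cnj (g z))" .
      qed
      also have "\<dots> = g y * (LINT \<xi>|lborel. LINT z|lborel. ?\<gamma> \<xi> * cis (- (2 * pi * (y - z) * \<xi>)) * cnj (g z))"
        by simp
      also have "(LINT \<xi>|lborel. LINT z|lborel. ?\<gamma> \<xi> * cis (- (2 * pi * (y - z) * \<xi>)) * cnj (g z))
         = (LINT z|lborel. LINT \<xi>|lborel. ?\<gamma> \<xi> * cis (- (2 * pi * (y - z) * \<xi>)) * cnj (g z))"
        using lborel_pair.Fubini_integral[OF int3[of y]] by simp
      also have "\<dots> = (LINT z|lborel. cnj (g z) * ?G (y - z))"
        unfolding integral_mult_left_zero fourier_gaussian(2)[OF \<sigma>] by (simp only: mult.commute)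
      finally show ?thesis .
    qed
    have eq: "complex_of_real (LINT \<xi>|lborel. ?\<gamma> \<xi> * (cmod (fourier g \<xi>))\<^sup>2)
       = (LINT y|lborel. g y * (LINT z|lborel. cnj (g z) * ?G (y - z)))"
    proof -
      have "complex_of_real (LINT \<xi>|lborel. ?\<gamma> \<xi> * (cmod (fourier g \<xi>))\<^sup>2)
        = (LINT \<xi>|lborel. complex_of_real (?\<gamma> \<xi> * (cmod (fourier g \<xi>))\<^sup>2))"
        by (rule integral_complex_of_real[symmetric])
      also have "\<dots> = (LINT \<xi>|lborel. LINT y|lborel. ?\<gamma> \<xi> * cnj (fourier g \<xi>) * (g y * cis (- (2 * pi * y * \<xi>))))"
      proof (intro Bochner_Integration.integral_cong refl)
        fix \<xi>
        have "(LINT y|lborel. ?\<gamma> \<xi> * cnj (fourier g \<xi>) * (g y * cis (- (2 * pi * y * \<xi>))))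
           = ?\<gamma> \<xi> * cnj (fourier g \<xi>) * fourier g \<xi>"
          unfolding fourier_def by simp
        also have "\<dots> = complex_of_real (?\<gamma> \<xi> * (cmod (fourier g \<xi>))\<^sup>2)"
          by (simp add: complex_norm_square mult_ac del: of_real_power)
        finally show "complex_of_real (?\<gamma> \<xi> * (cmod (fourier g \<xi>))\<^sup>2) = (LINT y|lborel. ?\<gamma> \<xi> * cnj (fourier g \<xi>) * (g y * cis (- (2 * pi * y * \<xi>))))" ..
      qed
      also have "\<dots> = (LINT y|lborel. LINT \<xi>|lborel. ?\<gamma> \<xi> * cnj (fourier g \<xi>) * (g y * cis (- (2 * pi * y * \<xi>))))"
        using lborel_pair.Fubini_integral[OF int2] by simp
      finally show ?thesis unfolding inner .
    qed
    have "(\<integral>\<^sup>+\<xi>. ennreal (?\<gamma> \<xi> * (cmod (fourier g \<xi>))\<^sup>2) \<partial>lborel) = ennreal (LINT \<xi>|lborel. ?\<gamma> \<xi> * (cmod (fourier g \<xi>))\<^sup>2)"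
      by (rule nn_integral_eq_integral[OF int1]) simp
    also have "\<dots> = ennreal (norm (complex_of_real (LINT \<xi>|lborel. ?\<gamma> \<xi> * (cmod (fourier g \<xi>))\<^sup>2)))"
      by (simp add: integral_nonneg_AE)
    also have "\<dots> \<le> (\<integral>\<^sup>+y. ennreal (norm (g y * (LINT z|lborel. cnj (g z) * ?G (y - z)))) \<partial>lborel)"
      unfolding eq by (rule integral_norm_bound_ennreal')
    also have "\<dots> \<le> (\<integral>\<^sup>+y. \<integral>\<^sup>+z. ennreal (cmod (g y) * cmod (g z) * normal_density 0 \<sigma> (y - z)) \<partial>lborel \<partial>lborel)"
    proof (rule nn_integral_mono)
      fix y
      have "ennreal (norm (g y * (LINT z|lborel. cnj (g z) * ?G (y - z))))
         = ennreal (cmod (g y)) * ennreal (norm (LINT z|lborel. cnj (g z) * ?G (y - z)))"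
        by (simp add: norm_mult ennreal_mult)
      also have "\<dots> \<le> ennreal (cmod (g y)) * (\<integral>\<^sup>+z. ennreal (norm (cnj (g z) * ?G (y - z))) \<partial>lborel)"
        by (intro mult_left_mono integral_norm_bound_ennreal') simp
      also have "\<dots> = (\<integral>\<^sup>+z. ennreal (cmod (g y)) * ennreal (norm (cnj (g z) * ?G (y - z))) \<partial>lborel)"
        by (rule nn_integral_cmult[symmetric]) measurable
      also have "\<dots> = (\<integral>\<^sup>+z. ennreal (cmod (g y) * cmod (g z) * normal_density 0 \<sigma> (y - z)) \<partial>lborel)"
        by (intro nn_integral_cong) (simp add: norm_mult ennreal_mult mult.assoc)
      finally show "ennreal (norm (g y * (LINT z|lborel. cnj (g z) * ?G (y - z)))) \<le> \<dots>" .
    qed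
    also have "\<dots> \<le> (\<integral>\<^sup>+y. ennreal ((cmod (g y))\<^sup>2) \<partial>lborel)"
      by (rule nn_integral_normal_schur[OF _ \<sigma>]) measurable
    finally show ?thesis .
  qed
  let ?f = "\<lambda>n \<xi>. ennreal (exp (- (2 * pi * (1 / real (Suc n)) * \<xi>)\<^sup>2 / 2) * (cmod (fourier g \<xi>))\<^sup>2)"
  have lim: "(\<lambda>n. ?f n \<xi>) \<longlonglongrightarrow> ennreal ((cmod (fourier g \<xi>))\<^sup>2)" for \<xi>
  proof (rule tendsto_ennrealI)
    have "(\<lambda>n. 1 / real (Suc n)) \<longlonglongrightarrow> 0" using LIMSEQ_inverse_real_of_nat by (simp add: inverse_eq_divide)
    then have "(\<lambda>n. exp (- (2 * pi * (1 / real (Suc n)) * \<xi>)\<^sup>2 / 2) * (cmod (fourier g \<xi>))\<^sup>2)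
       \<longlonglongrightarrow> exp (- (2 * pi * 0 * \<xi>)\<^sup>2 / 2) * (cmod (fourier g \<xi>))\<^sup>2"
      by (intro tendsto_intros) auto
    then show "(\<lambda>n. exp (- (2 * pi * (1 / real (Suc n)) * \<xi>)\<^sup>2 / 2) * (cmod (fourier g \<xi>))\<^sup>2)
       \<longlonglongrightarrow> (cmod (fourier g \<xi>))\<^sup>2" by simp
  qed
  have "(\<integral>\<^sup>+\<xi>. ennreal ((cmod (fourier g \<xi>))\<^sup>2) \<partial>lborel) = (\<integral>\<^sup>+\<xi>. liminf (\<lambda>n. ?f n \<xi>) \<partial>lborel)"
    by (intro nn_integral_cong) (simp only: lim_imp_Liminf[OF sequentially_bot lim])
  also have "\<dots> \<le> liminf (\<lambda>n. \<integral>\<^sup>+\<xi>. ?f n \<xi> \<partial>lborel)"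
    by (rule nn_integral_liminf) measurable
  also have "\<dots> \<le> liminf (\<lambda>_::nat. \<integral>\<^sup>+y. ennreal ((cmod (g y))\<^sup>2) \<partial>lborel)"
    by (intro Liminf_mono always_eventually allI damped) simp
  also have "\<dots> = (\<integral>\<^sup>+y. ennreal ((cmod (g y))\<^sup>2) \<partial>lborel)"
    by (simp add: Liminf_const)
  finally show ?thesis .
qed

text \<open>Integrability of \<open>g\<close> itself is included so that \<open>fourier g\<close> is
  an absolutely convergent integral; integrability of the square makes \<open>energy\<close>
  meaningful, as the default value 0 would otherwise intervene.\<close>

definition square_integrable :: "(real \<Rightarrow> complex) \<Rightarrow> bool" where
  "square_integrable g \<longleftrightarrow> integrable lborel g \<and> integrable lborel (\<lambda>x. (cmod (g x))\<^sup>2)"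

definition energy :: "(real \<Rightarrow> complex) \<Rightarrow> real" where
  "energy g = (LINT x|lborel. (cmod (g x))\<^sup>2)"

lemma square_integrableD:
  assumes "square_integrable g"
  shows "integrable lborel g" "integrable lborel (\<lambda>x. (cmod (g x))\<^sup>2)" "g \<in> borel_measurable borel"
  using assms unfolding square_integrable_def by auto

lemma energy_nonneg [simp]: "0 \<le> energy g"
  unfolding energy_def by simp

lemma square_integrable_bound:
  assumes g: "square_integrable g" and [measurable]: "h \<in> borel_measurable borel"
    and le: "\<And>x. cmod (h x) \<le> c * cmod (g x)"
  shows "square_integrable h" and "energy h \<le> c\<^sup>2 * energy g"
proof -
  note g' = square_integrableD[OF g]
  have le2: "(cmod (h x))\<^sup>2 \<le> c\<^sup>2 * (cmod (g x))\<^sup>2" for x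
    using power_mono[OF le, of x 2] by (simp add: power_mult_distrib)
  have int: "integrable lborel (\<lambda>x. c\<^sup>2 * (cmod (g x))\<^sup>2)"
    using g'(2) by simp
  have 1: "integrable lborel h"
  proof (rule Bochner_Integration.integrable_bound)
    show "integrable lborel (\<lambda>x. of_real c * g x)" using g'(1) by simp
    show "AE x in lborel. cmod (h x) \<le> cmod (of_real c * g x)"
      using le by (auto simp: norm_mult intro!: AE_I2 order.trans[OF le] mult_right_mono)
  qed simp
  have 2: "integrable lborel (\<lambda>x. (cmod (h x))\<^sup>2)"
    by (rule Bochner_Integration.integrable_bound[OF int]) (use le2 in auto)
  show "square_integrable h" using 1 2 by (simp add: square_integrable_def)
  show "energy h \<le> c\<^sup>2 * energy g"
    unfolding energy_def using integral_mono[OF 2 int le2] by simp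
qed

lemma plancherel_le_energy:
  assumes g: "square_integrable g"
  shows "integrable lborel (\<lambda>\<xi>. (cmod (fourier g \<xi>))\<^sup>2)"
    and "(LINT \<xi>|lborel. (cmod (fourier g \<xi>))\<^sup>2) \<le> energy g"
proof -
  note g' = square_integrableD[OF g] and [measurable] = square_integrableD(3)[OF g]
  have *: "(\<integral>\<^sup>+\<xi>. ennreal ((cmod (fourier g \<xi>))\<^sup>2) \<partial>lborel) \<le> ennreal (energy g)"
    using plancherel_le[OF g'(1)] nn_integral_eq_integral[OF g'(2)] unfolding energy_def by simp
  then show int: "integrable lborel (\<lambda>\<xi>. (cmod (fourier g \<xi>))\<^sup>2)"
    by (intro integrableI_bounded) (auto intro: le_less_trans)
  from * show "(LINT \<xi>|lborel. (cmod (fourier g \<xi>))\<^sup>2) \<le> energy g"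
    using nn_integral_eq_integral[OF int] by simp
qed

text \<open>The inequality is the nonnegativity of the variance of \<open>F\<close> on the interval;
  \<open>m\<close> below is the mean.\<close>

lemma interval_Cauchy_Schwarz:
  fixes F :: "real \<Rightarrow> real"
  assumes [measurable]: "F \<in> borel_measurable borel" and bnd: "\<And>x. \<bar>F x\<bar> \<le> N" and pq: "p < q"
  shows "integrable lborel (\<lambda>x. indicator {p<..<q} x * F x)"
    and "integrable lborel (\<lambda>x. indicator {p<..<q} x * (F x)\<^sup>2)"
    and "(LINT x|lborel. indicator {p<..<q} x * F x)\<^sup>2
      \<le> (q - p) * (LINT x|lborel. indicator {p<..<q} x * (F x)\<^sup>2)"
proof -
  let ?i = "indicator {p<..<q} :: real \<Rightarrow> real"
  have i: "integrable lborel ?i" and i': "(LINT x|lborel. ?i x) = q - p"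
    using pq by (auto simp: integrable_indicator_iff)
  show 1: "integrable lborel (\<lambda>x. ?i x * F x)"
    by (rule Bochner_Integration.integrable_bound[OF integrable_mult_right[OF i, of N]])
       (auto simp: indicator_def intro!: AE_I2 order.trans[OF bnd abs_ge_self])
  have "\<bar>(F x)\<^sup>2\<bar> \<le> N\<^sup>2" for x using power_mono[OF bnd[of x], of 2] by simp
  then show 2: "integrable lborel (\<lambda>x. ?i x * (F x)\<^sup>2)"
    by (intro Bochner_Integration.integrable_bound[OF integrable_mult_right[OF i, of "N\<^sup>2"]])
       (auto simp: indicator_def)
  let ?I = "LINT x|lborel. ?i x * F x" and ?J = "LINT x|lborel. ?i x * (F x)\<^sup>2"
  define m where "m = ?I / (q - p)"
  have "0 \<le> (LINT x|lborel. ?i x * (F x - m)\<^sup>2)"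
    by (rule Bochner_Integration.integral_nonneg) auto
  also have "\<dots> = (LINT x|lborel. ?i x * (F x)\<^sup>2 - 2 * m * (?i x * F x) + m\<^sup>2 * ?i x)"
    by (intro Bochner_Integration.integral_cong refl) (simp add: power2_eq_square algebra_simps)
  also have "\<dots> = ?J - 2 * m * ?I + m\<^sup>2 * (q - p)"
    using 1 2 i i' by simp
  finally have *: "0 \<le> ?J - 2 * m * ?I + m\<^sup>2 * (q - p)" .
  have I: "?I = m * (q - p)" using pq by (simp add: m_def)
  have "0 \<le> ?J - m\<^sup>2 * (q - p)"
    using * unfolding I by (simp add: power2_eq_square algebra_simps)
  then have "0 \<le> (q - p) * (?J - m\<^sup>2 * (q - p))" using pq by simp
  then show "?I\<^sup>2 \<le> (q - p) * ?J"
    unfolding I by (simp add: power2_eq_square algebra_simps)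
qed

lemma norm_cis_diff_le: "cmod (cis s - cis t) \<le> \<bar>s - t\<bar>"
proof -
  have "cmod (cis s - cis t) = cmod (cis t * (cis (s - t) - 1))"
    by (simp add: algebra_simps cis_mult)
  also have "\<dots> = cmod (iexp (s - t) - 1)"
    by (simp add: norm_mult cis_conv_exp)
  also have "\<dots> \<le> \<bar>s - t\<bar>"
    using iexp_approx1[of "s - t" 0] by simp
  finally show ?thesis .
qed

subsection \<open>Families of intervals with bounded overlap\<close>

text \<open>A finite family of nondegenerate open intervals; \<open>weak_type_truncated\<close>
  reduces the general family to this case. The final constants may depend on \<open>B\<close> only,
  not on \<open>K\<close> or on the lengths.\<close>

locale interval_family =
  fixes K :: "'k set" and a b :: "'k \<Rightarrow> real" and B :: real
  assumes finite_K [simp]: "finite K"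
    and less: "\<And>k. k \<in> K \<Longrightarrow> a k < b k"
    and overlap: "\<And>\<xi>. (\<Sum>k\<in>K. indicator {a k<..<b k} \<xi>) \<le> B"
begin

lemma B_nonneg: "0 \<le> B"
  using overlap[of 0] by (meson order.trans sum_nonneg indicator_pos_le)

lemma sum_fourier_le:
  assumes g: "square_integrable g"
  shows "(\<Sum>k\<in>K. LINT \<xi>|lborel. indicator {a k<..<b k} \<xi> * (cmod (fourier g \<xi>))\<^sup>2) \<le> B * energy g"
proof -
  note pl = plancherel_le_energy[OF g] and [measurable] = square_integrableD(3)[OF g]
  have int: "integrable lborel (\<lambda>\<xi>. indicator {a k<..<b k} \<xi> * (cmod (fourier g \<xi>))\<^sup>2)" for k
    by (rule Bochner_Integration.integrable_bound[OF pl(1)]) (auto simp: indicator_def)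
  have "(\<Sum>k\<in>K. LINT \<xi>|lborel. indicator {a k<..<b k} \<xi> * (cmod (fourier g \<xi>))\<^sup>2)
     = (LINT \<xi>|lborel. (\<Sum>k\<in>K. indicator {a k<..<b k} \<xi>) * (cmod (fourier g \<xi>))\<^sup>2)"
    unfolding sum_distrib_right by (rule Bochner_Integration.integral_sum[symmetric]) (rule int)
  also have "\<dots> \<le> (LINT \<xi>|lborel. B * (cmod (fourier g \<xi>))\<^sup>2)"
  proof (rule integral_mono)
    show "integrable lborel (\<lambda>\<xi>. (\<Sum>k\<in>K. indicator {a k<..<b k} \<xi>) * (cmod (fourier g \<xi>))\<^sup>2)"
      unfolding sum_distrib_right by (intro Bochner_Integration.integrable_sum int)
  qed (auto intro!: mult_right_mono overlap pl(1))
  also have "\<dots> \<le> B * energy g"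
    using pl(2) B_nonneg by (simp add: mult_left_mono)
  finally show ?thesis .
qed

text \<open>A large sieve inequality: the value of the Fourier transform of a compactly supported function at a point
  is an average, over a short interval, of the Fourier transform of a comparable function.\<close>
lemma large_sieve:
  assumes h: "square_integrable h" and supp: "\<And>y. h y \<noteq> 0 \<Longrightarrow> \<bar>y - c\<bar> \<le> M"
    and \<delta>: "0 < \<delta>" "\<delta> * M \<le> 1 / 6" and s: "s = 1 \<or> s = - 1" and J: "J \<subseteq> K"
    and q: "\<And>k t. k \<in> J \<Longrightarrow> 0 < t \<Longrightarrow> t < \<delta> \<Longrightarrow> q k + s * t \<in> {a k<..<b k}"
  shows "(\<Sum>k\<in>J. (cmod (fourier h (q k)))\<^sup>2) \<le> 4 * B / \<delta> * energy h"
proof -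
  note h' = square_integrableD[OF h] and [measurable] = square_integrableD(3)[OF h]
  let ?i = "indicator {0<..<\<delta>} :: real \<Rightarrow> real"
  \<comment> \<open>\<open>\<psi>\<close> is the mean over 0 < t < \<delta> of the characters of
    frequency \<open>s * t\<close>, recentred at \<open>c\<close>. Writing
    \<open>h = ht * \<psi>\<close> makes \<open>fourier h p\<close> a mean of phases times
    \<open>fourier ht (p + s * t)\<close>; the sign \<open>s\<close> tells on which side of the
    sampling point the frequency interval lies.\<close>
  define \<psi> where "\<psi> y = (LINT t|lborel. complex_of_real (?i t / \<delta>) * cis (- (2 * pi * s * (y - c) * t)))" for y
  define ht where "ht y = h y / \<psi> y" for y
  have ii0: "integrable lborel ?i"
    using \<delta>(1) by (simp add: integrable_indicator_iff)
  have ii: "integrable lborel (\<lambda>t. complex_of_real (?i t / \<delta>))"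
    using \<delta>(1) by (intro integrable_of_real integrable_divide_zero) (auto simp: integrable_indicator_iff)
  have [measurable]: "\<psi> \<in> borel_measurable borel" unfolding \<psi>_def by measurable
  \<comment> \<open>Since \<open>\<delta> * M \<le> 1 / 6\<close>, all phases are at most pi/3 in
    size, where the cosine is at least 1/2. Dividing by \<open>\<psi>\<close> thus costs a factor 2,
    and the energy a factor 4, which is the 4 of the conclusion.\<close>
  have \<psi>: "1 / 2 \<le> cmod (\<psi> y)" if "\<bar>y - c\<bar> \<le> M" for y
  proof -
    have int: "integrable lborel (\<lambda>t. complex_of_real (?i t / \<delta>) * cis (- (2 * pi * s * (y - c) * t)))"
      by (intro integrable_mult_cis ii) measurable
    have "1 / 2 = (LINT t|lborel. ?i t / \<delta> * (1 / 2))"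
      using \<delta>(1) by simp
    also have "\<dots> \<le> (LINT t|lborel. Re (complex_of_real (?i t / \<delta>) * cis (- (2 * pi * s * (y - c) * t))))"
    proof (rule integral_mono)
      show "integrable lborel (\<lambda>t. ?i t / \<delta> * (1 / 2))"
        using ii0 by (intro integrable_mult_left integrable_divide_zero) auto
      show "integrable lborel (\<lambda>t. Re (complex_of_real (?i t / \<delta>) * cis (- (2 * pi * s * (y - c) * t))))"
        by (rule integrable_Re[OF int])
      fix t :: real
      show "?i t / \<delta> * (1 / 2) \<le> Re (complex_of_real (?i t / \<delta>) * cis (- (2 * pi * s * (y - c) * t)))"
      proof (cases "t \<in> {0<..<\<delta>}")
        case True
        have "\<bar>2 * pi * s * (y - c) * t\<bar> = 2 * pi * (\<bar>y - c\<bar> * t)"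
          using True s by (auto simp: abs_mult)
        also have "\<dots> \<le> 2 * pi * (M * \<delta>)"
          using True that by (intro mult_left_mono mult_mono) auto
        also have "\<dots> \<le> 2 * pi * (1 / 6)"
          using \<delta>(2) by (intro mult_left_mono) (auto simp: mult.commute)
        finally have *: "\<bar>2 * pi * s * (y - c) * t\<bar> \<le> pi / 3" by simp
        have "cos (pi / 3) \<le> cos \<bar>2 * pi * s * (y - c) * t\<bar>"
          using * by (intro cos_monotone_0_pi_le) auto
        then have "1 / 2 \<le> cos (2 * pi * s * (y - c) * t)" by (simp add: cos_60)
        then have "1 / \<delta> * (1 / 2) \<le> 1 / \<delta> * cos (2 * pi * s * (y - c) * t)"
          using \<delta>(1) by (intro mult_left_mono) auto
        then show ?thesis using True by simp
      qed auto
    qed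
    also have "\<dots> = Re (\<psi> y)"
      unfolding \<psi>_def by (rule integral_Re[OF int])
    also have "\<dots> \<le> cmod (\<psi> y)" by (rule complex_Re_le_cmod)
    finally show ?thesis .
  qed
  have ht_le: "cmod (ht y) \<le> 2 * cmod (h y)" for y
  proof (cases "h y = 0")
    case False
    from \<psi>[OF supp[OF this]] have "cmod (h y) * 1 \<le> cmod (h y) * (2 * cmod (\<psi> y))" by (intro mult_left_mono) auto
    moreover have "cmod (\<psi> y) > 0" using \<psi>[OF supp[OF False]] by linarith
    ultimately show ?thesis unfolding ht_def by (simp add: norm_divide field_simps)
  qed (simp add: ht_def)
  have [measurable]: "ht \<in> borel_measurable borel" unfolding ht_def by measurable
  note htb = square_integrable_bound[OF h, of ht, OF _ ht_le]
  have ht: "square_integrable ht" "energy ht \<le> 4 * energy h" using htb by auto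
  note ht' = square_integrableD[OF ht(1)]
  have rep: "fourier h p = (LINT t|lborel. complex_of_real (?i t / \<delta>) * cis (2 * pi * s * c * t) * fourier ht (p + s * t))" for p
  proof -
    let ?F = "\<lambda>t y. complex_of_real (?i t / \<delta>) * (ht y * cis (- (2 * pi * y * p)) * cis (- (2 * pi * s * (y - c) * t)))"
    have int: "integrable (lborel \<Otimes>\<^sub>M lborel) (\<lambda>(t, y). ?F t y)"
    proof (rule lborel_pair.Fubini_integrable)
      have *: "(LINT y|lborel. norm (?F t y)) = \<bar>?i t / \<delta>\<bar> * (LINT y|lborel. cmod (ht y))" for t
        by (simp add: norm_mult norm_divide)
      show "integrable lborel (\<lambda>t. LINT y|lborel. norm (case (t, y) of (t, y) \<Rightarrow> ?F t y))"
        unfolding prod.case * using ii0 by (intro integrable_mult_left integrable_abs integrable_divide_zero) auto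
      show "AE t in lborel. integrable lborel (\<lambda>y. case (t, y) of (t, y) \<Rightarrow> ?F t y)"
        unfolding prod.case by (intro AE_I2 integrable_mult_right integrable_mult_cis ht'(1)) measurable
    qed measurable
    have "(LINT t|lborel. complex_of_real (?i t / \<delta>) * cis (2 * pi * s * c * t) * fourier ht (p + s * t))
      = (LINT t|lborel. LINT y|lborel. ?F t y)"
    proof (intro Bochner_Integration.integral_cong refl)
      fix t
      have "cis (2 * pi * s * c * t) * fourier ht (p + s * t)
        = (LINT y|lborel. cis (2 * pi * s * c * t) * (ht y * cis (- (2 * pi * y * (p + s * t)))))"
        unfolding fourier_def by simp
      also have "\<dots> = (LINT y|lborel. ht y * cis (- (2 * pi * y * p)) * cis (- (2 * pi * s * (y - c) * t)))"
      proof (intro Bochner_Integration.integral_cong refl)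
        fix y
        have "2 * pi * s * c * t + - (2 * pi * y * (p + s * t)) = - (2 * pi * y * p) + - (2 * pi * s * (y - c) * t)"
          by (simp add: algebra_simps)
        then have "cis (2 * pi * s * c * t) * cis (- (2 * pi * y * (p + s * t)))
          = cis (- (2 * pi * y * p)) * cis (- (2 * pi * s * (y - c) * t))"
          unfolding cis_mult by simp
        then show "cis (2 * pi * s * c * t) * (ht y * cis (- (2 * pi * y * (p + s * t))))
          = ht y * cis (- (2 * pi * y * p)) * cis (- (2 * pi * s * (y - c) * t))"
          by (metis mult.left_commute mult.assoc)
      qed
      finally show "complex_of_real (?i t / \<delta>) * cis (2 * pi * s * c * t) * fourier ht (p + s * t) = (LINT y|lborel. ?F t y)"
        unfolding integral_mult_right_zero by (simp only: mult.assoc)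
    qed
    also have "\<dots> = (LINT y|lborel. LINT t|lborel. ?F t y)"
      by (rule lborel_pair.Fubini_integral[OF int, symmetric])
    also have "\<dots> = (LINT y|lborel. h y * cis (- (2 * pi * y * p)))"
    proof (intro Bochner_Integration.integral_cong refl)
      fix y
      have "(LINT t|lborel. ?F t y) = (LINT t|lborel. ht y * cis (- (2 * pi * y * p)) *
         (complex_of_real (?i t / \<delta>) * cis (- (2 * pi * s * (y - c) * t))))"
        by (simp only: mult_ac)
      also have "\<dots> = ht y * cis (- (2 * pi * y * p)) * \<psi> y"
        unfolding \<psi>_def integral_mult_right_zero ..
      also have "\<dots> = h y * cis (- (2 * pi * y * p))"
      proof (cases "h y = 0")
        case False
        then have "\<psi> y \<noteq> 0" using \<psi>[OF supp] by fastforce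
        then show ?thesis by (simp add: ht_def)
      qed (simp add: ht_def)
      finally show "(LINT t|lborel. ?F t y) = h y * cis (- (2 * pi * y * p))" .
    qed
    finally show ?thesis unfolding fourier_def ..
  qed
  \<comment> \<open>Cauchy-Schwarz over an interval of length \<delta> turns the point value into an
    integral over the k-th frequency interval, so that \<open>sum_fourier_le\<close> can sum over
    k.\<close>
  have single: "(cmod (fourier h (q k)))\<^sup>2 \<le> (1 / \<delta>) * (LINT \<xi>|lborel. indicator {a k<..<b k} \<xi> * (cmod (fourier ht \<xi>))\<^sup>2)"
    if k: "k \<in> J" for k
  proof -
    let ?G = "\<lambda>t. cmod (fourier ht (q k + s * t))"
    let ?N = "LINT y|lborel. cmod (ht y)"
    have Gb: "\<bar>?G t\<bar> \<le> ?N" for t using norm_fourier_le[OF ht'(1)] by simp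
    have [measurable]: "?G \<in> borel_measurable borel" by measurable
    note CS = interval_Cauchy_Schwarz[OF this Gb \<delta>(1)]
    have "cmod (fourier h (q k)) \<le> (LINT t|lborel. cmod (complex_of_real (?i t / \<delta>) * cis (2 * pi * s * c * t) * fourier ht (q k + s * t)))"
      unfolding rep by (rule integral_norm_bound)
    also have "\<dots> = (LINT t|lborel. (1 / \<delta>) * (?i t * ?G t))"
      using \<delta>(1) by (simp add: norm_mult norm_divide)
    also have "\<dots> = (1 / \<delta>) * (LINT t|lborel. ?i t * ?G t)" by (rule integral_mult_right_zero)
    finally have "(cmod (fourier h (q k)))\<^sup>2 \<le> ((1 / \<delta>) * (LINT t|lborel. ?i t * ?G t))\<^sup>2"
      by (rule power_mono) simp
    also have "\<dots> = (1 / \<delta>)\<^sup>2 * (LINT t|lborel. ?i t * ?G t)\<^sup>2" by (rule power_mult_distrib)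
    also have "\<dots> \<le> (1 / \<delta>)\<^sup>2 * (\<delta> * (LINT t|lborel. ?i t * (?G t)\<^sup>2))"
      using CS(3) by (intro mult_left_mono) auto
    also have "\<dots> = (1 / \<delta>) * (LINT t|lborel. ?i t * (?G t)\<^sup>2)"
      using \<delta>(1) by (simp add: power2_eq_square)
    also have "(LINT t|lborel. ?i t * (?G t)\<^sup>2) \<le> (LINT t|lborel. indicator {a k<..<b k} (q k + s * t) * (?G t)\<^sup>2)"
    proof (rule integral_mono)
      show "integrable lborel (\<lambda>t. ?i t * (?G t)\<^sup>2)" by (rule CS(2))
      have "integrable lborel (\<lambda>\<xi>. indicator {a k<..<b k} \<xi> * (cmod (fourier ht \<xi>))\<^sup>2)"
        by (rule Bochner_Integration.integrable_bound[OF plancherel_le_energy(1)[OF ht(1)]]) (auto simp: indicator_def)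
      from lborel_integrable_real_affine[OF this, of s "q k"] s
      show "integrable lborel (\<lambda>t. indicator {a k<..<b k} (q k + s * t) * (?G t)\<^sup>2)" by auto
      show "?i t * (?G t)\<^sup>2 \<le> indicator {a k<..<b k} (q k + s * t) * (?G t)\<^sup>2" for t
        using q[OF k, of t] by (auto simp: indicator_def)
    qed
    also have "\<dots> = (LINT \<xi>|lborel. indicator {a k<..<b k} \<xi> * (cmod (fourier ht \<xi>))\<^sup>2)"
      using s by (subst lborel_integral_real_affine[of s _ "q k"]) auto
    finally show ?thesis using \<delta>(1) by (simp add: divide_right_mono)
  qed
  have "(\<Sum>k\<in>J. (cmod (fourier h (q k)))\<^sup>2)
    \<le> (\<Sum>k\<in>J. (1 / \<delta>) * (LINT \<xi>|lborel. indicator {a k<..<b k} \<xi> * (cmod (fourier ht \<xi>))\<^sup>2))"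
    by (intro sum_mono single)
  also have "\<dots> \<le> (\<Sum>k\<in>K. (1 / \<delta>) * (LINT \<xi>|lborel. indicator {a k<..<b k} \<xi> * (cmod (fourier ht \<xi>))\<^sup>2))"
    using J \<delta>(1) by (intro sum_mono2) auto
  also have "\<dots> = (1 / \<delta>) * (\<Sum>k\<in>K. (LINT \<xi>|lborel. indicator {a k<..<b k} \<xi> * (cmod (fourier ht \<xi>))\<^sup>2))"
    by (rule sum_distrib_left[symmetric])
  also have "\<dots> \<le> (1 / \<delta>) * (B * (4 * energy h))"
    using \<delta>(1) B_nonneg ht(2) by (intro mult_left_mono order.trans[OF sum_fourier_le[OF ht(1)]]) auto
  finally show ?thesis by (simp add: mult_ac)
qed

end

subsection \<open>Ramp multipliers\<close>

definition ramp_symbol :: "real \<Rightarrow> real \<Rightarrow> real \<Rightarrow> real" where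
  "ramp_symbol a b \<xi> = indicator {a<..<b} \<xi> * ((b - \<xi>) / (b - a))"

lemma borel_measurable_ramp_symbol [measurable]: "ramp_symbol a b \<in> borel_measurable borel"
  unfolding ramp_symbol_def[abs_def] by measurable

text \<open>Multiplier operator whose symbol decreases linearly from 1 to 0 on an interval, demodulated at the left
  endpoint. Since the symbol vanishes at the right endpoint, the demodulated kernel varies slowly at all scales.\<close>
definition ramp :: "real \<Rightarrow> real \<Rightarrow> (real \<Rightarrow> complex) \<Rightarrow> real \<Rightarrow> complex" where
  "ramp a b g x = (LINT \<xi>|lborel. complex_of_real (ramp_symbol a b \<xi>)
     * fourier g \<xi> * cis (2 * pi * x * (\<xi> - a)))"

lemma ramp_symbol_bound:
  assumes "a < b"
  shows "\<bar>ramp_symbol a b \<xi>\<bar> \<le> indicator {a<..<b} \<xi>"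
  using assms by (auto simp: ramp_symbol_def indicator_def divide_le_eq_1)

lemma integrable_ramp_symbol:
  assumes g: "integrable lborel g" and ab: "a < b"
  shows "integrable lborel (\<lambda>\<xi>. complex_of_real (ramp_symbol a b \<xi>) * fourier g \<xi>)"
proof -
  have [measurable]: "g \<in> borel_measurable borel" using g by auto
  let ?N = "LINT y|lborel. cmod (g y)"
  show ?thesis
  proof (rule Bochner_Integration.integrable_bound)
    show "integrable lborel (\<lambda>\<xi>. ?N * indicator {a<..<b} \<xi> :: real)"
      using ab by (intro integrable_mult_right) (simp add: integrable_indicator_iff)
    show "AE \<xi> in lborel. norm (complex_of_real (ramp_symbol a b \<xi>) * fourier g \<xi>)
      \<le> norm (?N * indicator {a<..<b} \<xi> :: real)"
    proof (rule AE_I2)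
      fix \<xi>
      show "norm (complex_of_real (ramp_symbol a b \<xi>) * fourier g \<xi>)
        \<le> norm (?N * indicator {a<..<b} \<xi> :: real)"
        using mult_mono[OF ramp_symbol_bound[OF ab, of \<xi>] norm_fourier_le[OF g, of \<xi>]]
        by (simp add: norm_mult mult.commute abs_mult)
    qed
  qed measurable
qed

lemma integrable_ramp:
  assumes "integrable lborel g" "a < b"
  shows "integrable lborel (\<lambda>\<xi>. complex_of_real (ramp_symbol a b \<xi>)
     * fourier g \<xi> * cis (2 * pi * x * (\<xi> - a)))"
  by (intro integrable_mult_cis integrable_ramp_symbol assms) measurable

lemma borel_measurable_ramp [measurable]:
  assumes [measurable]: "g \<in> borel_measurable borel"
  shows "ramp a b g \<in> borel_measurable borel"
  unfolding ramp_def[abs_def] by measurable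

lemma fourier_add:
  assumes "integrable lborel g" "integrable lborel h"
  shows "fourier (\<lambda>x. g x + h x) \<xi> = fourier g \<xi> + fourier h \<xi>"
  unfolding fourier_def using assms
  by (simp add: ring_distribs integrable_mult_cis)

lemma fourier_cmult: "fourier (\<lambda>x. c * g x) \<xi> = c * fourier g \<xi>"
  unfolding fourier_def by (simp add: mult.assoc)

lemma ramp_add:
  assumes "integrable lborel g" "integrable lborel h" "a < b"
  shows "ramp a b (\<lambda>x. g x + h x) x = ramp a b g x + ramp a b h x"
  unfolding ramp_def fourier_add[OF assms(1,2)] distrib_left distrib_right
  by (intro Bochner_Integration.integral_add integrable_ramp assms)

lemma ramp_cmult: "ramp a b (\<lambda>x. c * g x) x = c * ramp a b g x"
proof -
  have "ramp a b (\<lambda>x. c * g x) x = (LINT \<xi>|lborel. c * (complex_of_real (ramp_symbol a b \<xi>)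
     * fourier g \<xi> * cis (2 * pi * x * (\<xi> - a))))"
    unfolding ramp_def fourier_cmult by (simp only: mult_ac)
  then show ?thesis unfolding ramp_def by simp
qed

lemma ramp_zero [simp]: "ramp a b (\<lambda>x. 0) x = 0"
  using ramp_cmult[of a b 0 "\<lambda>_. 0" x] by simp

text \<open>A crude bound that depends on the length of the frequency interval and so cannot enter a
  constant. By way of \<open>ramp_norm_le\<close> it makes the remainder of the stopping-time
  iteration small in \<open>V_dil_small\<close>.\<close>

lemma norm_ramp_le:
  assumes g: "integrable lborel g" and ab: "a < b"
  shows "cmod (ramp a b g x) \<le> (b - a) * (LINT y|lborel. cmod (g y))"
proof -
  let ?N = "LINT y|lborel. cmod (g y)"
  have "cmod (ramp a b g x) \<le> (LINT \<xi>|lborel. norm (complex_of_real (ramp_symbol a b \<xi>)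
     * fourier g \<xi> * cis (2 * pi * x * (\<xi> - a))))"
    unfolding ramp_def by (rule integral_norm_bound)
  also have "\<dots> \<le> (LINT \<xi>|lborel. indicator {a<..<b} \<xi> * ?N)"
  proof (rule integral_mono)
    show "integrable lborel (\<lambda>\<xi>. indicator {a<..<b} \<xi> * ?N)"
      using ab by (intro integrable_mult_left) (simp add: integrable_indicator_iff)
    fix \<xi>
    show "norm (complex_of_real (ramp_symbol a b \<xi>)
     * fourier g \<xi> * cis (2 * pi * x * (\<xi> - a))) \<le> indicator {a<..<b} \<xi> * ?N"
      using mult_mono[OF ramp_symbol_bound[OF ab, of \<xi>] norm_fourier_le[OF g, of \<xi>]]
      by (simp add: norm_mult abs_mult)
  qed (intro integrable_norm integrable_ramp assms)
  also have "\<dots> = (b - a) * ?N" using ab by simp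
  finally show ?thesis .
qed

text \<open>Up to a unimodular factor, \<open>ramp a b g x\<close> is the Fourier transform at -x of
  symbol times \<open>fourier g\<close>, so \<open>plancherel_le\<close> also serves for the way
  back. The restriction to {a<..<b} is kept on the right for the later sum over k.\<close>

lemma ramp_L2:
  assumes g: "square_integrable g" and ab: "a < b"
  shows "integrable lborel (\<lambda>x. (cmod (ramp a b g x))\<^sup>2)"
    and "(LINT x|lborel. (cmod (ramp a b g x))\<^sup>2)
      \<le> (LINT \<xi>|lborel. indicator {a<..<b} \<xi> * (cmod (fourier g \<xi>))\<^sup>2)"
proof -
  note g' = square_integrableD[OF g] and [measurable] = square_integrableD(3)[OF g]
  define m where "m \<xi> = complex_of_real (ramp_symbol a b \<xi>) * fourier g \<xi>" for \<xi>
  have m1: "integrable lborel m" unfolding m_def by (rule integrable_ramp_symbol[OF g'(1) ab])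
  have le: "(cmod (m \<xi>))\<^sup>2 \<le> indicator {a<..<b} \<xi> * (cmod (fourier g \<xi>))\<^sup>2" for \<xi>
  proof -
    have "cmod (m \<xi>) \<le> indicator {a<..<b} \<xi> * cmod (fourier g \<xi>)"
      using mult_right_mono[OF ramp_symbol_bound[OF ab, of \<xi>], of "cmod (fourier g \<xi>)"]
      by (simp add: norm_mult abs_mult m_def)
    from power_mono[OF this, of 2] show ?thesis
      by (auto simp: power_mult_distrib indicator_def)
  qed
  have i: "integrable lborel (\<lambda>\<xi>. indicator {a<..<b} \<xi> * (cmod (fourier g \<xi>))\<^sup>2)"
    by (rule Bochner_Integration.integrable_bound[OF plancherel_le_energy(1)[OF g]]) (auto simp: indicator_def)
  have [measurable]: "m \<in> borel_measurable borel" using m1 by auto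
  have m2: "integrable lborel (\<lambda>\<xi>. (cmod (m \<xi>))\<^sup>2)"
    by (rule Bochner_Integration.integrable_bound[OF i]) (use le in \<open>auto intro!: AE_I2 order.trans[OF le]\<close>)
  have m: "square_integrable m" using m1 m2 by (simp add: square_integrable_def)
  have eq: "cmod (ramp a b g x) = cmod (fourier m (0 + (-1) * x))" for x
  proof -
    have "ramp a b g x = (LINT \<xi>|lborel. cis (- (2 * pi * x * a)) * (m \<xi> * cis (- (2 * pi * \<xi> * (0 + (-1) * x)))))"
      unfolding ramp_def
    proof (intro Bochner_Integration.integral_cong refl)
      fix \<xi>
      have "cis (2 * pi * x * (\<xi> - a)) = cis (- (2 * pi * x * a)) * cis (- (2 * pi * \<xi> * (0 + (-1) * x)))"
        unfolding cis_mult by (simp add: algebra_simps)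
      then show "complex_of_real (ramp_symbol a b \<xi>) * fourier g \<xi> * cis (2 * pi * x * (\<xi> - a))
        = cis (- (2 * pi * x * a)) * (m \<xi> * cis (- (2 * pi * \<xi> * (0 + (-1) * x))))"
        unfolding m_def by (simp only: mult_ac)
    qed
    also have "\<dots> = cis (- (2 * pi * x * a)) * fourier m (0 + (-1) * x)"
      unfolding fourier_def by (rule integral_mult_right_zero)
    finally show ?thesis by (simp add: norm_mult)
  qed
  note pl = plancherel_le_energy[OF m]
  show "integrable lborel (\<lambda>x. (cmod (ramp a b g x))\<^sup>2)"
    unfolding eq by (rule lborel_integrable_real_affine[OF pl(1)]) simp
  have "(LINT x|lborel. (cmod (ramp a b g x))\<^sup>2) = (LINT \<xi>|lborel. (cmod (fourier m \<xi>))\<^sup>2)"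
    unfolding eq by (subst (2) lborel_integral_real_affine[of "-1" _ 0]) auto
  also have "\<dots> \<le> energy m" by (rule pl(2))
  also have "\<dots> \<le> (LINT \<xi>|lborel. indicator {a<..<b} \<xi> * (cmod (fourier g \<xi>))\<^sup>2)"
    unfolding energy_def by (intro integral_mono m2 i le)
  finally show "(LINT x|lborel. (cmod (ramp a b g x))\<^sup>2)
      \<le> (LINT \<xi>|lborel. indicator {a<..<b} \<xi> * (cmod (fourier g \<xi>))\<^sup>2)" .
qed

definition ramp_kernel :: "real \<Rightarrow> real \<Rightarrow> complex" where
  "ramp_kernel L z = (LINT t|lborel. complex_of_real (ramp_symbol 0 L t) * cis (2 * pi * z * t))"

text \<open>The term of size 1/z comes from the jump at 0 and does not see \<open>L\<close>. The end
  at \<open>L\<close> contributes only at order 1/(L z^2), since the symbol vanishes there. The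
  antiderivative \<open>?F\<close> is one integration by parts.\<close>

lemma ramp_kernel_eq:
  assumes L: "0 < L" and z: "z \<noteq> 0"
  shows "ramp_kernel L z = \<i> / (2 * pi * z) - (cis (2 * pi * L * z) - 1) / (4 * pi\<^sup>2 * L * z\<^sup>2)"
proof -
  let ?c = "2 * pi * z" 
  let ?F = "\<lambda>t::real. complex_of_real ((L - t) / L) * (cis (?c * t) / (\<i> * ?c)) - cis (?c * t) / (L * ?c\<^sup>2)"
  let ?f = "\<lambda>t::real. complex_of_real ((L - t) / L) * cis (?c * t)"
  have c: "?c \<noteq> 0" using z by simp
  have cis_deriv: "((\<lambda>t. cis (?c * t)) has_vector_derivative (\<i> * ?c * cis (?c * t))) (at t within S)" for t S
  proof -
    have "((\<lambda>t. exp (\<i> * complex_of_real ?c * complex_of_real t)) has_vector_derivative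
      \<i> * complex_of_real ?c * exp (\<i> * complex_of_real ?c * complex_of_real t)) (at t within S)"
      by (rule has_vector_derivative_real_field) (auto intro!: derivative_eq_intros)
    then show ?thesis unfolding cis_conv_exp by (simp add: mult_ac)
  qed
  have "((\<lambda>t. complex_of_real ((L - t) / L)) has_vector_derivative complex_of_real (- 1 / L)) (at t within S)" for t S
    by (intro has_vector_derivative_of_real) (use L in \<open>auto intro!: derivative_eq_intros\<close>)
  note lin_deriv = this
  have deriv: "(?F has_vector_derivative ?f t) (at t within S)" for t S
  proof -
    have "(?F has_vector_derivative
      (complex_of_real ((L - t) / L) * (\<i> * ?c * cis (?c * t) / (\<i> * ?c)) + complex_of_real (- 1 / L) * (cis (?c * t) / (\<i> * ?c)))
       - \<i> * ?c * cis (?c * t) / (L * ?c\<^sup>2)) (at t within S)"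
      by (intro has_vector_derivative_diff has_vector_derivative_mult has_vector_derivative_divide cis_deriv lin_deriv)
    moreover have "(complex_of_real ((L - t) / L) * (\<i> * ?c * cis (?c * t) / (\<i> * ?c)) + complex_of_real (- 1 / L) * (cis (?c * t) / (\<i> * ?c)))
       - \<i> * ?c * cis (?c * t) / (L * ?c\<^sup>2) = ?f t"
      using c L by (simp add: field_simps power2_eq_square)
    ultimately show ?thesis by simp
  qed
  have cont: "continuous_on {0..L} ?f"
    by (intro continuous_intros) (use L in auto)
  have "ramp_kernel L z = (LINT t|lborel. indicator {0..L} t *\<^sub>R ?f t)"
    unfolding ramp_kernel_def
  proof (rule integral_cong_AE)
    \<comment> \<open>The symbol is 0 at t = 0 while \<open>?f\<close> is 1 there; at t = L both
      vanish, so only one point is exceptional.\<close>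
    have "AE t in lborel. t \<noteq> (0::real)" by (rule AE_lborel_singleton)
    then show "AE t in lborel. complex_of_real (ramp_symbol 0 L t) * cis (2 * pi * z * t)
       = indicator {0..L} t *\<^sub>R ?f t"
      by eventually_elim (use L in \<open>auto simp: ramp_symbol_def indicator_def\<close>)
  qed measurable
  also have "\<dots> = ?F L - ?F 0"
    using L by (intro integral_FTC_Icc deriv cont) auto
  also have "\<dots> = \<i> / (2 * pi * z) - (cis (2 * pi * L * z) - 1) / (4 * pi\<^sup>2 * L * z\<^sup>2)"
    using c L z by (simp add: field_simps power2_eq_square)
  finally show ?thesis .
qed

text \<open>Demodulation at \<open>a\<close> moves the position of the frequency interval into a
  modulation of \<open>g\<close>; the kernel is left with its length only.\<close>

lemma ramp_conv_kernel:
  assumes g: "integrable lborel g" and ab: "a < b"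
  shows "ramp a b g x = (LINT y|lborel. g y * cis (- (2 * pi * a * y)) * ramp_kernel (b - a) (x - y))"
    and "integrable lborel (\<lambda>y. g y * cis (- (2 * pi * a * y)) * ramp_kernel (b - a) (x - y))"
proof -
  have [measurable]: "g \<in> borel_measurable borel" using g by auto
  let ?m = "\<lambda>\<xi>. ramp_symbol a b \<xi>"
  let ?F = "\<lambda>\<xi> y. complex_of_real (?m \<xi>) * (g y * cis (2 * pi * (x * (\<xi> - a) - y * \<xi>)))"
  have int: "integrable (lborel \<Otimes>\<^sub>M lborel) (\<lambda>(\<xi>, y). ?F \<xi> y)"
  proof (rule lborel_pair.Fubini_integrable)
    have *: "(LINT y|lborel. norm (?F \<xi> y)) = \<bar>?m \<xi>\<bar> * (LINT y|lborel. cmod (g y))" for \<xi>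
      by (simp add: norm_mult)
    have "integrable lborel ?m"
    proof (rule Bochner_Integration.integrable_bound)
      show "integrable lborel (indicator {a<..<b} :: real \<Rightarrow> real)"
        using ab by (simp add: integrable_indicator_iff)
    qed (use ramp_symbol_bound[OF ab] in auto)
    then show "integrable lborel (\<lambda>\<xi>. LINT y|lborel. norm (case (\<xi>, y) of (\<xi>, y) \<Rightarrow> ?F \<xi> y))"
      unfolding prod.case * by (intro integrable_mult_left integrable_abs)
    show "AE \<xi> in lborel. integrable lborel (\<lambda>y. case (\<xi>, y) of (\<xi>, y) \<Rightarrow> ?F \<xi> y)"
      unfolding prod.case by (intro AE_I2 integrable_mult_right integrable_mult_cis g) measurable
  qed measurable
  have inner: "(LINT \<xi>|lborel. ?F \<xi> y) = g y * cis (- (2 * pi * a * y)) * ramp_kernel (b - a) (x - y)" for y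
  proof -
    have "(LINT \<xi>|lborel. ?F \<xi> y) = (LINT t|lborel. ?F (a + 1 * t) y)"
      by (subst lborel_integral_real_affine[of 1 _ a]) auto
    also have "\<dots> = (LINT t|lborel. (g y * cis (- (2 * pi * a * y))) *
        (complex_of_real (ramp_symbol 0 (b - a) t) * cis (2 * pi * (x - y) * t)))"
    proof (intro Bochner_Integration.integral_cong refl)
      fix t
      have 1: "?m (a + 1 * t) = ramp_symbol 0 (b - a) t"
        by (auto simp: ramp_symbol_def indicator_def algebra_simps)
      have 2: "cis (2 * pi * (x * ((a + 1 * t) - a) - y * (a + 1 * t))) = cis (- (2 * pi * a * y)) * cis (2 * pi * (x - y) * t)"
        unfolding cis_mult by (simp add: algebra_simps)
      show "?F (a + 1 * t) y = (g y * cis (- (2 * pi * a * y))) *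
        (complex_of_real (ramp_symbol 0 (b - a) t) * cis (2 * pi * (x - y) * t))"
        unfolding 1 2 by (simp only: mult_ac)
    qed
    also have "\<dots> = g y * cis (- (2 * pi * a * y)) * ramp_kernel (b - a) (x - y)"
      unfolding ramp_kernel_def by (rule integral_mult_right_zero)
    finally show ?thesis .
  qed
  have "ramp a b g x = (LINT \<xi>|lborel. LINT y|lborel. ?F \<xi> y)"
    unfolding ramp_def
  proof (intro Bochner_Integration.integral_cong refl)
    fix \<xi>
    have "complex_of_real (?m \<xi>) * fourier g \<xi> * cis (2 * pi * x * (\<xi> - a))
      = (LINT y|lborel. complex_of_real (?m \<xi>) * cis (2 * pi * x * (\<xi> - a)) * (g y * cis (- (2 * pi * y * \<xi>))))"
      unfolding fourier_def integral_mult_right_zero by (simp only: mult_ac)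
    also have "\<dots> = (LINT y|lborel. ?F \<xi> y)"
    proof (intro Bochner_Integration.integral_cong refl)
      fix y
      have "cis (2 * pi * (x * (\<xi> - a) - y * \<xi>)) = cis (2 * pi * x * (\<xi> - a)) * cis (- (2 * pi * y * \<xi>))"
        unfolding cis_mult by (simp add: algebra_simps)
      then show "complex_of_real (?m \<xi>) * cis (2 * pi * x * (\<xi> - a)) * (g y * cis (- (2 * pi * y * \<xi>))) = ?F \<xi> y"
        by (simp only: mult_ac)
    qed
    finally show "complex_of_real (?m \<xi>) * fourier g \<xi> * cis (2 * pi * x * (\<xi> - a)) = (LINT y|lborel. ?F \<xi> y)" .
  qed
  also have "\<dots> = (LINT y|lborel. LINT \<xi>|lborel. ?F \<xi> y)"
    by (rule lborel_pair.Fubini_integral[OF int, symmetric])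
  finally show "ramp a b g x = (LINT y|lborel. g y * cis (- (2 * pi * a * y)) * ramp_kernel (b - a) (x - y))"
    unfolding inner .
  show "integrable lborel (\<lambda>y. g y * cis (- (2 * pi * a * y)) * ramp_kernel (b - a) (x - y))"
    using lborel_pair.integrable_snd[OF int] unfolding inner .
qed

lemma sum_four_square_le:
  fixes p q r s :: real
  shows "(p + q + r + s)\<^sup>2 \<le> 4 * (p\<^sup>2 + q\<^sup>2 + r\<^sup>2 + s\<^sup>2)"
proof -
  have "0 \<le> (p - q)\<^sup>2 + (p - r)\<^sup>2 + (p - s)\<^sup>2 + (q - r)\<^sup>2 + (q - s)\<^sup>2 + (r - s)\<^sup>2"
    by simp
  then show ?thesis by (simp add: power2_eq_square algebra_simps)
qed

section \<open>The vector of all ramps and its oscillation\<close>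

context interval_family
begin

definition ramp_norm :: "(real \<Rightarrow> complex) \<Rightarrow> real \<Rightarrow> real" where
  "ramp_norm g x = L2_set (\<lambda>k. cmod (ramp (a k) (b k) g x)) K"

lemma ramp_norm_nonneg [simp]: "0 \<le> ramp_norm g x"
  unfolding ramp_norm_def by (rule L2_set_nonneg)

lemma borel_measurable_ramp_norm [measurable]:
  assumes [measurable]: "g \<in> borel_measurable borel"
  shows "ramp_norm g \<in> borel_measurable borel"
  unfolding ramp_norm_def[abs_def] L2_set_def by measurable

lemma ramp_norm_cmult: "ramp_norm (\<lambda>x. c * g x) x = cmod c * ramp_norm g x"
  unfolding ramp_norm_def ramp_cmult norm_mult by (simp add: L2_set_right_distrib)

lemma ramp_norm_add_le:
  assumes "integrable lborel g" "integrable lborel h"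
  shows "ramp_norm (\<lambda>x. g x + h x) x \<le> ramp_norm g x + ramp_norm h x"
proof -
  have "ramp_norm (\<lambda>x. g x + h x) x \<le> L2_set (\<lambda>k. cmod (ramp (a k) (b k) g x) + cmod (ramp (a k) (b k) h x)) K"
    unfolding ramp_norm_def
    by (rule L2_set_mono) (auto simp: ramp_add[OF assms less] intro: norm_triangle_ineq)
  also have "\<dots> \<le> ramp_norm g x + ramp_norm h x"
    unfolding ramp_norm_def by (rule L2_set_triangle_ineq)
  finally show ?thesis .
qed

lemma ramp_norm_le:
  assumes "integrable lborel g"
  shows "ramp_norm g x \<le> (\<Sum>k\<in>K. b k - a k) * (LINT y|lborel. cmod (g y))"
proof -
  have "ramp_norm g x \<le> (\<Sum>k\<in>K. cmod (ramp (a k) (b k) g x))"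
    unfolding ramp_norm_def by (rule L2_set_le_sum) simp
  also have "\<dots> \<le> (\<Sum>k\<in>K. (b k - a k) * (LINT y|lborel. cmod (g y)))"
    by (intro sum_mono norm_ramp_le assms less)
  finally show ?thesis by (simp add: sum_distrib_right)
qed

lemma ramp_norm_L2:
  assumes g: "square_integrable g"
  shows "integrable lborel (\<lambda>x. (ramp_norm g x)\<^sup>2)"
    and "(LINT x|lborel. (ramp_norm g x)\<^sup>2) \<le> B * energy g"
proof -
  have eq: "(ramp_norm g x)\<^sup>2 = (\<Sum>k\<in>K. (cmod (ramp (a k) (b k) g x))\<^sup>2)" for x
    unfolding ramp_norm_def L2_set_def by (simp add: sum_nonneg)
  show "integrable lborel (\<lambda>x. (ramp_norm g x)\<^sup>2)"
    unfolding eq by (intro Bochner_Integration.integrable_sum ramp_L2(1)[OF g] less)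
  have "(LINT x|lborel. (ramp_norm g x)\<^sup>2) = (\<Sum>k\<in>K. LINT x|lborel. (cmod (ramp (a k) (b k) g x))\<^sup>2)"
    unfolding eq by (intro Bochner_Integration.integral_sum ramp_L2(1)[OF g] less)
  also have "\<dots> \<le> (\<Sum>k\<in>K. LINT \<xi>|lborel. indicator {a k<..<b k} \<xi> * (cmod (fourier g \<xi>))\<^sup>2)"
    by (intro sum_mono ramp_L2(2)[OF g] less)
  also have "\<dots> \<le> B * energy g" by (rule sum_fourier_le[OF g])
  finally show "(LINT x|lborel. (ramp_norm g x)\<^sup>2) \<le> B * energy g" .
qed

text \<open>A Bernstein inequality: after demodulation the frequencies lie in (0, L), so a shift by
  u - v costs 2 pi L |u - v| < 8 L |u - v|. Cauchy-Schwarz on the interval adds one more factor L to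
  the square, and L \<le> 1/R gives the power R^(-3).\<close>

lemma ramp_diff_short:
  assumes g: "square_integrable g" and R: "0 < R" and k: "k \<in> K" and short: "(b k - a k) * R \<le> 1"
  shows "(cmod (ramp (a k) (b k) g u - ramp (a k) (b k) g v))\<^sup>2
    \<le> 64 * \<bar>u - v\<bar>\<^sup>2 / R ^ 3 * (LINT \<xi>|lborel. indicator {a k<..<b k} \<xi> * (cmod (fourier g \<xi>))\<^sup>2)"
proof -
  note g' = square_integrableD[OF g] and [measurable] = square_integrableD(3)[OF g]
  note ab = less[OF k]
  let ?L = "b k - a k" and ?i = "indicator {a k<..<b k} :: real \<Rightarrow> real"
  let ?I = "LINT \<xi>|lborel. ?i \<xi> * cmod (fourier g \<xi>)" and ?J = "LINT \<xi>|lborel. ?i \<xi> * (cmod (fourier g \<xi>))\<^sup>2"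
  let ?s = "\<lambda>\<xi>. complex_of_real (ramp_symbol (a k) (b k) \<xi>) * fourier g \<xi>"
  have [measurable]: "(\<lambda>\<xi>. cmod (fourier g \<xi>)) \<in> borel_measurable borel" by measurable
  have bnd: "\<bar>cmod (fourier g \<xi>)\<bar> \<le> (LINT y|lborel. cmod (g y))" for \<xi>
    using norm_fourier_le[OF g'(1)] by simp
  note CS = interval_Cauchy_Schwarz[OF _ bnd ab, simplified]
  have J0: "0 \<le> ?J" by (rule Bochner_Integration.integral_nonneg) auto
  have "cmod (ramp (a k) (b k) g u - ramp (a k) (b k) g v)
    = cmod (LINT \<xi>|lborel. ?s \<xi> * cis (2 * pi * u * (\<xi> - a k)) - ?s \<xi> * cis (2 * pi * v * (\<xi> - a k)))"
    unfolding ramp_def by (simp add: Bochner_Integration.integral_diff integrable_ramp[OF g'(1) ab])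
  also have "\<dots> \<le> (LINT \<xi>|lborel. cmod (?s \<xi> * cis (2 * pi * u * (\<xi> - a k)) - ?s \<xi> * cis (2 * pi * v * (\<xi> - a k))))"
    by (rule integral_norm_bound)
  also have "\<dots> \<le> (LINT \<xi>|lborel. (8 * \<bar>u - v\<bar> * ?L) * (?i \<xi> * cmod (fourier g \<xi>)))"
  proof (rule integral_mono)
    show "integrable lborel (\<lambda>\<xi>. cmod (?s \<xi> * cis (2 * pi * u * (\<xi> - a k)) - ?s \<xi> * cis (2 * pi * v * (\<xi> - a k))))"
      by (intro integrable_norm Bochner_Integration.integrable_diff integrable_ramp[OF g'(1) ab])
    show "integrable lborel (\<lambda>\<xi>. (8 * \<bar>u - v\<bar> * ?L) * (?i \<xi> * cmod (fourier g \<xi>)))"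
      using CS(1) by (intro integrable_mult_right) simp
    fix \<xi>
    have "cmod (?s \<xi> * cis (2 * pi * u * (\<xi> - a k)) - ?s \<xi> * cis (2 * pi * v * (\<xi> - a k)))
      = \<bar>ramp_symbol (a k) (b k) \<xi>\<bar> * cmod (fourier g \<xi>) * cmod (cis (2 * pi * u * (\<xi> - a k)) - cis (2 * pi * v * (\<xi> - a k)))"
      unfolding right_diff_distrib[symmetric] norm_mult by simp
    also have "\<dots> \<le> \<bar>ramp_symbol (a k) (b k) \<xi>\<bar> * cmod (fourier g \<xi>) * \<bar>2 * pi * u * (\<xi> - a k) - 2 * pi * v * (\<xi> - a k)\<bar>"
      by (intro mult_left_mono norm_cis_diff_le) auto
    also have "\<bar>2 * pi * u * (\<xi> - a k) - 2 * pi * v * (\<xi> - a k)\<bar> = 2 * pi * \<bar>u - v\<bar> * \<bar>\<xi> - a k\<bar>"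
      by (simp add: abs_mult left_diff_distrib[symmetric] right_diff_distrib[symmetric])
    also have "\<bar>ramp_symbol (a k) (b k) \<xi>\<bar> * cmod (fourier g \<xi>) * (2 * pi * \<bar>u - v\<bar> * \<bar>\<xi> - a k\<bar>)
      \<le> (8 * \<bar>u - v\<bar> * ?L) * (?i \<xi> * cmod (fourier g \<xi>))"
    proof (cases "\<xi> \<in> {a k<..<b k}")
      case True
      have "\<bar>ramp_symbol (a k) (b k) \<xi>\<bar> * cmod (fourier g \<xi>) * (2 * pi * \<bar>u - v\<bar> * \<bar>\<xi> - a k\<bar>)
        \<le> 1 * cmod (fourier g \<xi>) * (2 * 4 * \<bar>u - v\<bar> * ?L)"
        using True pi_less_4 ramp_symbol_bound[OF ab, of \<xi>] by (intro mult_mono) auto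
      then show ?thesis using True by (simp add: mult_ac)
    qed (use ramp_symbol_bound[OF ab, of \<xi>] in auto)
    finally show "cmod (?s \<xi> * cis (2 * pi * u * (\<xi> - a k)) - ?s \<xi> * cis (2 * pi * v * (\<xi> - a k)))
      \<le> (8 * \<bar>u - v\<bar> * ?L) * (?i \<xi> * cmod (fourier g \<xi>))" .
  qed
  also have "\<dots> = (8 * \<bar>u - v\<bar> * ?L) * ?I" by (rule integral_mult_right_zero)
  finally have "(cmod (ramp (a k) (b k) g u - ramp (a k) (b k) g v))\<^sup>2 \<le> ((8 * \<bar>u - v\<bar> * ?L) * ?I)\<^sup>2"
    by (rule power_mono) simp
  also have "\<dots> = 64 * \<bar>u - v\<bar>\<^sup>2 * ?L\<^sup>2 * ?I\<^sup>2" by (simp add: power_mult_distrib)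
  also have "\<dots> \<le> 64 * \<bar>u - v\<bar>\<^sup>2 * ?L\<^sup>2 * (?L * ?J)"
    using CS(3) by (intro mult_left_mono) auto
  also have "\<dots> = 64 * \<bar>u - v\<bar>\<^sup>2 * ?J * ?L ^ 3" by (simp add: power2_eq_square power3_eq_cube)
  also have "\<dots> \<le> 64 * \<bar>u - v\<bar>\<^sup>2 * ?J * (1 / R) ^ 3"
    using short R ab J0 by (intro mult_left_mono power_mono) (auto simp: field_simps)
  also have "\<dots> = 64 * \<bar>u - v\<bar>\<^sup>2 / R ^ 3 * ?J" by (simp add: power_divide)
  finally show ?thesis .
qed

text \<open>The explicit kernel splits the difference into four terms, each a coefficient bounded
  uniformly in k times the Fourier transform of a fixed function at \<open>a k\<close> or
  \<open>b k\<close>. Intervals of length at least 1/R leave room for sampling at scale 1/R, so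
  \<open>large_sieve\<close> sums each term over k.\<close>

lemma ramp_diff_long:
  assumes g: "square_integrable g" and R: "0 < R" and J: "J \<subseteq> K"
    and long: "\<And>k. k \<in> J \<Longrightarrow> 1 \<le> (b k - a k) * R"
    and supp: "\<And>y. g y \<noteq> 0 \<Longrightarrow> \<bar>y - c\<bar> \<le> 3 * R \<and> R \<le> \<bar>u - y\<bar> \<and> R \<le> \<bar>v - y\<bar>"
  shows "(\<Sum>k\<in>J. (cmod (ramp (a k) (b k) g u - ramp (a k) (b k) g v))\<^sup>2)
    \<le> 1152 * B * \<bar>u - v\<bar>\<^sup>2 / R ^ 3 * energy g"
proof -
  note g' = square_integrableD[OF g] and [measurable] = square_integrableD(3)[OF g]
  let ?d = "\<bar>u - v\<bar>"
  \<comment> \<open>The profiles of the four terms: the difference of the 1/z parts, the difference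
    of the 1/z^2 parts, and the 1/z^2 part that multiplies the change of phase at
    \<open>b k\<close>. The factor R in \<open>r2\<close> and the factor \<open>2 * pi * ?d\<close>
    in \<open>h3\<close> bring all of them to the common size |u - v| / R^2.\<close>
  define r1 where "r1 y = (1 / (u - y) - 1 / (v - y)) / (2 * pi)" for y
  define r2 where "r2 y = R * (1 / (u - y)\<^sup>2 - 1 / (v - y)\<^sup>2) / (4 * pi\<^sup>2)" for y
  define r3 where "r3 y = 1 / (u - y)\<^sup>2 / (4 * pi\<^sup>2)" for y
  define h1 where "h1 y = of_real (r1 y) * g y" for y
  define h2 where "h2 y = of_real (r2 y) * g y" for y
  define h3 where "h3 y = of_real (2 * pi * ?d * r3 y) * g y" for y
  have pi1: "1 \<le> 2 * pi" using pi_gt3 by simp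
  have pi2: "2 \<le> 4 * pi\<^sup>2" using mult_mono[of 1 pi 1 pi] pi_gt3 by (simp add: power2_eq_square)
  have r: "\<bar>r1 y\<bar> \<le> ?d / R\<^sup>2" "\<bar>r2 y\<bar> \<le> ?d / R\<^sup>2" "\<bar>2 * pi * ?d * r3 y\<bar> \<le> ?d / R\<^sup>2" if "g y \<noteq> 0" for y
  proof -
    have uv: "R \<le> \<bar>u - y\<bar>" "R \<le> \<bar>v - y\<bar>" "u - y \<noteq> 0" "v - y \<noteq> 0" using supp[OF that] R by auto
    have inv: "1 / \<bar>u - y\<bar> \<le> 1 / R" "1 / \<bar>v - y\<bar> \<le> 1 / R"
      using uv R by (auto intro!: divide_left_mono simp: zero_less_mult_iff)
    have diff: "\<bar>1 / (u - y) - 1 / (v - y)\<bar> \<le> ?d / R\<^sup>2"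
    proof -
      have "1 / (u - y) - 1 / (v - y) = - (u - v) * (1 / (u - y)) * (1 / (v - y))"
        using uv by (simp add: field_simps)
      then have "\<bar>1 / (u - y) - 1 / (v - y)\<bar> = ?d * (1 / \<bar>u - y\<bar>) * (1 / \<bar>v - y\<bar>)"
        by (simp only: abs_mult abs_minus_cancel abs_divide abs_one)
      also have "\<dots> \<le> ?d * (1 / R) * (1 / R)"
        using inv R by (intro mult_mono) auto
      finally show ?thesis by (simp add: power2_eq_square)
    qed
    have "\<bar>r1 y\<bar> = \<bar>1 / (u - y) - 1 / (v - y)\<bar> / (2 * pi)" by (simp add: r1_def abs_mult)
    also have "\<dots> \<le> \<bar>1 / (u - y) - 1 / (v - y)\<bar> / 1"
      using pi1 by (intro divide_left_mono) auto
    finally show "\<bar>r1 y\<bar> \<le> ?d / R\<^sup>2" using diff by simp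
    have "\<bar>1 / (u - y)\<^sup>2 - 1 / (v - y)\<^sup>2\<bar> = \<bar>1 / (u - y) - 1 / (v - y)\<bar> * \<bar>1 / (u - y) + 1 / (v - y)\<bar>"
      unfolding abs_mult[symmetric] by (simp add: power2_eq_square algebra_simps)
    also have "\<dots> \<le> ?d / R\<^sup>2 * (2 / R)"
      using diff inv by (intro mult_mono order.trans[OF abs_triangle_ineq]) auto
    finally have d2: "\<bar>1 / (u - y)\<^sup>2 - 1 / (v - y)\<^sup>2\<bar> \<le> ?d / R\<^sup>2 * (2 / R)" .
    have "\<bar>r2 y\<bar> = R * \<bar>1 / (u - y)\<^sup>2 - 1 / (v - y)\<^sup>2\<bar> / (4 * pi\<^sup>2)"
      using R by (simp add: r2_def abs_mult)
    also have "\<dots> \<le> R * (?d / R\<^sup>2 * (2 / R)) / (4 * pi\<^sup>2)"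
      using d2 R by (intro divide_right_mono mult_left_mono) auto
    also have "\<dots> = ?d / R\<^sup>2 * (2 / (4 * pi\<^sup>2))" using R by simp
    also have "\<dots> \<le> ?d / R\<^sup>2 * 1"
      using pi2 by (intro mult_left_mono) (auto simp: divide_le_eq_1)
    finally show "\<bar>r2 y\<bar> \<le> ?d / R\<^sup>2" by simp
    have r3: "r3 y = (1 / \<bar>u - y\<bar>) * (1 / \<bar>u - y\<bar>) / (4 * pi\<^sup>2)"
      by (simp add: r3_def power2_eq_square)
    have hA: "2 * pi * ?d * (A * A / (4 * pi\<^sup>2)) = ?d * A * A / (2 * pi)" for A :: real
      using pi_neq_zero by (simp add: power2_eq_square field_simps)
    have "\<bar>2 * pi * ?d * r3 y\<bar> = \<bar>?d * (1 / \<bar>u - y\<bar>) * (1 / \<bar>u - y\<bar>) / (2 * pi)\<bar>"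
      unfolding r3 hA ..
    also have "\<dots> = ?d * (1 / \<bar>u - y\<bar>) * (1 / \<bar>u - y\<bar>) / (2 * pi)"
      by (intro abs_of_nonneg divide_nonneg_nonneg mult_nonneg_nonneg) auto
    also have "\<dots> \<le> ?d * (1 / R) * (1 / R) / 1"
      using inv uv R pi1 by (intro frac_le mult_mono) auto
    finally show "\<bar>2 * pi * ?d * r3 y\<bar> \<le> ?d / R\<^sup>2" by (simp add: power2_eq_square)
  qed
  have [measurable]: "h1 \<in> borel_measurable borel" "h2 \<in> borel_measurable borel" "h3 \<in> borel_measurable borel"
    unfolding h1_def h2_def h3_def r1_def r2_def r3_def by measurable
  have hle: "cmod (h1 y) \<le> (?d / R\<^sup>2) * cmod (g y)" "cmod (h2 y) \<le> (?d / R\<^sup>2) * cmod (g y)"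
    "cmod (h3 y) \<le> (?d / R\<^sup>2) * cmod (g y)" for y
  proof -
    have "cmod (of_real t * g y) \<le> (?d / R\<^sup>2) * cmod (g y)" if "g y \<noteq> 0 \<Longrightarrow> \<bar>t\<bar> \<le> ?d / R\<^sup>2" for t
      using that by (cases "g y = 0") (auto simp only: norm_mult norm_of_real norm_zero mult_zero_right norm_ge_zero intro!: mult_right_mono)
    from this[of "r1 y"] this[of "r2 y"] this[of "2 * pi * ?d * r3 y"] r[of y]
    show "cmod (h1 y) \<le> (?d / R\<^sup>2) * cmod (g y)" "cmod (h2 y) \<le> (?d / R\<^sup>2) * cmod (g y)"
      "cmod (h3 y) \<le> (?d / R\<^sup>2) * cmod (g y)" unfolding h1_def h2_def h3_def by blast+
  qed
  note h1b = square_integrable_bound[OF g _ hle(1), simplified]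
    and h2b = square_integrable_bound[OF g _ hle(2), simplified]
    and h3b = square_integrable_bound[OF g _ hle(3), simplified]
  note hi = square_integrableD(1)[OF h1b(1)] square_integrableD(1)[OF h2b(1)] square_integrableD(1)[OF h3b(1)]
  have bound: "cmod (ramp (a k) (b k) g u - ramp (a k) (b k) g v)
    \<le> cmod (fourier h1 (a k)) + cmod (fourier h2 (a k)) + cmod (fourier h3 (b k)) + cmod (fourier h2 (b k))"
    if k: "k \<in> J" for k
  proof -
    have kK: "k \<in> K" using J k by auto
    note ab = less[OF kK]
    define L where "L = b k - a k"
    have L: "0 < L" "1 \<le> L * R" using ab long[OF k] by (auto simp: L_def)
    have bk: "b k = a k + L" by (simp add: L_def)
    \<comment> \<open>\<open>p\<close> is \<open>h3\<close> without the factor 2 pi |u - v|. The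
      exact identity has the phase difference \<open>?e\<close>, which depends on k, in place of
      that factor; the two are exchanged only after norms are taken, when 1/L cancels the L in the
      bound for \<open>?e\<close>.\<close>
    define p where "p y = of_real (r3 y) * g y" for y
    have h3p: "fourier h3 \<xi> = of_real (2 * pi * ?d) * fourier p \<xi>" for \<xi>
      unfolding fourier_cmult[symmetric] h3_def p_def by (simp add: mult.assoc)
    have p_le: "cmod (p y) \<le> 1 / R\<^sup>2 * cmod (g y)" for y
    proof (cases "g y = 0")
      case False
      have "1 / \<bar>u - y\<bar> \<le> 1 / R" using supp[OF False] R by (intro divide_left_mono) (auto simp: zero_less_mult_iff)
      then have "(1 / \<bar>u - y\<bar>)\<^sup>2 / (4 * pi\<^sup>2) \<le> (1 / R)\<^sup>2 / 1"
        using R pi2 supp[OF False] by (intro frac_le power_mono) auto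
      then have "\<bar>r3 y\<bar> \<le> 1 / R\<^sup>2"
        by (simp add: r3_def power_divide)
      then show ?thesis unfolding p_def norm_mult norm_of_real by (intro mult_right_mono) auto
    qed (simp add: p_def)
    have [measurable]: "p \<in> borel_measurable borel" unfolding p_def r3_def by measurable
    have pint: "integrable lborel p"
      using square_integrableD(1)[OF square_integrable_bound(1)[OF g _ p_le]] by simp
    let ?E = "\<lambda>x y. g y * cis (- (2 * pi * a k * y)) * ramp_kernel L (x - y)"
    let ?e = "cis (2 * pi * L * u) - cis (2 * pi * L * v)"
    let ?T1 = "\<lambda>y. \<i> * (h1 y * cis (- (2 * pi * y * a k)))"
    let ?T2 = "\<lambda>y. of_real (1 / (L * R)) * (h2 y * cis (- (2 * pi * y * a k)))"
    let ?T3 = "\<lambda>y. of_real (1 / L) * ?e * (p y * cis (- (2 * pi * y * b k)))"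
    let ?T4 = "\<lambda>y. of_real (1 / (L * R)) * cis (2 * pi * L * v) * (h2 y * cis (- (2 * pi * y * b k)))"
    have pointwise: "?E u y - ?E v y = ?T1 y + ?T2 y - ?T3 y - ?T4 y" for y
    proof (cases "g y = 0")
      case False
      have uv: "u - y \<noteq> 0" "v - y \<noteq> 0" using supp[OF False] R by auto
      define \<alpha> where "\<alpha> = cis (- (2 * pi * y * a k))"
      define \<beta> where "\<beta> = cis (- (2 * pi * y * L))"
      define U where "U = cis (2 * pi * L * u)"
      define W where "W = cis (2 * pi * L * v)"
      have e1: "cis (- (2 * pi * a k * y)) = \<alpha>" by (simp add: \<alpha>_def mult_ac)
      have e2: "cis (- (2 * pi * y * b k)) = \<alpha> * \<beta>"
        unfolding \<alpha>_def \<beta>_def cis_mult bk by (simp add: algebra_simps)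
      have e3: "cis (2 * pi * L * (u - y)) = U * \<beta>" "cis (2 * pi * L * (v - y)) = W * \<beta>"
        unfolding U_def W_def \<beta>_def cis_mult by (simp_all add: algebra_simps)
      define X where "X = complex_of_real (1 / (u - y))"
      define Y where "Y = complex_of_real (1 / (v - y))"
      define P where "P = complex_of_real (1 / (2 * pi))"
      define M where "M = complex_of_real (1 / L)"
      have k1: "ramp_kernel L (u - y) = \<i> * P * X - M * P\<^sup>2 * X\<^sup>2 * (U * \<beta> - 1)"
        "ramp_kernel L (v - y) = \<i> * P * Y - M * P\<^sup>2 * Y\<^sup>2 * (W * \<beta> - 1)"
        unfolding ramp_kernel_eq[OF L(1) uv(1)] ramp_kernel_eq[OF L(1) uv(2)] e3 X_def Y_def P_def M_def
        using uv L by (simp_all add: power2_eq_square)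
      have r1: "of_real (r1 y) = P * (X - Y)" unfolding r1_def P_def X_def Y_def by simp
      have r2: "of_real (r2 y) = of_real R * P\<^sup>2 * (X\<^sup>2 - Y\<^sup>2)"
        unfolding r2_def P_def X_def Y_def by (simp add: power2_eq_square)
      have r3: "of_real (r3 y) = P\<^sup>2 * X\<^sup>2" unfolding r3_def P_def X_def by (simp add: power2_eq_square)
      have LR: "of_real (1 / (L * R)) * (of_real R :: complex) = M" "of_real (1 / L) = M"
        using R L by (simp_all add: M_def)
      have T2: "?T2 y = M * P\<^sup>2 * (X\<^sup>2 - Y\<^sup>2) * g y * \<alpha>"
        unfolding h2_def r2 \<alpha>_def[symmetric] LR(1)[symmetric] by (simp only: mult_ac)
      have T4: "?T4 y = M * P\<^sup>2 * (X\<^sup>2 - Y\<^sup>2) * W * g y * (\<alpha> * \<beta>)"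
        unfolding h2_def r2 e2 W_def[symmetric] LR(1)[symmetric] by (simp only: mult_ac)
      show ?thesis
        unfolding T2 T4 unfolding h1_def p_def r1 r3 e1 e2 k1 LR(2) \<alpha>_def[symmetric] U_def[symmetric] W_def[symmetric]
        by (simp add: algebra_simps)
    qed (simp add: h1_def h2_def p_def)
    note rk = ramp_conv_kernel[OF g'(1) ab, folded L_def]
    have i1: "integrable lborel ?T1" "integrable lborel ?T2" "integrable lborel ?T3" "integrable lborel ?T4"
      by (intro integrable_mult_right integrable_mult_cis hi pint; measurable)+
    have "ramp (a k) (b k) g u - ramp (a k) (b k) g v = (LINT y|lborel. ?E u y - ?E v y)"
      unfolding rk(1) by (rule Bochner_Integration.integral_diff[symmetric]) (rule rk(2))+
    also have "\<dots> = (LINT y|lborel. ?T1 y) + (LINT y|lborel. ?T2 y) - (LINT y|lborel. ?T3 y) - (LINT y|lborel. ?T4 y)"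
      unfolding pointwise using i1 by (simp del: integral_mult_right_zero)
    also have "\<dots> = \<i> * fourier h1 (a k) + of_real (1 / (L * R)) * fourier h2 (a k)
       - of_real (1 / L) * ?e * fourier p (b k) - of_real (1 / (L * R)) * cis (2 * pi * L * v) * fourier h2 (b k)"
      unfolding fourier_def integral_mult_right_zero ..
    finally have eq: "ramp (a k) (b k) g u - ramp (a k) (b k) g v = \<dots>" .
    have LR1: "1 / (L * R) \<le> 1" "0 \<le> 1 / (L * R)" using L R by (auto simp: divide_le_eq_1)
    have 1: "cmod (\<i> * fourier h1 (a k)) \<le> cmod (fourier h1 (a k))" by (simp add: norm_mult)
    have 2: "cmod (of_real (1 / (L * R)) * fourier h2 (a k)) \<le> cmod (fourier h2 (a k))"
      unfolding norm_mult norm_of_real using LR1 by (intro mult_left_le_one_le) auto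
    have 4: "cmod (of_real (1 / (L * R)) * cis (2 * pi * L * v) * fourier h2 (b k)) \<le> cmod (fourier h2 (b k))"
      unfolding norm_mult norm_of_real norm_cis mult_1_right using LR1 by (intro mult_left_le_one_le) auto
    have 3: "cmod (of_real (1 / L) * ?e * fourier p (b k)) \<le> cmod (fourier h3 (b k))"
    proof -
      have "cmod ?e \<le> \<bar>2 * pi * L * u - 2 * pi * L * v\<bar>" by (rule norm_cis_diff_le)
      also have "\<dots> = L * (2 * pi * ?d)"
        using L by (simp add: abs_mult right_diff_distrib[symmetric])
      finally have "1 / L * cmod ?e \<le> 2 * pi * ?d" using L by (simp add: field_simps)
      then have "1 / L * cmod ?e * cmod (fourier p (b k)) \<le> 2 * pi * ?d * cmod (fourier p (b k))"
        by (rule mult_right_mono) simp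
      then show ?thesis unfolding h3p norm_mult norm_of_real using L by (simp add: abs_mult)
    qed
    have tri: "cmod (z1 + z2 - z3 - z4) \<le> cmod z1 + cmod z2 + cmod z3 + cmod z4" for z1 z2 z3 z4
      using norm_triangle_ineq4[of "z1 + z2 - z3" z4] norm_triangle_ineq4[of "z1 + z2" z3] norm_triangle_ineq[of z1 z2]
      by linarith
    show ?thesis unfolding eq
      by (rule order.trans[OF tri]) (intro add_mono 1 2 3 4)
  qed
  \<comment> \<open>The largest step with \<open>\<delta> * (3 * R) \<le> 1 / 6\<close>; it is also
    shorter than every interval of \<open>J\<close>.\<close>
  define \<delta> where "\<delta> = 1 / (18 * R)"
  have \<delta>: "0 < \<delta>" "\<delta> * (3 * R) \<le> 1 / 6" using R by (auto simp: \<delta>_def)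
  have \<delta>L: "\<delta> \<le> b k - a k" if "k \<in> J" for k
    using long[OF that] R by (simp add: \<delta>_def divide_le_eq)
  let ?G = "4 * B / \<delta> * ((?d / R\<^sup>2)\<^sup>2 * energy g)"
  have sa: "(\<Sum>k\<in>J. (cmod (fourier h (a k)))\<^sup>2) \<le> ?G"
    and sb: "(\<Sum>k\<in>J. (cmod (fourier h (b k)))\<^sup>2) \<le> ?G"
    if h: "square_integrable h" "energy h \<le> (?d / R\<^sup>2)\<^sup>2 * energy g" "\<And>y. g y = 0 \<Longrightarrow> h y = 0" for h
  proof -
    have sp: "h y \<noteq> 0 \<Longrightarrow> \<bar>y - c\<bar> \<le> 3 * R" for y using h(3) supp by blast
    have "4 * B / \<delta> * energy h \<le> ?G" using h(2) B_nonneg \<delta>(1) by (intro mult_left_mono) auto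
    moreover have "(\<Sum>k\<in>J. (cmod (fourier h (a k)))\<^sup>2) \<le> 4 * B / \<delta> * energy h"
      by (rule large_sieve[OF h(1) sp \<delta>, where s=1]) (use J \<delta>L in force)+
    moreover have "(\<Sum>k\<in>J. (cmod (fourier h (b k)))\<^sup>2) \<le> 4 * B / \<delta> * energy h"
      by (rule large_sieve[OF h(1) sp \<delta>, where s="-1"]) (use J \<delta>L in force)+
    ultimately show "(\<Sum>k\<in>J. (cmod (fourier h (a k)))\<^sup>2) \<le> ?G" "(\<Sum>k\<in>J. (cmod (fourier h (b k)))\<^sup>2) \<le> ?G"
      by auto
  qed
  have "(\<Sum>k\<in>J. (cmod (ramp (a k) (b k) g u - ramp (a k) (b k) g v))\<^sup>2)
    \<le> (\<Sum>k\<in>J. 4 * ((cmod (fourier h1 (a k)))\<^sup>2 + (cmod (fourier h2 (a k)))\<^sup>2 + (cmod (fourier h3 (b k)))\<^sup>2 + (cmod (fourier h2 (b k)))\<^sup>2))"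
    by (intro sum_mono order.trans[OF power_mono[OF bound] sum_four_square_le]) auto
  also have "\<dots> = 4 * ((\<Sum>k\<in>J. (cmod (fourier h1 (a k)))\<^sup>2) + (\<Sum>k\<in>J. (cmod (fourier h2 (a k)))\<^sup>2)
     + (\<Sum>k\<in>J. (cmod (fourier h3 (b k)))\<^sup>2) + (\<Sum>k\<in>J. (cmod (fourier h2 (b k)))\<^sup>2))"
    by (simp add: sum_distrib_left[symmetric] sum.distrib)
  also have "\<dots> \<le> 4 * (?G + ?G + ?G + ?G)"
    by (intro mult_left_mono add_mono sa sb h1b h2b h3b) (auto simp: h1_def h2_def h3_def)
  \<comment> \<open>Each of the four sums is at most 4 B 18 R (d / R^2)^2 = 72 B d^2 / R^3 times the
    energy; the factor 4 from squaring gives 16 times 72.\<close>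
  also have "\<dots> = 1152 * B * ?d\<^sup>2 / R ^ 3 * energy g"
    using R by (simp add: \<delta>_def power_divide field_simps power_numeral_reduce)
  finally show ?thesis .
qed

text \<open>Substitute for the Hoermander regularity of a vector-valued kernel.\<close>
lemma ramp_oscillation:
  assumes g: "square_integrable g" and R: "0 < R"
    and supp: "\<And>y. g y \<noteq> 0 \<Longrightarrow> \<bar>y - c\<bar> \<le> 3 * R \<and> R \<le> \<bar>u - y\<bar> \<and> R \<le> \<bar>v - y\<bar>"
  shows "(\<Sum>k\<in>K. (cmod (ramp (a k) (b k) g u - ramp (a k) (b k) g v))\<^sup>2)
    \<le> 1216 * B * \<bar>u - v\<bar>\<^sup>2 / R ^ 3 * energy g"
proof -
  \<comment> \<open>The lengths are compared with 1/R, the frequency resolution at spatial scale R.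
    The constant is 64 + 1152 = 1216.\<close>
  define J where "J = {k\<in>K. 1 \<le> (b k - a k) * R}"
  let ?D = "\<lambda>k. (cmod (ramp (a k) (b k) g u - ramp (a k) (b k) g v))\<^sup>2"
  let ?I = "\<lambda>k. LINT \<xi>|lborel. indicator {a k<..<b k} \<xi> * (cmod (fourier g \<xi>))\<^sup>2"
  have "(\<Sum>k\<in>K - J. ?D k) \<le> (\<Sum>k\<in>K - J. 64 * \<bar>u - v\<bar>\<^sup>2 / R ^ 3 * ?I k)"
    by (intro sum_mono ramp_diff_short g R) (auto simp: J_def)
  also have "\<dots> \<le> (\<Sum>k\<in>K. 64 * \<bar>u - v\<bar>\<^sup>2 / R ^ 3 * ?I k)"
    using R by (intro sum_mono2) (auto intro!: mult_nonneg_nonneg Bochner_Integration.integral_nonneg)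
  also have "\<dots> \<le> 64 * \<bar>u - v\<bar>\<^sup>2 / R ^ 3 * (B * energy g)"
    unfolding sum_distrib_left[symmetric] using R by (intro mult_left_mono sum_fourier_le g) auto
  finally have 1: "(\<Sum>k\<in>K - J. ?D k) \<le> 64 * B * \<bar>u - v\<bar>\<^sup>2 / R ^ 3 * energy g" by (simp add: mult_ac)
  have 2: "(\<Sum>k\<in>J. ?D k) \<le> 1152 * B * \<bar>u - v\<bar>\<^sup>2 / R ^ 3 * energy g"
    by (rule ramp_diff_long[OF g R _ _ supp]) (auto simp: J_def)
  have "(\<Sum>k\<in>K. ?D k) = (\<Sum>k\<in>K - J. ?D k) + (\<Sum>k\<in>J. ?D k)"
    by (rule sum.subset_diff) (auto simp: J_def)
  moreover have "64 * B * \<bar>u - v\<bar>\<^sup>2 / R ^ 3 * energy g + 1152 * B * \<bar>u - v\<bar>\<^sup>2 / R ^ 3 * energy g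
    = 1216 * B * \<bar>u - v\<bar>\<^sup>2 / R ^ 3 * energy g" by (simp add: field_simps)
  ultimately show ?thesis using 1 2 by linarith
qed

end

subsection \<open>The stopping-time tree\<close>

locale dyadic_root =
  fixes q len :: real
  assumes len_pos: "0 < len"
begin

definition side :: "nat \<Rightarrow> real" where "side n = len / 2 ^ n"

definition node :: "nat \<Rightarrow> nat \<Rightarrow> real set" where
  "node n i = {q + side n * i ..< q + side n * (i + 1)}"

text \<open>The tripled interval, closed so that it is a \<open>cball\<close> as the Vitali covering
  lemma wants. The subtraction is on reals because for i = 0 the triple sticks out to the left of
  \<open>q\<close>.\<close>

definition dil :: "nat \<Rightarrow> nat \<Rightarrow> real set" where
  "dil n i = {q + side n * (real i - 1) .. q + side n * (i + 2)}"

definition root :: "real set" where "root = {q ..< q + len}"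

text \<open>Points left of \<open>q\<close> are sent to index 0 by \<open>nat\<close>, which is why
  \<open>q \<le> x\<close> accompanies every use.\<close>

definition idx :: "nat \<Rightarrow> real \<Rightarrow> nat" where
  "idx n x = nat \<lfloor>(x - q) / side n\<rfloor>"

lemma side_pos [simp]: "0 < side n" "0 \<le> side n" "side n \<noteq> 0"
  using len_pos by (auto simp: side_def)

lemma side_Suc: "side n = 2 * side (Suc n)"
  by (simp add: side_def)

lemma side_mono: "m \<le> n \<Longrightarrow> side n \<le> side m"
  unfolding side_def using len_pos by (intro divide_left_mono) (auto simp: power_increasing)

lemma mem_node: "x \<in> node n i \<longleftrightarrow> q \<le> x \<and> idx n x = i"
proof -
  have "x \<in> node n i \<longleftrightarrow> real i \<le> (x - q) / side n \<and> (x - q) / side n < real i + 1"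
    by (auto simp: node_def field_simps)
  also have "\<dots> \<longleftrightarrow> \<lfloor>(x - q) / side n\<rfloor> = int i"
    by (metis floor_eq_iff of_int_of_nat_eq)
  also have "\<dots> \<longleftrightarrow> q \<le> x \<and> idx n x = i"
  proof
    assume *: "\<lfloor>(x - q) / side n\<rfloor> = int i"
    then have "0 \<le> (x - q) / side n" by (metis of_nat_0_le_iff zero_le_floor)
    then have "q \<le> x" using side_pos(1)[of n] by (auto simp: zero_le_divide_iff)
    with * show "q \<le> x \<and> idx n x = i" by (simp add: idx_def)
  next
    assume *: "q \<le> x \<and> idx n x = i"
    then have "0 \<le> \<lfloor>(x - q) / side n\<rfloor>" by simp
    with * show "\<lfloor>(x - q) / side n\<rfloor> = int i" by (auto simp: idx_def)
  qed
  finally show ?thesis .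
qed

lemma root_eq_node: "root = node 0 0"
  by (simp add: root_def node_def side_def)

lemma rootD: "x \<in> root \<Longrightarrow> q \<le> x"
  by (simp add: root_def)

text \<open>Ancestors are found by integer division of the index. This lets \<open>last_stop\<close>
  be defined on pairs of naturals, with no reference to points.\<close>

lemma idx_add_div: "q \<le> x \<Longrightarrow> idx (n + k) x div 2 ^ k = idx n x"
proof (induction k)
  case (Suc k)
  let ?j = "idx (n + Suc k) x"
  have "x \<in> node (n + Suc k) ?j" using Suc.prems by (simp add: mem_node)
  then have x: "q + side (n + Suc k) * ?j \<le> x" "x < q + side (n + Suc k) * (?j + 1)" by (auto simp: node_def)
  have j: "real (2 * (?j div 2)) \<le> ?j" "real ?j + 1 \<le> real (2 * (?j div 2) + 2)"
    by linarith+
  have s: "side (n + k) = 2 * side (n + Suc k)" using side_Suc[of "n + k"] by simp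
  have "x \<in> node (n + k) (?j div 2)"
  proof -
    have "side (n + k) * real (?j div 2) = side (n + Suc k) * real (2 * (?j div 2))" unfolding s by simp
    also have "\<dots> \<le> side (n + Suc k) * ?j" using j by (intro mult_left_mono) auto
    finally have 1: "q + side (n + k) * real (?j div 2) \<le> x" using x by linarith
    have "side (n + Suc k) * (real ?j + 1) \<le> side (n + Suc k) * real (2 * (?j div 2) + 2)"
      using j by (intro mult_left_mono) auto
    also have "\<dots> = side (n + k) * (real (?j div 2) + 1)" unfolding s by (simp add: algebra_simps)
    finally have 2: "x < q + side (n + k) * (real (?j div 2) + 1)" using x by (simp add: add.commute)
    show ?thesis using 1 2 by (simp add: node_def add.commute)
  qed
  then have "?j div 2 = idx (n + k) x" by (simp add: mem_node)
  then show ?case using Suc by (simp add: div_mult2_eq)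
qed simp

lemma idx_le_div: "q \<le> x \<Longrightarrow> m \<le> n \<Longrightarrow> idx n x div 2 ^ (n - m) = idx m x"
  using idx_add_div[of x m "n - m"] by simp

lemma idx_Suc_div: "q \<le> x \<Longrightarrow> idx (Suc n) x div 2 = idx n x"
  using idx_add_div[of x n 1] by simp

lemma idx_less: "x \<in> root \<Longrightarrow> idx n x < 2 ^ n"
proof -
  assume x: "x \<in> root"
  then have "idx 0 x = 0" by (simp add: root_eq_node mem_node)
  then have "idx n x div 2 ^ n = 0" using idx_le_div[of x 0 n] x by (simp add: rootD)
  then show ?thesis by (simp add: div_eq_0_iff)
qed

lemma idx_eq_mono: "q \<le> x \<Longrightarrow> q \<le> y \<Longrightarrow> m \<le> n \<Longrightarrow> idx n x = idx n y \<Longrightarrow> idx m x = idx m y"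
  using idx_le_div[of x m n] idx_le_div[of y m n] by simp

lemma node_dist_less:
  assumes "x \<in> node n i" "y \<in> node n i"
  shows "\<bar>x - y\<bar> < side n"
  using assms by (auto simp: node_def algebra_simps)

text \<open>The second inclusion is what allows parents of bad intervals to be selected: the triple
  of a bad child still covers the whole selected parent.\<close>

lemma dil_Suc_subset:
  assumes "j = 2 * i \<or> j = 2 * i + 1"
  shows "dil (Suc n) j \<subseteq> dil n i" "node n i \<subseteq> dil (Suc n) j"
  using assms side_pos(1)[of "Suc n"] unfolding dil_def node_def side_Suc[of n]
  by (auto simp: algebra_simps)

lemma idx_Suc_cases: "q \<le> x \<Longrightarrow> idx (Suc n) x = 2 * idx n x \<or> idx (Suc n) x = 2 * idx n x + 1"
  using idx_Suc_div[of x n] by presburger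

lemma dil_idx_mono: "q \<le> x \<Longrightarrow> m \<le> n \<Longrightarrow> dil n (idx n x) \<subseteq> dil m (idx m x)"
proof (induction n)
  case (Suc n)
  then show ?case using dil_Suc_subset(1)[OF idx_Suc_cases[of x n]] by (cases "m = Suc n") auto
qed simp

lemma node_subset_dil: "node n i \<subseteq> dil n i"
proof -
  have "side n * (real i - 1) \<le> side n * i" "side n * real (i + 1) \<le> side n * real (i + 2)"
    by (intro mult_left_mono; simp)+
  then show ?thesis unfolding node_def dil_def
    by (intro subsetI) (simp only: atLeastLessThan_iff atLeastAtMost_iff, linarith)
qed

text \<open>Together with \<open>dil_center\<close> this provides the geometric hypotheses of
  \<open>ramp_oscillation\<close> on the annulus between consecutive triples.\<close>

lemma dil_separated:
  assumes "u \<in> node n i" "y \<notin> dil n i"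
  shows "side n \<le> \<bar>u - y\<bar>"
  using assms by (auto simp: node_def dil_def algebra_simps)

lemma dil_center:
  assumes "y \<in> dil n i"
  shows "\<bar>y - (q + side n * (i + 1 / 2))\<bar> \<le> 3 * side (Suc n)"
  using assms unfolding dil_def side_Suc[of n] by (auto simp: algebra_simps abs_le_iff)

lemma measure_node [simp]: "measure lborel (node n i) = side n"
  by (simp add: node_def algebra_simps)

lemma sets_node [measurable, simp]: "node n i \<in> sets borel"
  by (simp add: node_def)

lemma sets_dil [measurable, simp]: "dil n i \<in> sets borel"
  by (simp add: dil_def)

lemma sets_root [measurable, simp]: "root \<in> sets borel"
  by (simp add: root_def)

end

section \<open>Stopping conditions and the comparison of two levels\<close>

locale stopping_tree = interval_family K a b B + dyadic_root q len
  for K :: "'k set" and a b :: "'k \<Rightarrow> real" and B q len :: real +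
  fixes f :: "real \<Rightarrow> complex" and F :: real
  assumes f_meas [measurable]: "f \<in> borel_measurable borel"
    and f_bound: "\<And>x. cmod (f x) \<le> F"
    and f_supp: "\<And>x. f x \<noteq> 0 \<Longrightarrow> x \<in> root"
begin

definition restr :: "real set \<Rightarrow> real \<Rightarrow> complex" where
  "restr J y = (if y \<in> J then f y else 0)"

definition mass :: "real set \<Rightarrow> real" where "mass J = energy (restr J)"

lemma F_nonneg: "0 \<le> F"
  using f_bound[of 0] norm_ge_zero order.trans by blast

lemma restr_measurable [measurable]: "J \<in> sets borel \<Longrightarrow> restr J \<in> borel_measurable borel"
proof -
  assume [measurable]: "J \<in> sets borel"
  have "restr J = (\<lambda>y. indicator J y *\<^sub>R f y)" by (auto simp: restr_def)
  then show ?thesis by simp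
qed

lemma square_integrable_f: "square_integrable f"
proof -
  have i: "integrable lborel (\<lambda>x. c * indicator root x :: real)" for c
    using len_pos by (intro integrable_mult_right) (simp add: root_def integrable_indicator_iff)
  have "integrable lborel f"
    by (rule Bochner_Integration.integrable_bound[OF i[of F]])
      (use f_supp f_bound F_nonneg in \<open>auto simp: indicator_def\<close>)
  moreover have "integrable lborel (\<lambda>x. (cmod (f x))\<^sup>2)"
    by (rule Bochner_Integration.integrable_bound[OF i[of "F\<^sup>2"]])
      (use f_supp f_bound F_nonneg in \<open>auto simp: indicator_def intro!: power_mono\<close>)
  ultimately show ?thesis by (simp add: square_integrable_def)
qed

lemma square_integrable_restr: "J \<in> sets borel \<Longrightarrow> square_integrable (restr J)"
  by (rule square_integrable_bound(1)[OF square_integrable_f, of _ 1]) (auto simp: restr_def)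

lemmas integrable_restr = square_integrableD(1)[OF square_integrable_restr]

lemma mass_nonneg [simp]: "0 \<le> mass J"
  by (simp add: mass_def)

lemma mass_eq: "mass J = (LINT x|lborel. indicator J x * (cmod (f x))\<^sup>2)"
  unfolding mass_def energy_def restr_def by (intro Bochner_Integration.integral_cong) auto

lemma mass_mono: "I \<subseteq> J \<Longrightarrow> I \<in> sets borel \<Longrightarrow> J \<in> sets borel \<Longrightarrow> mass I \<le> mass J"
  unfolding mass_def energy_def
  by (intro integral_mono square_integrableD(2) square_integrable_restr) (auto simp: restr_def)

lemma restr_add: "J \<subseteq> I \<Longrightarrow> restr I = (\<lambda>y. restr (I - J) y + restr J y)"
  by (auto simp: restr_def fun_eq_iff)

abbreviation "V J \<equiv> ramp_norm (restr J)"

lemma V_diff_le: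
  assumes "J \<subseteq> I" "I \<in> sets borel" "J \<in> sets borel"
  shows "V I x \<le> V (I - J) x + V J x" "V (I - J) x \<le> V I x + V J x"
proof -
  have [measurable]: "I - J \<in> sets borel" using assms by auto
  show "V I x \<le> V (I - J) x + V J x"
    unfolding restr_add[OF assms(1)] using assms by (intro ramp_norm_add_le integrable_restr) auto
  have eq: "restr (I - J) = (\<lambda>y. restr I y + (- 1) * restr J y)"
    using assms(1) by (auto simp: restr_def fun_eq_iff)
  have "V (I - J) x \<le> ramp_norm (restr I) x + ramp_norm (\<lambda>y. (- 1) * restr J y) x"
    unfolding eq using assms by (intro ramp_norm_add_le integrable_restr integrable_mult_right)
  then show "V (I - J) x \<le> V I x + V J x"
    unfolding ramp_norm_cmult by simp
qed

definition \<alpha> :: "nat \<Rightarrow> nat \<Rightarrow> real" where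
  "\<alpha> n i = sqrt (mass (dil n i) / (3 * side n))"

lemma \<alpha>_nonneg [simp]: "0 \<le> \<alpha> n i"
  by (simp add: \<alpha>_def)

lemma mass_dil: "mass (dil n i) = 3 * side n * (\<alpha> n i)\<^sup>2"
  by (simp add: \<alpha>_def)

text \<open>Twice 15 + 6 B. The 15 comes from the covering lemma (5) and the triple (3), the 6 B
  from the L^2 bound of the ramps; the doubling makes the selected subintervals fill at most half of
  an interval, see \<open>measure_core\<close>.\<close>

definition \<kappa> :: real where "\<kappa> = 30 + 12 * B"

text \<open>In both tests \<open>(m, i)\<close> is the interval selected last and
  \<open>(n, j)\<close> a descendant. One test controls \<open>f\<close> itself, the other the ramps
  of its restriction to the triple of \<open>(m, i)\<close>.\<close>

definition bad_mass :: "nat \<Rightarrow> nat \<Rightarrow> nat \<Rightarrow> nat \<Rightarrow> bool" where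
  "bad_mass m i n j \<longleftrightarrow> \<kappa> * (\<alpha> m i)\<^sup>2 * (3 * side n) < mass (dil n j)"

definition bad_norm :: "nat \<Rightarrow> nat \<Rightarrow> nat \<Rightarrow> nat \<Rightarrow> bool" where
  "bad_norm m i n j \<longleftrightarrow> \<kappa> * (\<alpha> m i)\<^sup>2 * side n
     < (LINT x|lborel. indicator (node n j) x * (V (dil m i) x)\<^sup>2)"

text \<open>It is the parents of the first bad intervals that are selected: all ancestors of a selected
  interval and the interval itself are good, so that only oscillations have to be controlled.\<close>
definition stop :: "nat \<Rightarrow> nat \<Rightarrow> nat \<Rightarrow> nat \<Rightarrow> bool" where
  "stop m i n j \<longleftrightarrow> (\<exists>j' \<in> {2 * j, 2 * j + 1}. bad_mass m i (Suc n) j' \<or> bad_norm m i (Suc n) j')"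

text \<open>The level of the smallest selected interval that contains \<open>(n, j)\<close>,
  computed from the root downwards; the root counts as selected. Thus \<open>(n, j)\<close> is
  selected exactly when \<open>last_stop n j = n\<close>, and the whole stopping family is encoded
  in this function.\<close>

fun last_stop :: "nat \<Rightarrow> nat \<Rightarrow> nat" where
  "last_stop 0 j = 0"
| "last_stop (Suc n) j = (let m = last_stop n (j div 2) in
     if stop m (j div 2 ^ (Suc n - m)) (Suc n) j then Suc n else m)"

lemma last_stop_le: "last_stop n j \<le> n"
  by (induction n j rule: last_stop.induct) (auto simp: Let_def le_SucI)

lemma last_stop_idx_Suc:
  assumes "q \<le> x"
  shows "last_stop (Suc n) (idx (Suc n) x) = (let m = last_stop n (idx n x) in
     if stop m (idx m x) (Suc n) (idx (Suc n) x) then Suc n else m)"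
  using assms last_stop_le[of n "idx n x"] by (simp add: idx_Suc_div idx_le_div Let_def)

lemma \<kappa>_ge: "30 \<le> \<kappa>" "6 * B \<le> \<kappa>"
  using B_nonneg by (auto simp: \<kappa>_def)

lemma V_L2:
  assumes "J \<in> sets borel" "I \<in> sets borel"
  shows "integrable lborel (\<lambda>x. indicator I x * (V J x)\<^sup>2)"
    and "(LINT x|lborel. indicator I x * (V J x)\<^sup>2) \<le> B * mass J"
proof -
  note [measurable] = assms
  note n = ramp_norm_L2[OF square_integrable_restr[OF assms(1)]]
  show i: "integrable lborel (\<lambda>x. indicator I x * (V J x)\<^sup>2)"
    by (rule Bochner_Integration.integrable_bound[OF n(1)]) (auto simp: indicator_def)
  have "(LINT x|lborel. indicator I x * (V J x)\<^sup>2) \<le> (LINT x|lborel. (V J x)\<^sup>2)"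
    by (rule integral_mono[OF i n(1)]) (auto simp: indicator_def)
  with n(2) show "(LINT x|lborel. indicator I x * (V J x)\<^sup>2) \<le> B * mass J" by (simp add: mass_def)
qed

text \<open>As \<open>stop\<close> tests the children, it is goodness of level n - 1 that bounds the
  mass at level n. For n = Suc m no test is assumed, and monotonicity loses a factor 2, which
  \<open>\<kappa>\<close> absorbs.\<close>

lemma good_mass:
  assumes x: "q \<le> x" and mn: "m \<le> n"
    and good: "\<And>j. m < j \<Longrightarrow> j < n \<Longrightarrow> \<not> stop m (idx m x) j (idx j x)"
  shows "mass (dil n (idx n x)) \<le> \<kappa> * (\<alpha> m (idx m x))\<^sup>2 * (3 * side n)"
proof -
  consider "n = m" | "n = Suc m" | n' where "n = Suc n'" "m < n'"
    using mn by (metis Suc_lessI Suc_less_eq le_neq_implies_less less_imp_Suc_add not0_implies_Suc gr_implies_not0)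
  then show ?thesis
  proof cases
    case 1
    have "1 * ((\<alpha> m (idx m x))\<^sup>2 * (3 * side m)) \<le> \<kappa> * ((\<alpha> m (idx m x))\<^sup>2 * (3 * side m))"
      using \<kappa>_ge by (intro mult_right_mono) auto
    then show ?thesis unfolding 1 mass_dil by (simp add: mult_ac)
  next
    case 2
    have "mass (dil n (idx n x)) \<le> mass (dil m (idx m x))"
      by (intro mass_mono dil_idx_mono x mn) auto
    also have "\<dots> = 2 * ((\<alpha> m (idx m x))\<^sup>2 * (3 * side n))"
      unfolding mass_dil 2 side_Suc[of m] by simp
    also have "\<dots> \<le> \<kappa> * ((\<alpha> m (idx m x))\<^sup>2 * (3 * side n))"
      using \<kappa>_ge by (intro mult_right_mono) auto
    finally show ?thesis by (simp add: mult_ac)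
  next
    case 3
    then have "\<not> stop m (idx m x) n' (idx n' x)" using good by simp
    then show ?thesis using idx_Suc_cases[OF x, of n'] 3 by (auto simp: stop_def bad_mass_def not_less)
  qed
qed

text \<open>For n \<le> Suc m no test is available and the global L^2 bound is used: 3 B relative to
  \<open>side m\<close>, hence 6 B relative to \<open>side n\<close>. This is where
  \<open>6 * B \<le> \<kappa>\<close> is needed.\<close>

lemma good_norm:
  assumes x: "q \<le> x" and mn: "m \<le> n"
    and good: "\<And>j. m < j \<Longrightarrow> j < n \<Longrightarrow> \<not> stop m (idx m x) j (idx j x)"
  shows "(LINT y|lborel. indicator (node n (idx n x)) y * (V (dil m (idx m x)) y)\<^sup>2)
    \<le> \<kappa> * (\<alpha> m (idx m x))\<^sup>2 * side n"
proof -
  consider "n \<le> Suc m" | n' where "n = Suc n'" "m < n'"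
    using mn by (metis Suc_le_lessD less_Suc_eq_le not_less_eq_eq old.nat.exhaust le0)
  then show ?thesis
  proof cases
    case 1
    have "(LINT y|lborel. indicator (node n (idx n x)) y * (V (dil m (idx m x)) y)\<^sup>2) \<le> B * mass (dil m (idx m x))"
      by (rule V_L2(2)) auto
    also have "\<dots> = 3 * B * (\<alpha> m (idx m x))\<^sup>2 * side m" by (simp add: mass_dil)
    also have "\<dots> \<le> 3 * B * (\<alpha> m (idx m x))\<^sup>2 * (2 * side n)"
      using side_mono[OF 1] B_nonneg side_Suc[of m] by (intro mult_left_mono) auto
    also have "\<dots> = 6 * B * ((\<alpha> m (idx m x))\<^sup>2 * side n)" by simp
    also have "\<dots> \<le> \<kappa> * ((\<alpha> m (idx m x))\<^sup>2 * side n)"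
      using \<kappa>_ge by (intro mult_right_mono) auto
    finally show ?thesis by (simp add: mult_ac)
  next
    case 2
    then have "\<not> stop m (idx m x) n' (idx n' x)" using good by simp
    then show ?thesis using idx_Suc_cases[OF x, of n'] 2 by (auto simp: stop_def bad_norm_def not_less)
  qed
qed

text \<open>7296 = 1216 * 3 * 2: the constant of \<open>ramp_oscillation\<close>, the length of a
  triple, and \<open>side r = 2 * side (Suc r)\<close>.\<close>

definition osc_const :: real where "osc_const = sqrt (7296 * B * \<kappa>)"

definition step_const :: real where "step_const = 2 * osc_const + sqrt (2 * \<kappa> + 6 * B * \<kappa>)"

lemma osc_const_nonneg [simp]: "0 \<le> osc_const"
  using B_nonneg \<kappa>_ge by (simp add: osc_const_def)

abbreviation "ramp_dist g x u \<equiv> L2_set (\<lambda>k. cmod (ramp (a k) (b k) g x - ramp (a k) (b k) g u)) K"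

text \<open>On the annulus \<open>f\<close> stays at distance at least R =
  \<open>side (Suc r)\<close> from the cell of x and u, while |x - u| is at most
  \<open>side n\<close>. So \<open>ramp_oscillation\<close> gains the ratio of the two scales, and
  \<open>good_mass\<close> bounds the energy in terms of the selected interval.\<close>

lemma annulus_oscillation:
  assumes x: "q \<le> x" and u: "u \<in> node n (idx n x)" and mr: "m \<le> r" "r < n"
    and good: "\<And>j. m < j \<Longrightarrow> j < n \<Longrightarrow> \<not> stop m (idx m x) j (idx j x)"
  shows "ramp_dist (restr (dil r (idx r x) - dil (Suc r) (idx (Suc r) x))) x u
    \<le> osc_const * \<alpha> m (idx m x) * (side n / side (Suc r))"
proof -
  let ?A = "dil r (idx r x) - dil (Suc r) (idx (Suc r) x)" and ?R = "side (Suc r)"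
  have uq: "q \<le> u" and ui: "idx n u = idx n x" using u by (auto simp: mem_node)
  have iu: "idx (Suc r) u = idx (Suc r) x"
    using idx_eq_mono[OF uq x _ ui, of "Suc r"] mr by auto
  have xu: "x \<in> node (Suc r) (idx (Suc r) x)" "u \<in> node (Suc r) (idx (Suc r) x)"
    using x uq iu by (auto simp: mem_node)
  have d: "\<bar>x - u\<bar> \<le> side n"
    using node_dist_less[of x n "idx n x" u] x u by (auto simp: mem_node)
  have "(\<Sum>k\<in>K. (cmod (ramp (a k) (b k) (restr ?A) x - ramp (a k) (b k) (restr ?A) u))\<^sup>2)
    \<le> 1216 * B * \<bar>x - u\<bar>\<^sup>2 / ?R ^ 3 * energy (restr ?A)"
  proof (rule ramp_oscillation)
    show "square_integrable (restr ?A)" by (rule square_integrable_restr) auto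
    fix y assume "restr ?A y \<noteq> 0"
    then have y: "y \<in> dil r (idx r x)" "y \<notin> dil (Suc r) (idx (Suc r) x)" by (auto simp: restr_def split: if_splits)
    show "\<bar>y - (q + side r * (idx r x + 1 / 2))\<bar> \<le> 3 * ?R \<and> ?R \<le> \<bar>x - y\<bar> \<and> ?R \<le> \<bar>u - y\<bar>"
      using dil_center[OF y(1)] dil_separated[OF xu(1) y(2)] dil_separated[OF xu(2) y(2)] by simp
  qed simp
  also have "\<dots> \<le> 1216 * B * (side n)\<^sup>2 / ?R ^ 3 * (\<kappa> * (\<alpha> m (idx m x))\<^sup>2 * (3 * side r))"
  proof (intro mult_mono divide_right_mono power_mono d order.refl)
    have "energy (restr ?A) \<le> mass (dil r (idx r x))"
      unfolding mass_def[symmetric] by (rule mass_mono) auto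
    also have "\<dots> \<le> \<kappa> * (\<alpha> m (idx m x))\<^sup>2 * (3 * side r)"
      using good mr by (intro good_mass x) auto
    finally show "energy (restr ?A) \<le> \<kappa> * (\<alpha> m (idx m x))\<^sup>2 * (3 * side r)" .
  qed (use B_nonneg in auto)
  also have "\<dots> = (osc_const * \<alpha> m (idx m x) * (side n / ?R))\<^sup>2"
  proof -
    have "osc_const\<^sup>2 = 7296 * B * \<kappa>" using B_nonneg \<kappa>_ge by (simp add: osc_const_def)
    then show ?thesis
      by (simp add: power_mult_distrib power_divide side_Suc[of r] power2_eq_square power3_eq_cube)
  qed
  finally have "L2_set (\<lambda>k. cmod (ramp (a k) (b k) (restr ?A) x - ramp (a k) (b k) (restr ?A) u)) K
    \<le> sqrt ((osc_const * \<alpha> m (idx m x) * (side n / ?R))\<^sup>2)"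
    unfolding L2_set_def by (rule real_sqrt_le_mono)
  then show ?thesis by simp
qed

lemma total_oscillation:
  assumes x: "q \<le> x" and u: "u \<in> node n (idx n x)" and mr: "m \<le> r" "r \<le> n"
    and good: "\<And>j. m < j \<Longrightarrow> j < n \<Longrightarrow> \<not> stop m (idx m x) j (idx j x)"
  shows "ramp_dist (restr (dil m (idx m x) - dil r (idx r x))) x u
    \<le> 2 * osc_const * \<alpha> m (idx m x) * (side n / side r)"
  using mr
proof (induction r rule: dec_induct)
  case base
  have "restr (dil m (idx m x) - dil m (idx m x)) = (\<lambda>_. 0)" by (simp add: restr_def fun_eq_iff)
  then show ?case by (simp add: L2_set_def)
next
  case (step r)
  let ?D = "\<lambda>n. dil n (idx n x)"
  have sub: "?D (Suc r) \<subseteq> ?D r" "?D r \<subseteq> ?D m" by (rule dil_idx_mono[OF x]; use step in simp)+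
  have eq: "restr (?D m - ?D (Suc r)) = (\<lambda>y. restr (?D m - ?D r) y + restr (?D r - ?D (Suc r)) y)"
    using sub by (auto simp: restr_def fun_eq_iff)
  have "ramp_dist (restr (?D m - ?D (Suc r))) x u
    \<le> L2_set (\<lambda>k. cmod (ramp (a k) (b k) (restr (?D m - ?D r)) x - ramp (a k) (b k) (restr (?D m - ?D r)) u)
        + cmod (ramp (a k) (b k) (restr (?D r - ?D (Suc r))) x - ramp (a k) (b k) (restr (?D r - ?D (Suc r))) u)) K"
  proof (rule L2_set_mono)
    fix k assume k: "k \<in> K"
    have i: "integrable lborel (restr (?D m - ?D r))" "integrable lborel (restr (?D r - ?D (Suc r)))"
      by (intro integrable_restr; simp)+
    show "cmod (ramp (a k) (b k) (restr (?D m - ?D (Suc r))) x - ramp (a k) (b k) (restr (?D m - ?D (Suc r))) u)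
      \<le> cmod (ramp (a k) (b k) (restr (?D m - ?D r)) x - ramp (a k) (b k) (restr (?D m - ?D r)) u)
        + cmod (ramp (a k) (b k) (restr (?D r - ?D (Suc r))) x - ramp (a k) (b k) (restr (?D r - ?D (Suc r))) u)"
      unfolding eq ramp_add[OF i less[OF k]] by (rule order.trans[OF _ norm_triangle_ineq]) (simp add: algebra_simps)
  qed simp
  also have "\<dots> \<le> ramp_dist (restr (?D m - ?D r)) x u + ramp_dist (restr (?D r - ?D (Suc r))) x u"
    by (rule L2_set_triangle_ineq)
  also have "\<dots> \<le> 2 * osc_const * \<alpha> m (idx m x) * (side n / side r) + osc_const * \<alpha> m (idx m x) * (side n / side (Suc r))"
    using step by (intro add_mono annulus_oscillation[OF x u _ _ good]) auto
  \<comment> \<open>The geometric series in closed form: 2 / \<open>side r\<close> + 1 /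
    \<open>side (Suc r)\<close> = 2 / \<open>side (Suc r)\<close>.\<close>
  also have "\<dots> = 2 * osc_const * \<alpha> m (idx m x) * (side n / side (Suc r))"
    unfolding side_Suc[of r] by (simp add: field_simps)
  finally show ?case .
qed

text \<open>The part of \<open>f\<close> between the two triples hardly oscillates on the small
  node, so its value at \<open>x\<close> is compared with its values at all \<open>u\<close> of that
  node. Averaging squares over \<open>u\<close> replaces the uncontrolled point value by L^2 means
  that goodness controls.\<close>

lemma stopping_step:
  assumes x: "q \<le> x" and mn: "m \<le> n"
    and good: "\<And>j. m < j \<Longrightarrow> j < n \<Longrightarrow> \<not> stop m (idx m x) j (idx j x)"
  shows "V (dil m (idx m x)) x \<le> step_const * \<alpha> m (idx m x) + V (dil n (idx n x)) x"
proof -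
  let ?D = "\<lambda>n. dil n (idx n x)" and ?a = "\<alpha> m (idx m x)" and ?I = "node n (idx n x)"
  have sub: "?D n \<subseteq> ?D m" by (rule dil_idx_mono[OF x mn])
  let ?y = "V (?D m - ?D n) x" and ?z = "2 * osc_const * ?a"
  have pt: "?y - ?z \<le> V (?D m) u + V (?D n) u" if u: "u \<in> ?I" for u
  proof -
    let ?g = "restr (?D m - ?D n)"
    have "?y \<le> L2_set (\<lambda>k. cmod (ramp (a k) (b k) ?g u) + cmod (ramp (a k) (b k) ?g x - ramp (a k) (b k) ?g u)) K"
      unfolding ramp_norm_def
    proof (rule L2_set_mono)
      fix k show "cmod (ramp (a k) (b k) ?g x) \<le> cmod (ramp (a k) (b k) ?g u) + cmod (ramp (a k) (b k) ?g x - ramp (a k) (b k) ?g u)"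
        by (rule norm_triangle_sub)
    qed simp
    also have "\<dots> \<le> V (?D m - ?D n) u + ramp_dist ?g x u"
      unfolding ramp_norm_def by (rule L2_set_triangle_ineq)
    also have "ramp_dist ?g x u \<le> ?z"
      using total_oscillation[OF x u mn order.refl good] by simp
    also have "V (?D m - ?D n) u \<le> V (?D m) u + V (?D n) u"
      by (rule V_diff_le(2)[OF sub]) auto
    finally show ?thesis by simp
  qed
  \<comment> \<open>The mean square of the larger ramps is at most \<kappa> a^2 by
    \<open>good_norm\<close>, that of the smaller ones at most 3 B \<kappa> a^2 by
    \<open>V_L2\<close> and \<open>good_mass\<close>; squaring a sum of two terms doubles
    both.\<close>
  have "?y - ?z \<le> sqrt (2 * \<kappa> + 6 * B * \<kappa>) * ?a"
  proof (cases "0 \<le> ?y - ?z")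
    case True
    have P: "(LINT u|lborel. indicator ?I u * (V (?D m) u)\<^sup>2) \<le> \<kappa> * ?a\<^sup>2 * side n"
      by (rule good_norm[OF x mn good])
    have "B * mass (?D n) \<le> B * (\<kappa> * ?a\<^sup>2 * (3 * side n))"
      by (intro mult_left_mono good_mass[OF x mn good] B_nonneg)
    then have R: "(LINT u|lborel. indicator ?I u * (V (?D n) u)\<^sup>2) \<le> 3 * B * \<kappa> * ?a\<^sup>2 * side n"
      using V_L2(2)[of "?D n" ?I] by (simp add: mult_ac)
    have i: "integrable lborel (\<lambda>u. indicator ?I u * (V (?D j) u)\<^sup>2)" for j
      by (rule V_L2(1)) auto
    have "(?y - ?z)\<^sup>2 * side n = (LINT u|lborel. indicator ?I u * (?y - ?z)\<^sup>2)"
      by (simp add: mult.commute)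
    also have "\<dots> \<le> (LINT u|lborel. 2 * (indicator ?I u * (V (?D m) u)\<^sup>2) + 2 * (indicator ?I u * (V (?D n) u)\<^sup>2))"
    proof (rule integral_mono)
      show "integrable lborel (\<lambda>u. indicator ?I u * (?y - ?z)\<^sup>2)"
        by (intro integrable_mult_left) (simp add: node_def integrable_indicator_iff)
      show "integrable lborel (\<lambda>u. 2 * (indicator ?I u * (V (?D m) u)\<^sup>2) + 2 * (indicator ?I u * (V (?D n) u)\<^sup>2))"
        by (intro Bochner_Integration.integrable_add integrable_mult_right i)
      fix u
      show "indicator ?I u * (?y - ?z)\<^sup>2 \<le> 2 * (indicator ?I u * (V (?D m) u)\<^sup>2) + 2 * (indicator ?I u * (V (?D n) u)\<^sup>2)"
      proof (cases "u \<in> ?I")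
        case u: True
        have "(?y - ?z)\<^sup>2 \<le> (V (?D m) u + V (?D n) u)\<^sup>2" using pt[OF u] True by (intro power_mono) auto
        also have "\<dots> \<le> 2 * (V (?D m) u)\<^sup>2 + 2 * (V (?D n) u)\<^sup>2"
          using sum_squares_bound[of "V (?D m) u" "V (?D n) u"] by (simp add: power2_sum)
        finally show ?thesis using u by simp
      qed simp
    qed
    also have "\<dots> = 2 * (LINT u|lborel. indicator ?I u * (V (?D m) u)\<^sup>2) + 2 * (LINT u|lborel. indicator ?I u * (V (?D n) u)\<^sup>2)"
      using i[of m] i[of n] by simp
    also have "\<dots> \<le> 2 * (\<kappa> * ?a\<^sup>2 * side n) + 2 * (3 * B * \<kappa> * ?a\<^sup>2 * side n)"
      using P R by linarith
    also have "\<dots> = (2 * \<kappa> + 6 * B * \<kappa>) * ?a\<^sup>2 * side n" by (simp add: algebra_simps)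
    finally have "(?y - ?z)\<^sup>2 \<le> (2 * \<kappa> + 6 * B * \<kappa>) * ?a\<^sup>2" by simp
    then have "sqrt ((?y - ?z)\<^sup>2) \<le> sqrt ((2 * \<kappa> + 6 * B * \<kappa>) * ?a\<^sup>2)" by (rule real_sqrt_le_mono)
    with True show ?thesis by (simp add: real_sqrt_mult)
  next
    case False
    have "0 \<le> sqrt (2 * \<kappa> + 6 * B * \<kappa>) * ?a" using B_nonneg \<kappa>_ge by (intro mult_nonneg_nonneg) auto
    with False show ?thesis by linarith
  qed
  moreover have "V (?D m) x \<le> ?y + V (?D n) x"
    by (rule V_diff_le(1)[OF sub]) auto
  ultimately show ?thesis unfolding step_const_def by (simp add: algebra_simps)
qed

end

text \<open>The weak-type (1,1) argument for maximal functions: Vitali's lemma picks disjoint balls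
  whose fivefold enlargements cover the union, and every picked ball carries its share of the
  integral of \<open>g\<close>.\<close>

lemma covering_weak_type:
  fixes c r :: "'i \<Rightarrow> real" and g :: "real \<Rightarrow> ennreal"
  assumes "finite I" and r: "\<And>i. i \<in> I \<Longrightarrow> 0 < r i" and [measurable]: "g \<in> borel_measurable lebesgue"
    and le: "\<And>i. i \<in> I \<Longrightarrow> ennreal (t * (2 * r i)) \<le> (\<integral>\<^sup>+y\<in>cball (c i) (r i). g y \<partial>lebesgue)"
    and t: "0 \<le> t"
  shows "ennreal t * emeasure lebesgue (\<Union>i\<in>I. cball (c i) (r i)) \<le> 5 * (\<integral>\<^sup>+y. g y \<partial>lebesgue)"
proof -
  obtain M where M: "\<And>i. i \<in> I \<Longrightarrow> r i \<le> M"
    using bdd_above_finite[OF finite_imageI[OF \<open>finite I\<close>, of r]] unfolding bdd_above_def by auto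
  have rM: "\<And>i. i \<in> I \<Longrightarrow> 0 < r i \<and> r i \<le> M" using r M by auto
  obtain C where "countable C" and C: "C \<subseteq> I" "pairwise (\<lambda>i j. disjnt (cball (c i) (r i)) (cball (c j) (r j))) C"
    "(\<Union>i\<in>I. cball (c i) (r i)) \<subseteq> (\<Union>i\<in>C. cball (c i) (5 * r i))"
    by (rule Vitali_covering_lemma_cballs[OF order.refl rM])
  have finC: "finite C" using C(1) \<open>finite I\<close> by (rule finite_subset)
  let ?D = "density lebesgue g"
  have cb: "emeasure lebesgue (cball p s) = ennreal (2 * s)" if "0 < s" for p s :: real
    using that by (simp add: cball_eq_atLeastAtMost)
  have "emeasure lebesgue (\<Union>i\<in>I. cball (c i) (r i)) \<le> emeasure lebesgue (\<Union>i\<in>C. cball (c i) (5 * r i))"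
    by (rule emeasure_mono[OF C(3)]) (use finC in \<open>intro sets.finite_UN; simp\<close>)
  also have "\<dots> \<le> (\<Sum>i\<in>C. emeasure lebesgue (cball (c i) (5 * r i)))"
    by (rule emeasure_subadditive_finite[OF finC]) auto
  also have "\<dots> = (\<Sum>i\<in>C. ennreal (2 * (5 * r i)))"
    using C(1) r by (intro sum.cong refl cb) auto
  finally have "ennreal t * emeasure lebesgue (\<Union>i\<in>I. cball (c i) (r i)) \<le> ennreal t * (\<Sum>i\<in>C. ennreal (2 * (5 * r i)))"
    by (rule mult_left_mono) simp
  also have "\<dots> = (\<Sum>i\<in>C. 5 * ennreal (t * (2 * r i)))"
    unfolding sum_distrib_left
  proof (intro sum.cong refl)
    fix i assume "i \<in> C"
    then have "0 < r i" using C(1) r by auto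
    then show "ennreal t * ennreal (2 * (5 * r i)) = 5 * ennreal (t * (2 * r i))"
      using t by (simp add: ennreal_mult[symmetric] ennreal_numeral[symmetric] mult_ac del: ennreal_numeral)
  qed
  also have "\<dots> \<le> (\<Sum>i\<in>C. 5 * emeasure ?D (cball (c i) (r i)))"
    using C(1) by (intro sum_mono mult_left_mono) (auto simp: emeasure_density intro!: le)
  also have "\<dots> = 5 * emeasure ?D (\<Union>i\<in>C. cball (c i) (r i))"
    unfolding sum_distrib_left[symmetric]
    by (subst sum_emeasure) (use C(2) finC in \<open>auto simp: disjoint_family_on_def pairwise_def disjnt_def\<close>)
  also have "\<dots> \<le> 5 * emeasure ?D UNIV"
    by (intro mult_left_mono emeasure_mono) auto
  also have "emeasure ?D UNIV = (\<integral>\<^sup>+y. g y \<partial>lebesgue)"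
    by (simp add: emeasure_density)
  finally show ?thesis .
qed

lemma covering_weak_type_real:
  fixes c r :: "'i \<Rightarrow> real" and g :: "real \<Rightarrow> real"
  assumes fin: "finite I" and r: "\<And>i. i \<in> I \<Longrightarrow> 0 < r i" and g: "integrable lborel g" "\<And>x. 0 \<le> g x"
    and le: "\<And>i. i \<in> I \<Longrightarrow> t * (2 * r i) \<le> (LINT y|lborel. indicator (cball (c i) (r i)) y * g y)"
    and t: "0 \<le> t"
  shows "t * measure lborel (\<Union>i\<in>I. cball (c i) (r i)) \<le> 5 * (LINT y|lborel. g y)"
proof -
  have [measurable]: "g \<in> borel_measurable borel" using g(1) by auto
  have "ennreal t * emeasure lebesgue (\<Union>i\<in>I. cball (c i) (r i)) \<le> 5 * (\<integral>\<^sup>+y. ennreal (g y) \<partial>lebesgue)"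
  proof (rule covering_weak_type[OF fin r _ _ t])
    fix i assume i: "i \<in> I"
    have int: "integrable lborel (\<lambda>y. indicator (cball (c i) (r i)) y * g y)"
      by (rule Bochner_Integration.integrable_bound[OF g(1)]) (auto simp: indicator_def)
    have "ennreal (t * (2 * r i)) \<le> ennreal (LINT y|lborel. indicator (cball (c i) (r i)) y * g y)"
      by (rule ennreal_leI[OF le[OF i]])
    also have "\<dots> = (\<integral>\<^sup>+y. ennreal (indicator (cball (c i) (r i)) y * g y) \<partial>lborel)"
      using g(2) by (intro nn_integral_eq_integral[symmetric] int) (auto intro!: mult_nonneg_nonneg)
    also have "\<dots> = (\<integral>\<^sup>+y\<in>cball (c i) (r i). ennreal (g y) \<partial>lebesgue)"
      unfolding nn_integral_completion by (intro nn_integral_cong) (auto simp: indicator_def)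
    finally show "ennreal (t * (2 * r i)) \<le> \<dots>" .
  qed (auto intro!: measurable_completion)
  also have "(\<integral>\<^sup>+y. ennreal (g y) \<partial>lebesgue) = ennreal (LINT y|lborel. g y)"
    unfolding nn_integral_completion using g by (intro nn_integral_eq_integral) auto
  also have "5 * ennreal (LINT y|lborel. g y) = ennreal (5 * (LINT y|lborel. g y))"
    by (simp add: ennreal_mult' )
  also have "emeasure lebesgue (\<Union>i\<in>I. cball (c i) (r i)) = emeasure lborel (\<Union>i\<in>I. cball (c i) (r i))"
  proof -
    have "(\<Union>i\<in>I. cball (c i) (r i)) \<in> sets lborel" using fin by (intro sets.finite_UN) auto
    then show ?thesis by (simp add: emeasure_completion main_part_sets)
  qed
  also have "\<dots> = ennreal (measure lborel (\<Union>i\<in>I. cball (c i) (r i)))"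
  proof (rule emeasure_eq_ennreal_measure)
    have "compact (\<Union>i\<in>I. cball (c i) (r i))" using fin by (intro compact_UN) auto
    then show "emeasure lborel (\<Union>i\<in>I. cball (c i) (r i)) \<noteq> top"
      using emeasure_bounded_finite[OF compact_imp_bounded] by force
  qed
  finally show ?thesis
    using t g(2) by (simp add: ennreal_mult[symmetric] Bochner_Integration.integral_nonneg)
qed

section \<open>Sums along branches and the disjoint cores of selected intervals\<close>

context stopping_tree
begin

lemma last_stop_mono:
  assumes "q \<le> x" "n \<le> n'"
  shows "last_stop n (idx n x) \<le> last_stop n' (idx n' x)"
  using assms(2)
proof (induction n' rule: dec_induct)
  case (step n')
  then show ?case
    using last_stop_idx_Suc[OF assms(1), of n'] last_stop_le[of n' "idx n' x"] by (auto simp: Let_def)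
qed simp

lemma last_stop_idem:
  assumes "q \<le> x"
  shows "last_stop (last_stop n (idx n x)) (idx (last_stop n (idx n x)) x) = last_stop n (idx n x)"
proof (induction n)
  case (Suc n)
  then show ?case
    using last_stop_idx_Suc[OF assms, of n] by (auto simp: Let_def)
qed simp

lemma last_stop_good:
  assumes "q \<le> x" "last_stop n (idx n x) < j" "j \<le> n"
  shows "\<not> stop (last_stop n (idx n x)) (idx (last_stop n (idx n x)) x) j (idx j x)"
  using assms(2,3)
proof (induction n)
  case (Suc n)
  then show ?case
    using last_stop_idx_Suc[OF assms(1), of n] by (auto simp: Let_def le_Suc_eq split: if_splits)
qed simp

definition selected :: "nat \<Rightarrow> real \<Rightarrow> nat set" where
  "selected n x = {k. k \<le> n \<and> last_stop k (idx k x) = k}"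

lemma finite_selected [simp]: "finite (selected n x)"
  by (rule finite_subset[of _ "{..n}"]) (auto simp: selected_def)

lemma f_eq_restr: "x \<in> root \<Longrightarrow> f = restr (dil 0 (idx 0 x))"
  using f_supp node_subset_dil[of 0 0] mem_node[of x 0 0] unfolding restr_def fun_eq_iff root_eq_node by auto

lemma step_const_pos: "0 < step_const"
proof -
  have "0 < sqrt (2 * \<kappa> + 6 * B * \<kappa>)"
    using \<kappa>_ge B_nonneg by (intro real_sqrt_gt_zero add_pos_nonneg mult_nonneg_nonneg) auto
  then show ?thesis unfolding step_const_def using osc_const_nonneg by linarith
qed

text \<open>\<open>stopping_step\<close> is iterated from one selected interval containing
  \<open>x\<close> to the next; each passage charges the average of the interval that is
  left.\<close>

lemma branch_sum:
  assumes x: "x \<in> root"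
  shows "ramp_norm f x \<le> step_const * (\<Sum>k\<in>selected n x. \<alpha> k (idx k x)) + V (dil n (idx n x)) x"
proof -
  have xq: "q \<le> x" using x by (rule rootD)
  let ?t = "\<lambda>n. last_stop n (idx n x)" and ?S = "\<lambda>N. \<Sum>k\<in>selected N x. \<alpha> k (idx k x)"
  let ?V = "\<lambda>n. V (dil n (idx n x)) x"
  \<comment> \<open>Only selected levels strictly before the current one are charged; the current
    one is still represented by the term \<open>?V (?t n)\<close>.\<close>
  let ?A = "\<lambda>n. {k. k < ?t n \<and> ?t k = k}"
  have fA: "finite (?A n)" for n by (rule finite_subset[of _ "{..?t n}"]) auto
  \<comment> \<open>\<open>stopping_step\<close> needs goodness strictly below its target level, so
    the target may be a newly selected level \<open>Suc n\<close>. The case \<open>n' = n\<close>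
    serves for the last passage, to the remainder.\<close>
  have step: "?V (?t n) \<le> step_const * \<alpha> (?t n) (idx (?t n) x) + ?V n'" if "n \<le> n'" "n' \<le> Suc n" for n n'
  proof (rule stopping_step[OF xq])
    show "?t n \<le> n'" using last_stop_le[of n "idx n x"] that by simp
    fix j assume "?t n < j" "j < n'"
    then show "\<not> stop (?t n) (idx (?t n) x) j (idx j x)"
      using that by (intro last_stop_good[OF xq]) auto
  qed
  have sub: "step_const * (\<Sum>k\<in>?A n. \<alpha> k (idx k x)) + step_const * \<alpha> (?t n) (idx (?t n) x) \<le> step_const * (\<Sum>k\<in>A'. \<alpha> k (idx k x))"
    if "insert (?t n) (?A n) \<subseteq> A'" "finite A'" for n A'
  proof -
    have "(\<Sum>k\<in>?A n. \<alpha> k (idx k x)) + \<alpha> (?t n) (idx (?t n) x) = (\<Sum>k\<in>insert (?t n) (?A n). \<alpha> k (idx k x))"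
      by (subst sum.insert) (auto intro: fA)
    also have "\<dots> \<le> (\<Sum>k\<in>A'. \<alpha> k (idx k x))" using that by (intro sum_mono2) auto
    finally show ?thesis using step_const_pos by (simp add: distrib_left[symmetric])
  qed
  have main: "ramp_norm f x \<le> step_const * (\<Sum>k\<in>?A n. \<alpha> k (idx k x)) + ?V (?t n)" for n
  proof (induction n)
    case 0
    then show ?case using f_eq_restr[OF x] by simp
  next
    case (Suc n)
    show ?case
    proof (cases "?t (Suc n) = ?t n")
      case True
      then show ?thesis using Suc by simp
    next
      case False
      then have t: "?t (Suc n) = Suc n" using last_stop_idx_Suc[OF xq, of n] by (auto simp: Let_def split: if_splits)
      have "insert (?t n) (?A n) \<subseteq> ?A (Suc n)"
        unfolding t using last_stop_idem[OF xq, of n] last_stop_le[of n "idx n x"] by auto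
      from sub[OF this fA] Suc step[of n "Suc n"] show ?thesis unfolding t by simp
    qed
  qed
  have "insert (?t n) (?A n) \<subseteq> selected n x"
    using last_stop_idem[OF xq, of n] last_stop_le[of n "idx n x"] by (auto simp: selected_def)
  from sub[OF this finite_selected] main[of n] step[of n n] show ?thesis by simp
qed

text \<open>For fixed bounded \<open>f\<close> and finitely many bounded frequency intervals the
  remainder is at most a multiple of \<open>side n\<close>. The depth depends on \<open>f\<close>
  and \<open>K\<close>, but the bound \<open>step_const\<close> does not.\<close>

lemma V_dil_small:
  "\<exists>n. \<forall>x. V (dil n (idx n x)) x \<le> step_const"
proof -
  define S where "S = (\<Sum>k\<in>K. b k - a k)"
  have S: "0 \<le> S" unfolding S_def using less by (intro sum_nonneg) (simp add: less_imp_le)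
  have le: "V (dil n i) x \<le> S * F * 3 * side n" for n i x
  proof -
    have "(LINT y|lborel. cmod (restr (dil n i) y)) \<le> (LINT y|lborel. F * indicator (dil n i) y)"
    proof (rule integral_mono)
      show "integrable lborel (\<lambda>y. F * indicator (dil n i) y :: real)"
        by (intro integrable_mult_right) (simp add: dil_def integrable_indicator_iff emeasure_lborel_Icc_eq)
      show "integrable lborel (\<lambda>y. cmod (restr (dil n i) y))"
        by (intro integrable_norm integrable_restr) simp
    qed (auto simp: restr_def f_bound)
    also have "\<dots> = F * (3 * side n)"
    proof -
      have "q + side n * (real i - 1) \<le> q + side n * real (i + 2)" by (intro add_left_mono mult_left_mono) auto
      then show ?thesis by (simp add: dil_def algebra_simps)
    qed
    finally have *: "(LINT y|lborel. cmod (restr (dil n i) y)) \<le> F * (3 * side n)" .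
    have "V (dil n i) x \<le> S * (LINT y|lborel. cmod (restr (dil n i) y))"
      unfolding S_def by (rule ramp_norm_le) (simp add: integrable_restr)
    also have "\<dots> \<le> S * (F * (3 * side n))" by (rule mult_left_mono[OF * S])
    finally show ?thesis by (simp add: mult_ac)
  qed
  have "(\<lambda>n. S * F * 3 * (len * (1 / 2) ^ n)) \<longlonglongrightarrow> S * F * 3 * (len * 0)"
    by (intro tendsto_intros LIMSEQ_power_zero) auto
  then have "\<forall>\<^sub>F n in sequentially. S * F * 3 * (len * (1 / 2) ^ n) < step_const"
    using step_const_pos by (intro order_tendstoD(2)) auto
  then obtain n where "S * F * 3 * (len * (1 / 2) ^ n) < step_const"
    by (auto simp: eventually_sequentially)
  then have "S * F * 3 * side n < step_const" by (simp add: side_def power_divide)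
  with le show ?thesis by (meson order.trans less_imp_le)
qed

definition tree :: "nat \<Rightarrow> (nat \<times> nat) set" where
  "tree N = {(n, i). n \<le> N \<and> i < 2 ^ n \<and> last_stop n i = n}"

lemma finite_tree [simp]: "finite (tree N)"
proof (rule finite_subset)
  show "tree N \<subseteq> (SIGMA n:{..N}. {..<2 ^ n})" by (auto simp: tree_def)
qed auto

text \<open>Of the height \<open>2 * step_const\<close> one half is spent on the remainder; what is
  left forces the sum of averages above 1.\<close>

lemma superlevel_subset:
  "\<exists>N. {x\<in>root. 2 * step_const < ramp_norm f x}
     \<subseteq> {x\<in>root. 1 < (\<Sum>(n, i)\<in>tree N. \<alpha> n i * indicator (node n i) x)}"
proof -
  obtain N where N: "\<And>x. V (dil N (idx N x)) x \<le> step_const" using V_dil_small by blast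
  show ?thesis
  proof (intro exI[of _ N] subsetI CollectI conjI; elim CollectE conjE)
    fix x assume x: "x \<in> root" and big: "2 * step_const < ramp_norm f x"
    have "2 * step_const < step_const * (\<Sum>k\<in>selected N x. \<alpha> k (idx k x)) + step_const"
      using big branch_sum[OF x, of N] N[of x] by linarith
    then have "step_const * 1 < step_const * (\<Sum>k\<in>selected N x. \<alpha> k (idx k x))" by simp
    then have "1 < (\<Sum>k\<in>selected N x. \<alpha> k (idx k x))"
      using step_const_pos by (simp only: mult_less_cancel_left_pos)
    also have "\<dots> = (\<Sum>(n, i)\<in>(\<lambda>k. (k, idx k x)) ` selected N x. \<alpha> n i * indicator (node n i) x)"
      by (subst sum.reindex) (auto simp: inj_on_def mem_node rootD[OF x])
    also have "\<dots> \<le> (\<Sum>(n, i)\<in>tree N. \<alpha> n i * indicator (node n i) x)"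
      by (rule sum_mono2[OF finite_tree]) (auto simp: selected_def tree_def idx_less[OF x])
    finally show "1 < (\<Sum>(n, i)\<in>tree N. \<alpha> n i * indicator (node n i) x)" .
  qed
qed

text \<open>The part of a selected interval not covered by later selections up to level
  \<open>N\<close>. Phrased by \<open>last_stop\<close>, disjointness is immediate;
  \<open>core_eq\<close> gives the set-difference form needed for the measure.\<close>

definition core :: "nat \<Rightarrow> nat \<Rightarrow> nat \<Rightarrow> real set" where
  "core N m i = {x\<in>node m i. \<forall>k. m \<le> k \<and> k \<le> N \<longrightarrow> last_stop k (idx k x) = m}"

lemma core_disjoint:
  assumes "(m, i) \<in> tree N" "(m', i') \<in> tree N" "(m, i) \<noteq> (m', i')"
  shows "core N m i \<inter> core N m' i' = {}"
proof -
  have *: False if "(m, i) \<in> tree N" "(m', i') \<in> tree N" "x \<in> core N m i" "x \<in> core N m' i'" "m < m'" for m i m' i' x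
  proof -
    have "last_stop m' (idx m' x) = m" using that by (auto simp: core_def tree_def)
    moreover have "last_stop m' (idx m' x) = m'" using that by (auto simp: core_def tree_def mem_node)
    ultimately show False using that by simp
  qed
  show ?thesis
  proof (rule ccontr)
    assume "\<not> ?thesis"
    then obtain x where x: "x \<in> core N m i" "x \<in> core N m' i'" by auto
    then have "m = m'" using *[OF assms(1,2)] *[OF assms(2,1)] by (meson linorder_neqE_nat)
    moreover have "i = i'" using x calculation by (auto simp: core_def mem_node)
    ultimately show False using assms(3) by simp
  qed
qed

text \<open>The maximal selected intervals inside \<open>(m, i)\<close>: asking that the dyadic
  parent still has last stop \<open>m\<close> excludes grandchildren.\<close>

definition children :: "nat \<Rightarrow> nat \<Rightarrow> nat \<Rightarrow> (nat \<times> nat) set" where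
  "children N m i = {(k, j). m < k \<and> k \<le> N \<and> j < 2 ^ k \<and> last_stop k j = k \<and>
     last_stop (k - 1) (j div 2) = m \<and> j div 2 ^ (k - m) = i}"

lemma finite_children [simp]: "finite (children N m i)"
proof (rule finite_subset)
  show "children N m i \<subseteq> (SIGMA n:{..N}. {..<2 ^ n})" by (auto simp: children_def)
qed auto

text \<open>Along the branch of \<open>x\<close>, the first level where \<open>last_stop\<close>
  leaves \<open>m\<close> is the level of a child containing \<open>x\<close>.\<close>

lemma core_eq:
  assumes t: "(m, i) \<in> tree N"
  shows "core N m i = node m i - (\<Union>(k, j)\<in>children N m i. node k j)"
proof (rule set_eqI)
  fix x
  have im: "i < 2 ^ m" "last_stop m i = m" "m \<le> N" using t by (auto simp: tree_def)
  show "x \<in> core N m i \<longleftrightarrow> x \<in> node m i - (\<Union>(k, j)\<in>children N m i. node k j)"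
  proof (cases "x \<in> node m i")
    case True
    then have xq: "q \<le> x" and xi: "idx m x = i" by (auto simp: mem_node)
    have xr: "x \<in> root"
    proof -
      have "idx m x div 2 ^ m = 0" using xi im(1) by (simp add: div_eq_0_iff)
      then have "idx 0 x = 0" using idx_le_div[OF xq, of 0 m] by simp
      then show ?thesis using xq by (simp add: root_eq_node mem_node)
    qed
    have "(\<forall>k. m \<le> k \<and> k \<le> N \<longrightarrow> last_stop k (idx k x) = m) \<longleftrightarrow> (\<forall>(k, j)\<in>children N m i. x \<notin> node k j)"
    proof (intro iffI)
      assume *: "\<forall>k. m \<le> k \<and> k \<le> N \<longrightarrow> last_stop k (idx k x) = m"
      show "\<forall>(k, j)\<in>children N m i. x \<notin> node k j"
      proof (clarify)
        fix k j assume "(k, j) \<in> children N m i" "x \<in> node k j"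
        then show False using *[rule_format, of k] by (auto simp: children_def mem_node)
      qed
    next
      assume *: "\<forall>(k, j)\<in>children N m i. x \<notin> node k j"
      have "last_stop k (idx k x) = m" if "m \<le> k" "k \<le> N" for k
        using that
      proof (induction k rule: dec_induct)
        case base
        then show ?case using xi im by simp
      next
        case (step k)
        then have tk: "last_stop k (idx k x) = m" by simp
        show ?case
        proof (rule ccontr)
          assume ne: "last_stop (Suc k) (idx (Suc k) x) \<noteq> m"
          then have "last_stop (Suc k) (idx (Suc k) x) = Suc k"
            using last_stop_idx_Suc[OF xq, of k] tk by (auto simp: Let_def split: if_splits)
          then have "(Suc k, idx (Suc k) x) \<in> children N m i"
            using step tk idx_less[OF xr, of "Suc k"] idx_le_div[OF xq, of m "Suc k"] xi
            by (simp add: children_def idx_Suc_div[OF xq] del: last_stop.simps)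
          with * xq show False by (auto simp: mem_node)
        qed
      qed
      then show "\<forall>k. m \<le> k \<and> k \<le> N \<longrightarrow> last_stop k (idx k x) = m" by blast
    qed
    then show ?thesis using True by (auto simp: core_def)
  qed (auto simp: core_def)
qed

lemma sets_core [measurable]: "(m, i) \<in> tree N \<Longrightarrow> core N m i \<in> sets borel"
  unfolding core_eq by (intro sets.Diff sets.finite_UN) auto

lemma children_disjoint: "disjoint_family_on (\<lambda>(k, j). node k j) (children N m i)"
proof -
  have *: False if "(k, j) \<in> children N m i" "(k', j') \<in> children N m i" "x \<in> node k j" "x \<in> node k' j'" "k < k'" for k j k' j' x
  proof -
    have x: "q \<le> x" "idx k x = j" "idx k' x = j'" using that by (auto simp: mem_node)
    obtain k'' where k'': "k' = Suc k''" using \<open>k < k'\<close> gr0_implies_Suc by fastforce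
    have "k = last_stop k (idx k x)" using that x by (auto simp: children_def)
    also have "\<dots> \<le> last_stop k'' (idx k'' x)" using that k'' x by (intro last_stop_mono) auto
    also have "\<dots> = m" using that k'' x idx_Suc_div[OF x(1), of k''] by (auto simp: children_def)
    finally show False using that by (auto simp: children_def)
  qed
  show ?thesis
    unfolding disjoint_family_on_def
  proof (intro ballI impI, rule ccontr)
    fix p p' assume A: "p \<in> children N m i" "p' \<in> children N m i" "p \<noteq> p'"
      and "(case p of (k, j) \<Rightarrow> node k j) \<inter> (case p' of (k, j) \<Rightarrow> node k j) \<noteq> {}"
    then obtain x k j k' j' where p: "p = (k, j)" "p' = (k', j')" and x: "x \<in> node k j" "x \<in> node k' j'"
      by (cases p; cases p') auto
    then have "k = k'" using *[of k j k' j' x] *[of k' j' k j x] A p by (meson linorder_neqE_nat)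
    then show False using x A(3) p by (auto simp: mem_node)
  qed
qed

lemma children_stop:
  assumes "(k, j) \<in> children N m i"
  shows "stop m i k j"
proof -
  obtain k' where k: "k = Suc k'" using assms by (cases k) (auto simp: children_def)
  have h: "last_stop k' (j div 2) = m" "j div 2 ^ (Suc k' - m) = i" and "last_stop (Suc k') j = Suc k'" "m \<le> k'"
    using assms k by (auto simp: children_def simp del: last_stop.simps)
  then show ?thesis unfolding k last_stop.simps Let_def h by (simp split: if_splits)
qed

lemma children_subset_dil:
  assumes "(k, j) \<in> children N m i" "j' \<in> {2 * j, 2 * j + 1}"
  shows "dil (Suc k) j' \<subseteq> dil m i"
proof -
  define x where "x = q + side k * j"
  have x: "x \<in> node k j" by (simp add: x_def node_def)
  then have xq: "q \<le> x" and xk: "idx k x = j" by (auto simp: mem_node)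
  have "m \<le> k" "j div 2 ^ (k - m) = i" using assms by (auto simp: children_def)
  then have "idx m x = i" using idx_le_div[OF xq, of m k] xk by simp
  with dil_idx_mono[OF xq \<open>m \<le> k\<close>] xk have "dil k j \<subseteq> dil m i" by simp
  moreover have "dil (Suc k) j' \<subseteq> dil k j" using assms(2) by (intro dil_Suc_subset) auto
  ultimately show ?thesis by blast
qed

lemma node_Suc_subset: "j' \<in> {2 * j, 2 * j + 1} \<Longrightarrow> node (Suc n) j' \<subseteq> node n j"
proof
  fix x assume "j' \<in> {2 * j, 2 * j + 1}" "x \<in> node (Suc n) j'"
  then show "x \<in> node n j" using idx_Suc_div[of x n] by (auto simp: mem_node)
qed

lemma dil_eq_cball: "dil n j = cball (q + side n * (j + 1 / 2)) (3 / 2 * side n)"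
  by (auto simp: dil_def cball_eq_atLeastAtMost algebra_simps)

lemma node_fmeasurable [simp]: "node n i \<in> fmeasurable lborel"
proof (rule fmeasurableI)
  have "q + side n * real i \<le> q + side n * real (i + 1)" by (intro add_left_mono mult_left_mono) auto
  then show "emeasure lborel (node n i) < \<infinity>" by (simp add: node_def)
qed simp

lemma children_fmeasurable:
  assumes "A \<subseteq> children N m i"
  shows "(\<Union>(k, j)\<in>A. node k j) \<in> fmeasurable lborel"
proof -
  have "finite A" using assms finite_children by (rule finite_subset)
  then show ?thesis
    by (intro fmeasurable.finite_UN) auto
qed

text \<open>Vitali is applied to the triples of the bad subintervals, which cover the selected
  children by \<open>dil_Suc_subset\<close> and stay inside the triple of \<open>(m, i)\<close>. The
  constant is 5 for the covering times 3 for the triple.\<close>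

lemma measure_bad_mass:
  fixes N :: nat
  assumes pos: "0 < \<alpha> m i"
  defines "A \<equiv> {(k, j)\<in>children N m i. \<exists>j'\<in>{2 * j, 2 * j + 1}. bad_mass m i (Suc k) j'}"
  shows "\<kappa> * measure lborel (\<Union>(k, j)\<in>A. node k j) \<le> 15 * side m"
proof -
  have A: "A \<subseteq> children N m i" by (auto simp: A_def)
  have finA: "finite A" using A finite_children by (rule finite_subset)
  have "\<forall>p\<in>A. \<exists>j'. j' \<in> {2 * snd p, 2 * snd p + 1} \<and> bad_mass m i (Suc (fst p)) j'"
    unfolding A_def by fastforce
  then obtain h where h: "\<And>p. p \<in> A \<Longrightarrow> h p \<in> {2 * snd p, 2 * snd p + 1} \<and> bad_mass m i (Suc (fst p)) (h p)"
    by metis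
  define c :: "nat \<times> nat \<Rightarrow> real" where "c p = q + side (Suc (fst p)) * (h p + 1 / 2)" for p
  define r :: "nat \<times> nat \<Rightarrow> real" where "r p = 3 / 2 * side (Suc (fst p))" for p
  have ball: "cball (c p) (r p) = dil (Suc (fst p)) (h p)" for p
    by (simp add: dil_eq_cball c_def r_def)
  let ?g = "\<lambda>y. indicator (dil m i) y * (cmod (f y))\<^sup>2"
  have ig: "integrable lborel ?g"
    by (rule Bochner_Integration.integrable_bound[OF square_integrableD(2)[OF square_integrable_f]]) (auto simp: indicator_def)
  let ?t = "\<kappa> * (\<alpha> m i)\<^sup>2"
  have "?t * measure lborel (\<Union>p\<in>A. cball (c p) (r p)) \<le> 5 * (LINT y|lborel. ?g y)"
  proof (rule covering_weak_type_real[OF finA _ ig])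
    fix p assume p: "p \<in> A"
    obtain k j where kj: "p = (k, j)" by (cases p)
    have sub: "dil (Suc k) (h p) \<subseteq> dil m i"
      using p h[OF p] A kj by (intro children_subset_dil[of k j N]) auto
    have "?t * (2 * r p) = ?t * (3 * side (Suc k))" by (simp add: r_def kj)
    also have "\<dots> \<le> mass (dil (Suc k) (h p))"
      using h[OF p] unfolding bad_mass_def kj by simp
    also have "\<dots> = (LINT y|lborel. indicator (cball (c p) (r p)) y * ?g y)"
      unfolding mass_eq ball kj fst_conv
      by (intro Bochner_Integration.integral_cong refl) (use sub kj in \<open>auto simp: indicator_def\<close>)
    finally show "?t * (2 * r p) \<le> \<dots>" .
  qed (use \<kappa>_ge in \<open>auto simp: r_def\<close>)
  also have "(LINT y|lborel. ?g y) = mass (dil m i)" by (simp add: mass_eq)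
  also have "5 * mass (dil m i) = (\<alpha> m i)\<^sup>2 * (15 * side m)" by (simp add: mass_dil)
  finally have "(\<alpha> m i)\<^sup>2 * (\<kappa> * measure lborel (\<Union>p\<in>A. cball (c p) (r p))) \<le> (\<alpha> m i)\<^sup>2 * (15 * side m)"
    by (simp add: mult_ac)
  then have *: "\<kappa> * measure lborel (\<Union>p\<in>A. cball (c p) (r p)) \<le> 15 * side m"
    using pos by simp
  have "measure lborel (\<Union>(k, j)\<in>A. node k j) \<le> measure lborel (\<Union>p\<in>A. cball (c p) (r p))"
  proof (rule measure_mono_fmeasurable)
    show "(\<Union>(k, j)\<in>A. node k j) \<subseteq> (\<Union>p\<in>A. cball (c p) (r p))"
    proof
      fix x assume "x \<in> (\<Union>(k, j)\<in>A. node k j)"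
      then obtain k j where kj: "(k, j) \<in> A" "x \<in> node k j" by auto
      have "node k j \<subseteq> dil (Suc k) (h (k, j))" using h[OF kj(1)] by (intro dil_Suc_subset(2)) auto
      then show "x \<in> (\<Union>p\<in>A. cball (c p) (r p))" unfolding ball using kj by (intro UN_I[of "(k, j)"]) auto
    qed
    show "(\<Union>(k, j)\<in>A. node k j) \<in> sets lborel" using children_fmeasurable[OF A] by auto
    show "(\<Union>p\<in>A. cball (c p) (r p)) \<in> fmeasurable lborel"
      using finA by (intro fmeasurable.finite_UN fmeasurable_compact) auto
  qed
  then have "\<kappa> * measure lborel (\<Union>(k, j)\<in>A. node k j) \<le> \<kappa> * measure lborel (\<Union>p\<in>A. cball (c p) (r p))"
    using \<kappa>_ge by (intro mult_left_mono) auto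
  with * show ?thesis by linarith
qed

text \<open>Children are disjoint, so their integrals add up to at most the global L^2 bound, B
  times the mass of a triple. A bad interval is half of the selected child, hence 6 B = 2 * 3 *
  B.\<close>

lemma measure_bad_norm:
  fixes N :: nat
  assumes pos: "0 < \<alpha> m i"
  defines "A \<equiv> {(k, j)\<in>children N m i. \<exists>j'\<in>{2 * j, 2 * j + 1}. bad_norm m i (Suc k) j'}"
  shows "\<kappa> * measure lborel (\<Union>(k, j)\<in>A. node k j) \<le> 6 * B * side m"
proof -
  have A: "A \<subseteq> children N m i" by (auto simp: A_def)
  have finA: "finite A" using A finite_children by (rule finite_subset)
  let ?W = "V (dil m i)"
  have int: "integrable lborel (\<lambda>x. indicator (node k j) x * (?W x)\<^sup>2)" for k j
    by (rule V_L2(1)) auto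
  have single: "\<kappa> * (\<alpha> m i)\<^sup>2 * side k \<le> 2 * (LINT x|lborel. indicator (node k j) x * (?W x)\<^sup>2)" if kj: "(k, j) \<in> A" for k j
  proof -
    obtain j' where j': "j' \<in> {2 * j, 2 * j + 1}" "bad_norm m i (Suc k) j'" using kj by (auto simp: A_def)
    have "\<kappa> * (\<alpha> m i)\<^sup>2 * side k = 2 * (\<kappa> * (\<alpha> m i)\<^sup>2 * side (Suc k))" by (simp add: side_Suc[of k])
    also have "\<dots> \<le> 2 * (LINT x|lborel. indicator (node (Suc k) j') x * (?W x)\<^sup>2)"
      using j'(2) unfolding bad_norm_def by simp
    also have "\<dots> \<le> 2 * (LINT x|lborel. indicator (node k j) x * (?W x)\<^sup>2)"
      using node_Suc_subset[OF j'(1)] by (intro mult_left_mono integral_mono int) (auto simp: indicator_def)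
    finally show ?thesis .
  qed
  have dj: "disjoint_family_on (\<lambda>p. node (fst p) (snd p)) A"
    using disjoint_family_on_mono[OF A children_disjoint] by (simp add: case_prod_unfold)
  have "measure lborel (\<Union>(k, j)\<in>A. node k j) \<le> (\<Sum>p\<in>A. measure lborel (node (fst p) (snd p)))"
    unfolding case_prod_unfold using finA by (intro measure_UNION_le) auto
  also have "\<dots> = (\<Sum>p\<in>A. side (fst p))" by simp
  finally have "\<kappa> * (\<alpha> m i)\<^sup>2 * measure lborel (\<Union>(k, j)\<in>A. node k j) \<le> \<kappa> * (\<alpha> m i)\<^sup>2 * (\<Sum>p\<in>A. side (fst p))"
    using \<kappa>_ge by (intro mult_left_mono) auto
  also have "\<dots> \<le> (\<Sum>p\<in>A. 2 * (LINT x|lborel. indicator (node (fst p) (snd p)) x * (?W x)\<^sup>2))"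
    unfolding sum_distrib_left by (intro sum_mono single) simp
  also have "\<dots> = 2 * (LINT x|lborel. (\<Sum>p\<in>A. indicator (node (fst p) (snd p)) x * (?W x)\<^sup>2))"
    by (simp add: sum_distrib_left[symmetric] Bochner_Integration.integral_sum int)
  also have "(LINT x|lborel. (\<Sum>p\<in>A. indicator (node (fst p) (snd p)) x * (?W x)\<^sup>2))
     = (LINT x|lborel. indicator (\<Union>p\<in>A. node (fst p) (snd p)) x * (?W x)\<^sup>2)"
    by (simp add: sum_distrib_right[symmetric] indicator_UN_disjoint[OF finA dj])
  also have "\<dots> \<le> B * mass (dil m i)"
    using finA by (intro V_L2(2)) auto
  also have "2 * (B * mass (dil m i)) = (\<alpha> m i)\<^sup>2 * (6 * B * side m)" by (simp add: mass_dil)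
  finally have "(\<alpha> m i)\<^sup>2 * (\<kappa> * measure lborel (\<Union>(k, j)\<in>A. node k j)) \<le> (\<alpha> m i)\<^sup>2 * (6 * B * side m)"
    by (simp add: mult_ac)
  then show ?thesis using pos by simp
qed

text \<open>The two estimates above divide by the square of the average. If it vanishes, both sides
  of the strict inequalities in the tests are 0 and nothing below is selected.\<close>

lemma children_empty:
  assumes "\<alpha> m i = 0"
  shows "children N m i = {}"
proof (rule ccontr)
  assume "\<not> ?thesis"
  then obtain k j where kj: "(k, j) \<in> children N m i" by auto
  then obtain j' where j': "j' \<in> {2 * j, 2 * j + 1}" "bad_mass m i (Suc k) j' \<or> bad_norm m i (Suc k) j'"
    using children_stop[OF kj] by (auto simp: stop_def)
  have m0: "mass (dil m i) = 0" using assms by (simp add: mass_dil)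
  have "mass (dil (Suc k) j') \<le> mass (dil m i)"
    by (intro mass_mono children_subset_dil[OF kj j'(1)]) auto
  moreover have "(LINT x|lborel. indicator (node (Suc k) j') x * (V (dil m i) x)\<^sup>2) \<le> B * mass (dil m i)"
    by (rule V_L2(2)) auto
  ultimately show False using j'(2) assms m0 by (auto simp: bad_mass_def bad_norm_def)
qed

lemma measure_core:
  assumes t: "(m, i) \<in> tree N"
  shows "side m \<le> 2 * measure lborel (core N m i)"
proof (cases "\<alpha> m i = 0")
  case True
  then show ?thesis unfolding core_eq[OF t] children_empty[OF True] by simp
next
  case False
  then have pos: "0 < \<alpha> m i" by (simp add: less_le)
  let ?A1 = "{(k, j)\<in>children N m i. \<exists>j'\<in>{2 * j, 2 * j + 1}. bad_mass m i (Suc k) j'}"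
  let ?A2 = "{(k, j)\<in>children N m i. \<exists>j'\<in>{2 * j, 2 * j + 1}. bad_norm m i (Suc k) j'}"
  let ?U = "\<lambda>A. \<Union>(k, j)\<in>A. node k j"
  have sub: "?A1 \<subseteq> children N m i" "?A2 \<subseteq> children N m i" by auto
  have "children N m i \<subseteq> ?A1 \<union> ?A2"
  proof
    fix p assume p: "p \<in> children N m i"
    obtain k j where kj: "p = (k, j)" by (cases p)
    show "p \<in> ?A1 \<union> ?A2" using children_stop[of k j N m i] p unfolding kj stop_def by blast
  qed
  then have un: "?U (children N m i) = ?U ?A1 \<union> ?U ?A2" by blast
  have fm: "?U ?A1 \<in> fmeasurable lborel" "?U ?A2 \<in> fmeasurable lborel" "?U (children N m i) \<in> fmeasurable lborel"
    using children_fmeasurable[OF sub(1)] children_fmeasurable[OF sub(2)] children_fmeasurable[OF order.refl] by auto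
  have "measure lborel (?U (children N m i)) \<le> measure lborel (?U ?A1) + measure lborel (?U ?A2)"
    unfolding un using fm by (intro measure_Un_le) auto
  then have "\<kappa> * measure lborel (?U (children N m i)) \<le> \<kappa> * (measure lborel (?U ?A1) + measure lborel (?U ?A2))"
    using \<kappa>_ge by (intro mult_left_mono) auto
  also have "\<dots> \<le> 15 * side m + 6 * B * side m"
    using measure_bad_mass[OF pos, of N] measure_bad_norm[OF pos, of N] by (simp add: distrib_left)
  \<comment> \<open>This equation determines the value of \<open>\<kappa>\<close>.\<close>
  also have "\<dots> = \<kappa> * (side m / 2)" by (simp add: \<kappa>_def algebra_simps)
  finally have half: "measure lborel (?U (children N m i)) \<le> side m / 2"
    using \<kappa>_ge by (simp add: mult_le_cancel_left)
  have "measure lborel (node m i) \<le> measure lborel (core N m i \<union> ?U (children N m i))"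
    unfolding core_eq[OF t] using fm(3)
    by (intro measure_mono_fmeasurable fmeasurable.Un fmeasurable.Diff node_fmeasurable) auto
  also have "\<dots> \<le> measure lborel (core N m i) + measure lborel (?U (children N m i))"
    using fm t by (intro measure_Un_le) auto
  finally show ?thesis using half by simp
qed

lemma node_laminar:
  assumes "(m, i) \<in> tree N" "(n, j) \<in> tree N" "node m i \<inter> node n j \<noteq> {}"
  shows "node m i \<subseteq> node n j \<or> node n j \<subseteq> node m i"
proof -
  obtain x where "x \<in> node m i" "x \<in> node n j" using assms(3) by blast
  then have x: "q \<le> x" "idx m x = i" "idx n x = j" by (auto simp: mem_node)
  show ?thesis
  proof (cases "m \<le> n")
    case True
    then have "node n j \<subseteq> node m i" using idx_eq_mono[OF _ x(1) True] x by (auto simp: mem_node)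
    then show ?thesis ..
  next
    case False
    then have "node m i \<subseteq> node n j" using idx_eq_mono[OF _ x(1), of _ n m] x by (auto simp: mem_node)
    then show ?thesis ..
  qed
qed

end

subsection \<open>Weights\<close>

lemma sigma_finite_lebesgue: "sigma_finite_measure (lebesgue :: real measure)"
proof
  show "\<exists>A. countable A \<and> A \<subseteq> sets (lebesgue :: real measure) \<and> \<Union> A = space (lebesgue :: real measure) \<and> (\<forall>a\<in>A. emeasure lebesgue a \<noteq> \<infinity>)"
  proof (intro exI[of _ "range (\<lambda>n::nat. {- real n..real n})"] conjI ballI)
    show "\<Union> (range (\<lambda>n::nat. {- real n..real n})) = space (lebesgue :: real measure)"
    proof (auto)
      fix x :: real
      obtain n where "\<bar>x\<bar> \<le> real n" using real_arch_simple by blast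
      then show "\<exists>n::nat. - real n \<le> x \<and> x \<le> real n" by (intro exI[of _ n]) auto
    qed
  qed auto
qed

lemma AE_lebesgue_singleton: "AE x in lebesgue. x \<noteq> (c::real)"
  using AE_completion[OF AE_lborel_singleton[of c]] .

locale A1_weight =
  fixes w :: "real \<Rightarrow> real"
  assumes w_A1: "w \<in> A1_class"
begin

abbreviation "\<mu> \<equiv> weight_measure w"

abbreviation weighted_energy :: "(real \<Rightarrow> complex) \<Rightarrow> ennreal" where
  "weighted_energy f \<equiv> \<integral>\<^sup>+x. ennreal ((cmod (f x))\<^sup>2) * ennreal (w x) \<partial>lebesgue"

lemma w_meas [measurable]: "w \<in> borel_measurable lebesgue"
  and w_nonneg [simp]: "0 \<le> w x"
  and w_integrable: "compact C \<Longrightarrow> set_integrable lebesgue C w"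
  and A1_finite: "A1_const w < \<infinity>"
  using w_A1 by (auto simp: A1_class_def weight_def)

lemma Ainf_finite: "Ainf_const w < \<infinity>"
  using Ainf_const_le_A1_const[OF w_A1] A1_finite by (rule le_less_trans)

lemma sets_weight [measurable_cong, simp]: "sets \<mu> = sets lebesgue"
  by (simp add: weight_measure_def)

lemma space_weight [simp]: "space \<mu> = UNIV"
  by (simp add: weight_measure_def)

lemma emeasure_weight: "A \<in> sets lebesgue \<Longrightarrow> emeasure \<mu> A = (\<integral>\<^sup>+x\<in>A. ennreal (w x) \<partial>lebesgue)"
  unfolding weight_measure_def by (rule emeasure_density) measurable

lemma emeasure_weight_finite:
  assumes "bounded A" "A \<in> sets lebesgue"
  shows "emeasure \<mu> A < \<infinity>"
proof -
  obtain c where "\<forall>x\<in>A. norm x \<le> c" using assms(1) unfolding bounded_iff by (elim exE)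
  then have c: "A \<subseteq> cball 0 c" by (auto simp: dist_norm)
  have i: "integrable lebesgue (\<lambda>x. indicator (cball 0 c) x *\<^sub>R w x)"
    using w_integrable[of "cball 0 c"] by (simp add: set_integrable_def)
  have "emeasure \<mu> A \<le> emeasure \<mu> (cball 0 c)"
    by (rule emeasure_mono[OF c]) auto
  also have "\<dots> = (\<integral>\<^sup>+x. ennreal (norm (indicator (cball 0 c) x *\<^sub>R w x)) \<partial>lebesgue)"
    by (subst emeasure_weight) (auto intro!: nn_integral_cong simp: indicator_def)
  also have "\<dots> < \<infinity>" using i unfolding integrable_iff_bounded by simp
  finally show ?thesis .
qed

lemma emeasure_weight_cong:
  assumes "AE x in lebesgue. x \<in> A \<longleftrightarrow> x \<in> A'" "A \<in> sets lebesgue" "A' \<in> sets lebesgue"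
  shows "emeasure \<mu> A = emeasure \<mu> A'"
  unfolding emeasure_weight[OF assms(2)] emeasure_weight[OF assms(3)]
  by (rule nn_integral_cong_AE) (use assms(1) in eventually_elim, auto simp: indicator_def)

text \<open>At points with w x = 0 the quotient is finite only if the maximal function vanishes,
  because c / 0 is infinite for nonzero c; so the product form holds there too.\<close>

lemma AE_maximal_le: "AE x in lebesgue. maximal w x \<le> A1_const w * ennreal (w x)"
proof -
  have "AE x in lebesgue. maximal w x / ennreal (w x) \<le> A1_const w"
    unfolding A1_const_def by (rule esssup_AE)
  then show ?thesis
  proof eventually_elim
    case (elim x)
    show ?case
    proof (cases "w x = 0")
      case True
      then have "maximal w x = 0"
        using elim A1_finite by (auto simp: ennreal_divide_zero split: if_splits)
      then show ?thesis by simp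
    next
      case False
      then have "0 < w x" using w_nonneg[of x] by (simp add: less_le)
      then have "maximal w x = maximal w x / ennreal (w x) * ennreal (w x)"
        by (simp add: ennreal_divide_times ennreal_times_divide mult_divide_eq_ennreal)
      also have "\<dots> \<le> A1_const w * ennreal (w x)"
        using elim by (rule mult_right_mono) simp
      finally show ?thesis .
    qed
  qed
qed

lemma maximal_ge:
  assumes "p < r" "x \<in> {p<..<r}"
  shows "(\<integral>\<^sup>+y\<in>{p<..<r}. ennreal \<bar>g y\<bar> \<partial>lebesgue) / ennreal (r - p) \<le> maximal g x"
  unfolding maximal_def using assms by (intro SUP_upper2[of "(p, r)"]) auto

lemma AE_average_le:
  assumes pr: "p < r"
  shows "AE x in lebesgue. x \<in> {p<..<r} \<longrightarrow> emeasure \<mu> {p<..<r} \<le> ennreal (r - p) * (A1_const w * ennreal (w x))"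
  using AE_maximal_le
proof eventually_elim
  case (elim x)
  show ?case
  proof
    assume x: "x \<in> {p<..<r}"
    have "emeasure \<mu> {p<..<r} / ennreal (r - p) \<le> maximal w x"
      using maximal_ge[OF pr x, of w] by (simp add: emeasure_weight)
    also have "\<dots> \<le> A1_const w * ennreal (w x)" by (rule elim)
    finally have "ennreal (r - p) * (emeasure \<mu> {p<..<r} / ennreal (r - p)) \<le> ennreal (r - p) * (A1_const w * ennreal (w x))"
      by (rule mult_left_mono) simp
    moreover have "ennreal (r - p) * (emeasure \<mu> {p<..<r} / ennreal (r - p)) = emeasure \<mu> {p<..<r}"
      using pr by (simp add: ennreal_times_divide mult.commute[of "ennreal (r - p)"] mult_divide_eq_ennreal)
    ultimately show "emeasure \<mu> {p<..<r} \<le> ennreal (r - p) * (A1_const w * ennreal (w x))" by simp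
  qed
qed

lemma maximal_integral_le:
  assumes "p < r"
  shows "(\<integral>\<^sup>+x\<in>{p<..<r}. maximal (\<lambda>y. w y * indicator {p<..<r} y) x \<partial>lebesgue)
    \<le> Ainf_const w * emeasure \<mu> {p<..<r}" (is "?X \<le> _ * ?m")
proof -
  have le: "?X / ?m \<le> Ainf_const w"
    unfolding Ainf_const_def using assms by (intro SUP_upper2[of "(p, r)"]) auto
  show ?thesis
  proof (cases "?m = 0")
    case True
    then have "?X = 0" using le Ainf_finite by (auto simp: ennreal_divide_zero split: if_splits)
    then show ?thesis by simp
  next
    case False
    have fin: "?m < \<infinity>" by (rule emeasure_weight_finite) auto
    have "?X = ?X / ?m * ?m" using False fin
      by (simp add: ennreal_divide_times ennreal_times_divide mult_divide_eq_ennreal)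
    also have "\<dots> \<le> Ainf_const w * ?m" using le by (rule mult_right_mono) simp
    finally show ?thesis .
  qed
qed

text \<open>The maximal function of the restricted weight is at least its average at every point of
  the interval. The zero weight has constant 0, hence the positivity assumption.\<close>

lemma Ainf_ge_1:
  assumes pr: "p < r" and pos: "emeasure \<mu> {p<..<r} \<noteq> 0"
  shows "1 \<le> Ainf_const w"
proof -
  let ?m = "emeasure \<mu> {p<..<r}"
  have fin: "?m < \<infinity>" by (rule emeasure_weight_finite) auto
  have "?m = (\<integral>\<^sup>+x\<in>{p<..<r}. (?m / ennreal (r - p)) \<partial>lebesgue)"
  proof -
    have "(\<integral>\<^sup>+x\<in>{p<..<r}. (?m / ennreal (r - p)) \<partial>lebesgue) = ?m / ennreal (r - p) * emeasure lebesgue {p<..<r}"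
      by (rule nn_integral_cmult_indicator) simp
    also have "\<dots> = ?m"
      using pr by (simp add: ennreal_divide_times ennreal_times_divide mult_divide_eq_ennreal)
    finally show ?thesis ..
  qed
  also have "\<dots> \<le> (\<integral>\<^sup>+x\<in>{p<..<r}. maximal (\<lambda>y. w y * indicator {p<..<r} y) x \<partial>lebesgue)"
  proof (rule nn_integral_mono)
    fix x
    have "?m / ennreal (r - p) \<le> maximal (\<lambda>y. w y * indicator {p<..<r} y) x" if x: "x \<in> {p<..<r}"
    proof -
      have "?m = (\<integral>\<^sup>+y\<in>{p<..<r}. ennreal \<bar>w y * indicator {p<..<r} y\<bar> \<partial>lebesgue)"
        by (subst emeasure_weight) (auto intro!: nn_integral_cong simp: indicator_def)
      then show ?thesis using maximal_ge[OF pr x, of "\<lambda>y. w y * indicator {p<..<r} y"] by simp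
    qed
    then show "?m / ennreal (r - p) * indicator {p<..<r} x \<le> maximal (\<lambda>y. w y * indicator {p<..<r} y) x * indicator {p<..<r} x"
      by (auto simp: indicator_def)
  qed
  also have "\<dots> \<le> Ainf_const w * ?m" by (rule maximal_integral_le[OF pr])
  finally have "?m / ?m \<le> Ainf_const w * ?m / ?m" by (rule divide_right_mono_ennreal)
  then show ?thesis using pos fin by (simp add: mult_divide_eq_ennreal ennreal_divide_self)
qed

end

section \<open>Weighted estimates for the selected intervals\<close>

locale weighted_tree = stopping_tree K a b B q len f F + A1_weight w
  for K :: "'k set" and a b :: "'k \<Rightarrow> real" and B q len :: real and f F and w
begin

text \<open>Open versions, because the maximal function and the weight constants are suprema over
  open intervals; they differ from \<open>dil\<close> and \<open>node\<close> by null sets.\<close>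

definition dil_int :: "nat \<Rightarrow> nat \<Rightarrow> real set" where
  "dil_int n i = {q + side n * (real i - 1) <..< q + side n * real (i + 2)}"

definition node_int :: "nat \<Rightarrow> nat \<Rightarrow> real set" where
  "node_int n i = {q + side n * real i <..< q + side n * real (i + 1)}"

lemma node_ends: "q + side n * real i < q + side n * real (i + 1)"
  "q + side n * (real i - 1) < q + side n * real (i + 2)"
  by (intro add_strict_left_mono mult_strict_left_mono; simp)+

lemma node_lens: "q + side n * real (i + 1) - (q + side n * real i) = side n"
  "q + side n * real (i + 2) - (q + side n * (real i - 1)) = 3 * side n"
  by (simp_all add: algebra_simps)

lemma node_AE_eq: "AE x in lebesgue. x \<in> node n i \<longleftrightarrow> x \<in> node_int n i"
  using AE_lebesgue_singleton[of "q + side n * real i"]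
  by eventually_elim (simp only: node_def node_int_def atLeastLessThan_iff greaterThanLessThan_iff, linarith)

lemma node_subset_dil_int: "node n i \<subseteq> dil_int n i"
proof -
  have "side n * (real i - 1) < side n * i" "side n * real (i + 1) \<le> side n * real (i + 2)"
    by (intro mult_strict_left_mono mult_left_mono; simp)+
  then show ?thesis unfolding node_def dil_int_def
    by (intro subsetI) (simp only: atLeastLessThan_iff greaterThanLessThan_iff, linarith)
qed

lemma dil_AE_eq: "AE x in lebesgue. x \<in> dil n i \<longleftrightarrow> x \<in> dil_int n i"
  using AE_lebesgue_singleton[of "q + side n * (real i - 1)"] AE_lebesgue_singleton[of "q + side n * real (i + 2)"]
  by eventually_elim (simp only: dil_def dil_int_def atLeastAtMost_iff greaterThanLessThan_iff, linarith)

lemma sets_lebesgue_node [measurable, simp]: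
  "node n i \<in> sets lebesgue" "dil n i \<in> sets lebesgue" "node_int n i \<in> sets lebesgue" "dil_int n i \<in> sets lebesgue"
  by (auto simp: node_def dil_def node_int_def dil_int_def)

lemma emeasure_node_finite: "emeasure \<mu> (node n i) < \<infinity>" "emeasure \<mu> (dil_int n i) < \<infinity>"
  by (rule emeasure_weight_finite; simp add: node_def dil_int_def)+

lemma emeasure_node_int: "emeasure \<mu> (node n i) = emeasure \<mu> (node_int n i)"
  by (rule emeasure_weight_cong[OF node_AE_eq]) auto

lemma sets_lebesgue_core: "p \<in> tree N \<Longrightarrow> core N (fst p) (snd p) \<in> sets lebesgue"
  using sets_core[of "fst p" "snd p" N] by (intro sets_completionI_sets) auto

lemma emeasure_core:
  assumes "p \<in> tree N"
  shows "ennreal (side (fst p)) \<le> 2 * emeasure lebesgue (core N (fst p) (snd p))"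
proof -
  obtain m i where p: "p = (m, i)" by (cases p)
  have t: "(m, i) \<in> tree N" using assms p by simp
  have s: "core N m i \<in> sets lborel" using sets_core[OF t] by simp
  have fm: "core N m i \<in> fmeasurable lborel"
    by (rule fmeasurableI2[OF node_fmeasurable _ s]) (auto simp: core_def)
  have "ennreal (side m) \<le> ennreal (2 * measure lborel (core N m i))"
    by (rule ennreal_leI[OF measure_core[OF t]])
  also have "\<dots> = 2 * emeasure lborel (core N m i)"
    using fm by (simp add: ennreal_mult' emeasure_eq_measure2)
  also have "emeasure lborel (core N m i) = emeasure lebesgue (core N m i)"
    using s by (simp add: emeasure_completion main_part_sets)
  finally show ?thesis by (simp add: p)
qed

lemma core_disjoint_family:
  "T \<subseteq> tree N \<Longrightarrow> disjoint_family_on (\<lambda>p. core N (fst p) (snd p)) T"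
  unfolding disjoint_family_on_def
proof (intro ballI impI)
  fix p p' assume "T \<subseteq> tree N" "p \<in> T" "p' \<in> T" "p \<noteq> p'"
  then show "core N (fst p) (snd p) \<inter> core N (fst p') (snd p') = {}"
    by (intro core_disjoint) (auto simp: prod_eq_iff)
qed

text \<open>The Carleson packing condition with the \<open>A\<^sub>\<infinity>\<close> constant needs no reverse Hoelder inequality: on the
  disjoint parts the averages are dominated by the maximal function in the definition of that constant.\<close>
lemma carleson_packing:
  assumes Q: "Q \<in> tree N"
  shows "(\<Sum>p\<in>{p\<in>tree N. node (fst p) (snd p) \<subseteq> node (fst Q) (snd Q)}. emeasure \<mu> (node (fst p) (snd p)))
    \<le> 2 * Ainf_const w * emeasure \<mu> (node (fst Q) (snd Q))"
proof -
  obtain n0 i0 where Q0: "Q = (n0, i0)" by (cases Q)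
  let ?Q = "node_int n0 i0"
  let ?M = "maximal (\<lambda>y. w y * indicator ?Q y)"
  let ?T = "{p\<in>tree N. node (fst p) (snd p) \<subseteq> node n0 i0}"
  let ?E = "\<lambda>p. core N (fst p) (snd p)"
  have [measurable]: "?M \<in> borel_measurable lebesgue"
    by (rule measurable_completion) simp
  \<comment> \<open>The weight of the interval is its length times the average of w. The length is
    at most twice that of the core, and on the core the average is below the maximal function of the
    weight restricted to \<open>Q\<close>.\<close>
  have single: "emeasure \<mu> (node (fst p) (snd p)) \<le> 2 * (\<integral>\<^sup>+x\<in>?E p. ?M x \<partial>lebesgue)" if p: "p \<in> ?T" for p
  proof -
    obtain n i where ni: "p = (n, i)" by (cases p)
    have t: "(n, i) \<in> tree N" and sub: "node n i \<subseteq> node n0 i0" using p ni by auto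
    have int_sub: "node_int n i \<subseteq> ?Q"
      using interior_mono[OF sub] by (simp add: node_def node_int_def)
    let ?W = "emeasure \<mu> (node n i)"
    have W: "?W = (\<integral>\<^sup>+y\<in>node_int n i. ennreal \<bar>w y * indicator ?Q y\<bar> \<partial>lebesgue)"
      unfolding emeasure_node_int
      by (subst emeasure_weight) (use int_sub in \<open>auto intro!: nn_integral_cong simp: indicator_def\<close>)
    have s0: "ennreal (side n) \<noteq> 0" "ennreal (side n) < \<infinity>" by (auto simp: ennreal_eq_0_iff not_le)
    have "?W = ennreal (side n) * (?W / ennreal (side n))"
      using s0 by (simp add: ennreal_times_divide mult.commute[of "ennreal (side n)"] mult_divide_eq_ennreal)
    also have "\<dots> \<le> (2 * emeasure lebesgue (?E p)) * (?W / ennreal (side n))"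
      using emeasure_core[of p N] p ni by (intro mult_right_mono) auto
    also have "\<dots> = 2 * (\<integral>\<^sup>+x\<in>?E p. (?W / ennreal (side n)) \<partial>lebesgue)"
      using sets_lebesgue_core[of p N] p by (simp add: nn_integral_cmult_indicator mult_ac)
    also have "(\<integral>\<^sup>+x\<in>?E p. (?W / ennreal (side n)) \<partial>lebesgue) \<le> (\<integral>\<^sup>+x\<in>?E p. ?M x \<partial>lebesgue)"
    proof (rule nn_integral_mono_AE, use node_AE_eq[of n i] in eventually_elim)
      case (elim x)
      show ?case
      proof (cases "x \<in> ?E p")
        case True
        then have "x \<in> node_int n i" using elim ni by (auto simp: core_def)
        then have "?W / ennreal (side n) \<le> ?M x"
          using maximal_ge[OF node_ends(1)[of n i], of x "\<lambda>y. w y * indicator ?Q y"] unfolding W node_lens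
          by (simp add: node_int_def)
        then show ?thesis using True by simp
      qed simp
    qed
    finally show ?thesis by (simp add: ni mult_left_mono)
  qed
  have finT: "finite ?T" using finite_tree[of N] by simp
  have sE: "?E p \<in> sets lebesgue" if "p \<in> ?T" for p using sets_lebesgue_core that by auto
  have "(\<Sum>p\<in>?T. emeasure \<mu> (node (fst p) (snd p))) \<le> (\<Sum>p\<in>?T. 2 * (\<integral>\<^sup>+x\<in>?E p. ?M x \<partial>lebesgue))"
    by (rule sum_mono[OF single])
  also have "\<dots> = 2 * (\<Sum>p\<in>?T. emeasure (density lebesgue ?M) (?E p))"
    unfolding sum_distrib_left by (intro sum.cong refl) (use sE in \<open>auto simp: emeasure_density\<close>)
  also have "(\<Sum>p\<in>?T. emeasure (density lebesgue ?M) (?E p)) = emeasure (density lebesgue ?M) (\<Union>p\<in>?T. ?E p)"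
    using finT sE by (intro sum_emeasure core_disjoint_family) auto
  also have "\<dots> \<le> emeasure (density lebesgue ?M) (node n0 i0)"
    by (rule emeasure_mono) (auto simp: core_def)
  also have "\<dots> = (\<integral>\<^sup>+x\<in>node n0 i0. ?M x \<partial>lebesgue)"
    by (simp add: emeasure_density)
  also have "\<dots> = (\<integral>\<^sup>+x\<in>?Q. ?M x \<partial>lebesgue)"
    by (rule nn_integral_cong_AE) (use node_AE_eq[of n0 i0] in eventually_elim, auto simp: indicator_def)
  also have "\<dots> \<le> Ainf_const w * emeasure \<mu> ?Q"
    unfolding node_int_def by (rule maximal_integral_le[OF node_ends(1)])
  finally show ?thesis by (simp add: Q0 emeasure_node_int mult_left_mono mult.assoc)
qed

text \<open>Layer-cake decomposition with respect to the lower bounds \<open>m p\<close> of the weight on the dilated intervals: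
  at each height the covering lemma is applied to the part of \<open>f\<close> where the weight is large.\<close>
lemma weighted_large_mass:
  assumes t: "0 < t"
  shows "ennreal (t\<^sup>2) * (\<Sum>p\<in>{p\<in>tree N. t \<le> \<alpha> (fst p) (snd p)}. emeasure \<mu> (node (fst p) (snd p)))
    \<le> 30 * A1_const w * weighted_energy f"
proof -
  let ?T = "{p\<in>tree N. t \<le> \<alpha> (fst p) (snd p)}"
  let ?E = "\<lambda>p. core N (fst p) (snd p)"
  have finT: "finite ?T" using finite_tree[of N] by simp
  obtain A where A: "A1_const w = ennreal A" "0 \<le> A" using A1_finite by (cases "A1_const w") auto
  define W where "W p = measure \<mu> (dil_int (fst p) (snd p))" for p
  have We: "emeasure \<mu> (dil_int (fst p) (snd p)) = ennreal (W p)" for p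
    unfolding W_def using emeasure_node_finite(2) by (intro emeasure_eq_ennreal_measure) (auto simp: less_top)
  have W0: "0 \<le> W p" for p by (simp add: W_def)
  \<comment> \<open>By the A1 condition the average of w over the triple is at most the A1 constant
    times w almost everywhere on it, so \<open>m p\<close> is an essential lower bound of w
    there.\<close>
  define m where "m p = W p / (3 * side (fst p) * A)" for p
  have m0: "0 \<le> m p" for p using W0 A by (simp add: m_def)
  have AEw: "AE x in lebesgue. x \<in> dil_int (fst p) (snd p) \<longrightarrow> W p \<le> 3 * side (fst p) * A * w x" for p
    using AE_average_le[OF node_ends(2)[of "fst p" "snd p"]] unfolding node_lens dil_int_def[symmetric] We
  proof eventually_elim
    case (elim x)
    have "ennreal (3 * side (fst p)) * (A1_const w * ennreal (w x)) = ennreal (3 * side (fst p) * A * w x)"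
      using A by (simp add: ennreal_mult mult.assoc)
    with elim show ?case using A by (auto simp: ennreal_le_iff intro!: mult_nonneg_nonneg)
  qed
  have AEm: "AE x in lebesgue. x \<in> dil (fst p) (snd p) \<longrightarrow> m p \<le> w x" for p
    using AEw[of p] dil_AE_eq[of "fst p" "snd p"]
  proof eventually_elim
    case (elim x)
    show ?case
    proof (cases "A = 0")
      case False
      then have "0 < 3 * side (fst p) * A" using A(2) by simp
      with elim show ?thesis by (simp add: m_def divide_le_eq mult.commute)
    qed (simp add: m_def)
  qed
  \<comment> \<open>If A = 0, division by zero gives m p = 0, and the equation survives because the
    A1 condition then forces W p = 0.\<close>
  have Wm: "W p = 3 * side (fst p) * A * m p" for p
  proof (cases "A = 0")
    case True
    have "AE x in lebesgue. x \<in> dil_int (fst p) (snd p) \<longrightarrow> W p \<le> 0"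
      using AEw[of p] True by simp
    then have "W p \<le> 0"
    proof (rule contrapos_pp)
      assume "\<not> W p \<le> 0"
      moreover have "\<not> (AE x in lebesgue. x \<notin> dil_int (fst p) (snd p))"
      proof
        assume "AE x in lebesgue. x \<notin> dil_int (fst p) (snd p)"
        then have "emeasure lebesgue (dil_int (fst p) (snd p)) = 0"
          by (subst (asm) AE_iff_measurable[OF _ refl]) auto
        then show False using node_ends(2)[of "fst p" "snd p"] by (simp add: dil_int_def)
      qed
      ultimately show "\<not> (AE x in lebesgue. x \<in> dil_int (fst p) (snd p) \<longrightarrow> W p \<le> 0)" by simp
    qed
    then show ?thesis using True W0[of p] by simp
  qed (simp add: m_def)
  let ?h = "\<lambda>s y. ennreal ((cmod (f y))\<^sup>2) * indicator {s<..} (w y)"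
  have [measurable]: "f \<in> borel_measurable lebesgue" using measurable_completion[of f lborel borel] f_meas by simp
  have hm [measurable]: "?h s \<in> borel_measurable lebesgue" for s by measurable
  \<comment> \<open>For s < m p the weight exceeds s almost everywhere on the triple of
    \<open>p\<close>, so cutting \<open>f\<close> down to the set where w > s loses none of the mass
    on that triple. The cores being disjoint, the sum is the measure of a union.\<close>
  have level: "ennreal (t\<^sup>2) * (\<Sum>p\<in>?T. emeasure lebesgue (?E p) * indicator {..<m p} s)
    \<le> 5 * (\<integral>\<^sup>+y. ?h s y \<partial>lebesgue)" for s
  proof -
    let ?Ts = "{p\<in>?T. s < m p}"
    define c :: "nat \<times> nat \<Rightarrow> real" where "c p = q + side (fst p) * (real (snd p) + 1 / 2)" for p
    define r :: "nat \<times> nat \<Rightarrow> real" where "r p = 3 / 2 * side (fst p)" for p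
    have ball: "cball (c p) (r p) = dil (fst p) (snd p)" for p by (simp add: dil_eq_cball c_def r_def)
    have finTs: "finite ?Ts" using finT by simp
    have "(\<Sum>p\<in>?T. emeasure lebesgue (?E p) * indicator {..<m p} s) = (\<Sum>p\<in>?Ts. emeasure lebesgue (?E p))"
      using finT by (intro sum.mono_neutral_cong_right) (auto simp: indicator_def)
    also have "\<dots> = emeasure lebesgue (\<Union>p\<in>?Ts. ?E p)"
      using finTs sets_lebesgue_core by (intro sum_emeasure core_disjoint_family) auto
    also have "\<dots> \<le> emeasure lebesgue (\<Union>p\<in>?Ts. cball (c p) (r p))"
    proof (rule emeasure_mono)
      show "(\<Union>p\<in>?Ts. ?E p) \<subseteq> (\<Union>p\<in>?Ts. cball (c p) (r p))"
      proof -
        have "core N n i \<subseteq> dil n i" for n i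
          using node_subset_dil[of n i] by (auto simp: core_def)
        then show ?thesis unfolding ball by (intro UN_mono order.refl)
      qed
      show "(\<Union>p\<in>?Ts. cball (c p) (r p)) \<in> sets lebesgue"
        unfolding ball using finTs by (intro sets.finite_UN) auto
    qed
    finally have "ennreal (t\<^sup>2) * (\<Sum>p\<in>?T. emeasure lebesgue (?E p) * indicator {..<m p} s)
      \<le> ennreal (t\<^sup>2) * emeasure lebesgue (\<Union>p\<in>?Ts. cball (c p) (r p))"
      by (rule mult_left_mono) simp
    also have "\<dots> \<le> 5 * (\<integral>\<^sup>+y. ?h s y \<partial>lebesgue)"
    proof (rule covering_weak_type[OF finTs _ hm])
      fix p assume p: "p \<in> ?Ts"
      show "0 < r p" by (simp add: r_def)
      have "t\<^sup>2 * (2 * r p) = t\<^sup>2 * (3 * side (fst p))" by (simp add: r_def)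
      also have "\<dots> \<le> (\<alpha> (fst p) (snd p))\<^sup>2 * (3 * side (fst p))"
        using p t by (intro mult_right_mono power_mono) auto
      also have "\<dots> = mass (dil (fst p) (snd p))" by (simp add: mass_dil)
      finally have "ennreal (t\<^sup>2 * (2 * r p)) \<le> ennreal (mass (dil (fst p) (snd p)))" by (rule ennreal_leI)
      also have "\<dots> = (\<integral>\<^sup>+y. ennreal (indicator (dil (fst p) (snd p)) y * (cmod (f y))\<^sup>2) \<partial>lborel)"
        unfolding mass_eq
      proof (rule nn_integral_eq_integral[symmetric])
        show "integrable lborel (\<lambda>y. indicator (dil (fst p) (snd p)) y * (cmod (f y))\<^sup>2)"
          by (rule Bochner_Integration.integrable_bound[OF square_integrableD(2)[OF square_integrable_f]]) (auto simp: indicator_def)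
      qed simp
      also have "\<dots> = (\<integral>\<^sup>+y. ennreal (indicator (dil (fst p) (snd p)) y * (cmod (f y))\<^sup>2) \<partial>lebesgue)"
        unfolding nn_integral_completion ..
      also have "\<dots> \<le> (\<integral>\<^sup>+y\<in>cball (c p) (r p). ?h s y \<partial>lebesgue)"
        unfolding ball
      proof (rule nn_integral_mono_AE, use AEm[of p] in eventually_elim)
        case (elim y)
        then show ?case using p by (auto simp: indicator_def)
      qed
      finally show "ennreal (t\<^sup>2 * (2 * r p)) \<le> (\<integral>\<^sup>+y\<in>cball (c p) (r p). ?h s y \<partial>lebesgue)" .
    qed simp
    finally show ?thesis .
  qed
  have interval: "ennreal c = (\<integral>\<^sup>+s\<in>{0..}. indicator {..<c} s \<partial>lborel)" if "0 \<le> c" for c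
  proof -
    have "(\<integral>\<^sup>+s\<in>{0..}. indicator {..<c} s \<partial>lborel) = (\<integral>\<^sup>+s. indicator {0..<c} s \<partial>lborel)"
      by (intro nn_integral_cong) (auto simp: indicator_def)
    also have "\<dots> = ennreal c" using that by simp
    finally show ?thesis ..
  qed
  \<comment> \<open>The weight of the node is at most W p, which is 3 A \<open>m p\<close> times the
    length and so at most 6 A \<open>m p\<close> times the measure of the core. The 5 of the
    covering lemma makes this 30. Integrating \<open>level\<close> over s > 0 recovers
    \<open>m p\<close> on the left and w on the right.\<close>
  have "ennreal (t\<^sup>2) * (\<Sum>p\<in>?T. emeasure \<mu> (node (fst p) (snd p)))
    \<le> ennreal (t\<^sup>2) * (\<Sum>p\<in>?T. 6 * A1_const w * (emeasure lebesgue (?E p) * ennreal (m p)))"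
  proof (intro mult_left_mono sum_mono)
    fix p assume p: "p \<in> ?T"
    have "emeasure \<mu> (node (fst p) (snd p)) \<le> emeasure \<mu> (dil_int (fst p) (snd p))"
      by (rule emeasure_mono[OF node_subset_dil_int]) simp
    also have "\<dots> = 3 * ennreal (side (fst p)) * (A1_const w * ennreal (m p))"
      unfolding We Wm using A m0[of p] by (simp add: ennreal_mult mult.assoc)
    also have "\<dots> \<le> 3 * (2 * emeasure lebesgue (?E p)) * (A1_const w * ennreal (m p))"
      using p emeasure_core[of p N] by (intro mult_right_mono mult_left_mono) auto
    finally show "emeasure \<mu> (node (fst p) (snd p)) \<le> 6 * A1_const w * (emeasure lebesgue (?E p) * ennreal (m p))"
      by (simp add: mult_ac)
  qed simp
  also have "\<dots> = 6 * A1_const w * (\<integral>\<^sup>+s\<in>{0..}. ennreal (t\<^sup>2) * (\<Sum>p\<in>?T. emeasure lebesgue (?E p) * indicator {..<m p} s) \<partial>lborel)"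
  proof -
    have "(\<integral>\<^sup>+s\<in>{0..}. ennreal (t\<^sup>2) * (\<Sum>p\<in>?T. emeasure lebesgue (?E p) * indicator {..<m p} s) \<partial>lborel)
      = (\<integral>\<^sup>+s. ennreal (t\<^sup>2) * (\<Sum>p\<in>?T. emeasure lebesgue (?E p) * (indicator {..<m p} s * indicator {0..} s)) \<partial>lborel)"
      by (intro nn_integral_cong) (simp only: sum_distrib_right sum_distrib_left mult.assoc)
    also have "\<dots> = ennreal (t\<^sup>2) * (\<Sum>p\<in>?T. emeasure lebesgue (?E p) * ennreal (m p))"
      unfolding interval[OF m0] by (simp add: nn_integral_cmult nn_integral_sum)
    finally show ?thesis by (simp add: sum_distrib_left mult_ac)
  qed
  also have "\<dots> \<le> 6 * A1_const w * (\<integral>\<^sup>+s\<in>{0..}. 5 * (\<integral>\<^sup>+y. ?h s y \<partial>lebesgue) \<partial>lborel)"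
    by (intro mult_left_mono nn_integral_mono mult_right_mono level) auto
  also have "(\<integral>\<^sup>+s\<in>{0..}. 5 * (\<integral>\<^sup>+y. ?h s y \<partial>lebesgue) \<partial>lborel)
    = 5 * weighted_energy f"
  proof -
    interpret S: sigma_finite_measure "lebesgue :: real measure" by (rule sigma_finite_lebesgue)
    interpret P: pair_sigma_finite "lborel :: real measure" "lebesgue :: real measure"
      by (rule pair_sigma_finite.intro) (auto intro: sigma_finite_lborel sigma_finite_lebesgue)
    have joint: "(\<lambda>(s, y). ?h s y * indicator {0..} s) \<in> borel_measurable (lborel \<Otimes>\<^sub>M lebesgue)"
    proof -
      have "(\<lambda>(s, y). ?h s y * indicator {0..} s) = (\<lambda>z. ennreal ((cmod (f (snd z)))\<^sup>2) * (if fst z < w (snd z) then 1 else 0) * indicator {0..} (fst z))"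
        by (auto simp: fun_eq_iff indicator_def)
      also have "\<dots> \<in> borel_measurable (lborel \<Otimes>\<^sub>M lebesgue)" by measurable
      finally show ?thesis .
    qed
    have "(\<integral>\<^sup>+s\<in>{0..}. 5 * (\<integral>\<^sup>+y. ?h s y \<partial>lebesgue) \<partial>lborel) = (\<integral>\<^sup>+s. 5 * (\<integral>\<^sup>+y. ?h s y * indicator {0..} s \<partial>lebesgue) \<partial>lborel)"
      unfolding nn_integral_multc[OF hm] by (simp only: mult.assoc)
    also have "\<dots> = 5 * (\<integral>\<^sup>+s. \<integral>\<^sup>+y. ?h s y * indicator {0..} s \<partial>lebesgue \<partial>lborel)"
      using S.borel_measurable_nn_integral_fst[OF joint] by (intro nn_integral_cmult) simp
    also have "(\<integral>\<^sup>+s. \<integral>\<^sup>+y. ?h s y * indicator {0..} s \<partial>lebesgue \<partial>lborel) = (\<integral>\<^sup>+y. \<integral>\<^sup>+s. ?h s y * indicator {0..} s \<partial>lborel \<partial>lebesgue)"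
      by (rule P.Fubini'[OF joint, symmetric])
    also have "\<dots> = weighted_energy f"
    proof (intro nn_integral_cong)
      fix y
      have "(\<integral>\<^sup>+s. ?h s y * indicator {0..} s \<partial>lborel) = (\<integral>\<^sup>+s. ennreal ((cmod (f y))\<^sup>2) * (indicator {..<w y} s * indicator {0..} s) \<partial>lborel)"
        by (intro nn_integral_cong) (auto simp: indicator_def)
      also have "\<dots> = ennreal ((cmod (f y))\<^sup>2) * ennreal (w y)"
        unfolding interval[OF w_nonneg] by (intro nn_integral_cmult) measurable
      finally show "(\<integral>\<^sup>+s. ?h s y * indicator {0..} s \<partial>lborel) = ennreal ((cmod (f y))\<^sup>2) * ennreal (w y)" .
    qed
    finally show ?thesis .
  qed
  finally show ?thesis by (simp add: mult_ac)
qed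

end

subsection \<open>Weak-type bounds for Carleson families\<close>

text \<open>Every pair has an upper element, in one of two positions.\<close>

lemma card_pairs_le:
  assumes X: "finite X" and total: "\<And>x y. x \<in> X \<Longrightarrow> y \<in> X \<Longrightarrow> R x y \<or> R y x"
  shows "(card X)\<^sup>2 \<le> 2 * (\<Sum>x\<in>X. card {y\<in>X. R y x})"
proof -
  let ?S = "SIGMA x:X. {y\<in>X. R y x}"
  have "X \<times> X \<subseteq> ?S \<union> prod.swap ` ?S"
  proof
    fix z assume "z \<in> X \<times> X"
    then obtain x y where z: "z = (x, y)" "x \<in> X" "y \<in> X" by auto
    from total[OF z(2,3)] show "z \<in> ?S \<union> prod.swap ` ?S"
    proof
      assume "R x y"
      then have "(y, x) \<in> ?S" using z by auto
      then show ?thesis using z by force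
    qed (use z in auto)
  qed
  then have "card (X \<times> X) \<le> card (?S \<union> prod.swap ` ?S)"
    using X by (intro card_mono) auto
  also have "\<dots> \<le> card ?S + card (prod.swap ` ?S)" by (rule card_Un_le)
  also have "\<dots> \<le> card ?S + card ?S" using X by (intro add_left_mono card_image_le) auto
  also have "card ?S = (\<Sum>x\<in>X. card {y\<in>X. R y x})" using X by (intro card_SigmaI) auto
  finally show ?thesis by (simp add: card_cartesian_product power2_eq_square)
qed

text \<open>By totality and transitivity every triple has an upper element, in one of three
  positions; the other two entries range over what lies below it.\<close>

lemma card_triples_le:
  assumes X: "finite X" and total: "\<And>x y. x \<in> X \<Longrightarrow> y \<in> X \<Longrightarrow> R x y \<or> R y x"
    and trans: "\<And>x y z. R x y \<Longrightarrow> R y z \<Longrightarrow> R x z"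
  shows "(card X) ^ 3 \<le> 3 * (\<Sum>x\<in>X. (card {y\<in>X. R y x})\<^sup>2)"
proof -
  let ?S = "SIGMA x:X. {y\<in>X. R y x} \<times> {y\<in>X. R y x}"
  let ?f = "\<lambda>(x, y, z). (y, x, z)" and ?g = "\<lambda>(x, y, z). (y, z, x)"
  have refl: "R x x" if "x \<in> X" for x using total[OF that that] by blast
  have "X \<times> X \<times> X \<subseteq> ?S \<union> (?f ` ?S \<union> ?g ` ?S)"
  proof
    fix t assume "t \<in> X \<times> X \<times> X"
    then obtain x y z where t: "t = (x, y, z)" "x \<in> X" "y \<in> X" "z \<in> X" by auto
    consider "R y x \<and> R z x" | "R x y \<and> R z y" | "R x z \<and> R y z"
      using total t trans by metis
    then show "t \<in> ?S \<union> (?f ` ?S \<union> ?g ` ?S)"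
    proof cases
      case 2
      then have "(y, x, z) \<in> ?S" using t by auto
      then have "?f (y, x, z) \<in> ?f ` ?S" by (rule imageI)
      then show ?thesis using t by simp
    next
      case 3
      then have "(z, x, y) \<in> ?S" using t by auto
      then have "?g (z, x, y) \<in> ?g ` ?S" by (rule imageI)
      then show ?thesis using t by simp
    qed (use t in auto)
  qed
  then have "card (X \<times> X \<times> X) \<le> card (?S \<union> (?f ` ?S \<union> ?g ` ?S))"
    using X by (intro card_mono) auto
  also have "\<dots> \<le> card ?S + (card (?f ` ?S) + card (?g ` ?S))"
    by (rule order.trans[OF card_Un_le]) (intro add_left_mono card_Un_le)
  also have "\<dots> \<le> card ?S + (card ?S + card ?S)"
    using X by (intro add_left_mono add_mono card_image_le) auto
  also have "card ?S = (\<Sum>x\<in>X. (card {y\<in>X. R y x})\<^sup>2)"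
    using X by (subst card_SigmaI) (auto simp: card_cartesian_product power2_eq_square)
  finally show ?thesis by (simp add: card_cartesian_product power3_eq_cube mult.assoc)
qed

section \<open>Moments of the counting function of a Carleson family\<close>

locale laminar_family =
  fixes M :: "'x measure" and S :: "'i set" and D :: "'i \<Rightarrow> 'x set" and \<Lambda> :: real
  assumes finite_S: "finite S"
    and D_meas: "\<And>p. p \<in> S \<Longrightarrow> D p \<in> fmeasurable M"
    and laminar: "\<And>p p'. p \<in> S \<Longrightarrow> p' \<in> S \<Longrightarrow> D p \<inter> D p' \<noteq> {} \<Longrightarrow> D p \<subseteq> D p' \<or> D p' \<subseteq> D p"
    and carleson: "\<And>p. p \<in> S \<Longrightarrow> (\<Sum>p'\<in>{p'\<in>S. D p' \<subseteq> D p}. measure M (D p')) \<le> \<Lambda> * measure M (D p)"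
    and \<Lambda>_ge: "1 \<le> \<Lambda>"
begin

definition below :: "'i set \<Rightarrow> 'i \<Rightarrow> 'i set" where "below T p = {p'\<in>T. D p' \<subseteq> D p}"

definition count :: "'i set \<Rightarrow> 'x \<Rightarrow> real" where "count T x = (\<Sum>p\<in>T. indicator (D p) x)"

lemma count_eq_card: "finite T \<Longrightarrow> count T x = real (card {p\<in>T. x \<in> D p})"
  unfolding count_def by (subst sum.mono_neutral_right[where S="{p\<in>T. x \<in> D p}"]) (auto simp: indicator_def)

lemma count_nonneg: "0 \<le> count T x"
  unfolding count_def by (intro sum_nonneg) simp

lemma integrable_D: "p \<in> S \<Longrightarrow> integrable M (indicator (D p) :: 'x \<Rightarrow> real)"
  using D_meas by (auto simp: integrable_indicator_iff fmeasurable_def)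

lemma measurable_D [measurable]: "p \<in> S \<Longrightarrow> D p \<in> sets M"
  using D_meas by auto

lemma borel_measurable_count: "T \<subseteq> S \<Longrightarrow> count T \<in> borel_measurable M"
  unfolding count_def[abs_def] by (intro borel_measurable_sum) (auto simp: measurable_D)

lemma count_bound: "T \<subseteq> S \<Longrightarrow> count T x \<le> real (card S) * indicator (\<Union>p\<in>S. D p) x"
proof -
  assume T: "T \<subseteq> S"
  have fT: "finite T" using T finite_S by (rule finite_subset)
  show ?thesis
  proof (cases "x \<in> (\<Union>p\<in>S. D p)")
    case True
    have "card {p\<in>T. x \<in> D p} \<le> card S" using T finite_S by (intro card_mono) auto
    then show ?thesis using True by (simp add: count_eq_card[OF fT])
  next
    case False
    then have "{p\<in>T. x \<in> D p} = {}" using T by auto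
    then have "count T x = 0" unfolding count_eq_card[OF fT] by (simp only: card.empty of_nat_0)
    then show ?thesis by simp
  qed
qed

lemma integrable_count_power:
  assumes T: "T \<subseteq> S" "0 < n"
  shows "integrable M (\<lambda>x. count T x ^ n)"
proof (rule Bochner_Integration.integrable_bound)
  have "(\<Union>p\<in>S. D p) \<in> fmeasurable M" using finite_S D_meas by (intro fmeasurable.finite_UN) auto
  then have "integrable M (indicator (\<Union>p\<in>S. D p) :: 'x \<Rightarrow> real)"
    by (auto simp: integrable_indicator_iff fmeasurable_def)
  then show "integrable M (\<lambda>x. real (card S) ^ n * indicator (\<Union>p\<in>S. D p) x)" by simp
  show "(\<lambda>x. count T x ^ n) \<in> borel_measurable M"
    using borel_measurable_count[OF T(1)] by measurable
  show "AE x in M. norm (count T x ^ n) \<le> norm (real (card S) ^ n * indicator (\<Union>p\<in>S. D p) x :: real)"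
  proof (rule AE_I2)
    fix x
    have "count T x ^ n \<le> (real (card S) * indicator (\<Union>p\<in>S. D p) x) ^ n"
      by (intro power_mono count_bound T count_nonneg)
    also have "\<dots> = real (card S) ^ n * indicator (\<Union>p\<in>S. D p) x"
      using T(2) by (auto simp: indicator_def power_mult_distrib)
    finally show "norm (count T x ^ n) \<le> norm (real (card S) ^ n * indicator (\<Union>p\<in>S. D p) x :: real)"
      using count_nonneg[of T x] by simp
  qed
qed

lemma integral_count:
  assumes T: "T \<subseteq> S"
  shows "(LINT x|M. count T x) = (\<Sum>p\<in>T. measure M (D p))"
proof -
  have "(LINT x|M. count T x) = (\<Sum>p\<in>T. LINT x|M. indicator (D p) x)"
    unfolding count_def using T by (intro Bochner_Integration.integral_sum integrable_D) auto
  also have "\<dots> = (\<Sum>p\<in>T. measure M (D p))"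
  proof (intro sum.cong refl)
    fix p assume "p \<in> T"
    then have "D p \<subseteq> space M" using T measurable_D sets.sets_into_space by blast
    then show "(LINT x|M. indicator (D p) x) = measure M (D p)" by (simp add: Int_absorb2)
  qed
  finally show ?thesis .
qed

lemma carleson_below:
  assumes "T \<subseteq> S" "p \<in> S"
  shows "(\<Sum>p'\<in>below T p. measure M (D p')) \<le> \<Lambda> * measure M (D p)"
proof -
  have "(\<Sum>p'\<in>below T p. measure M (D p')) \<le> (\<Sum>p'\<in>{p'\<in>S. D p' \<subseteq> D p}. measure M (D p'))"
    using assms finite_S by (intro sum_mono2) (auto simp: below_def)
  also have "\<dots> \<le> \<Lambda> * measure M (D p)" by (rule carleson[OF assms(2)])
  finally show ?thesis .
qed

lemma chain_total:
  "p \<in> S \<Longrightarrow> p' \<in> S \<Longrightarrow> x \<in> D p \<Longrightarrow> x \<in> D p' \<Longrightarrow> D p \<subseteq> D p' \<or> D p' \<subseteq> D p"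
  using laminar by blast

text \<open>The members containing \<open>x\<close> form a chain by laminarity, so
  \<open>card_pairs_le\<close> applies; of the members below p, those containing \<open>x\<close>
  are counted by \<open>count (below T p) x\<close>.\<close>

lemma count_below_square:
  assumes T: "T \<subseteq> S"
  shows "(count T x)\<^sup>2 \<le> 2 * (\<Sum>p\<in>T. count (below T p) x)"
proof -
  have fT: "finite T" using T finite_S by (rule finite_subset)
  let ?X = "{p\<in>T. x \<in> D p}"
  have "(card ?X)\<^sup>2 \<le> 2 * (\<Sum>p\<in>?X. card {p'\<in>?X. D p' \<subseteq> D p})"
    using T fT by (intro card_pairs_le chain_total) auto
  then have "real ((card ?X)\<^sup>2) \<le> real (2 * (\<Sum>p\<in>?X. card {p'\<in>?X. D p' \<subseteq> D p}))"
    by (simp only: of_nat_le_iff)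
  also have "\<dots> = 2 * (\<Sum>p\<in>?X. real (card {p'\<in>?X. D p' \<subseteq> D p}))" by simp
  also have "(\<Sum>p\<in>?X. real (card {p'\<in>?X. D p' \<subseteq> D p})) = (\<Sum>p\<in>?X. count (below T p) x)"
    using fT by (intro sum.cong refl) (simp add: count_eq_card below_def conj_ac cong: conj_cong)
  also have "\<dots> \<le> (\<Sum>p\<in>T. count (below T p) x)"
    using fT count_nonneg by (intro sum_mono2) auto
  finally show ?thesis using fT by (simp add: count_eq_card)
qed

lemma count_below_cube:
  assumes T: "T \<subseteq> S"
  shows "(count T x) ^ 3 \<le> 3 * (\<Sum>p\<in>T. (count (below T p) x)\<^sup>2)"
proof -
  have fT: "finite T" using T finite_S by (rule finite_subset)
  let ?X = "{p\<in>T. x \<in> D p}"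
  have "(card ?X) ^ 3 \<le> 3 * (\<Sum>p\<in>?X. (card {p'\<in>?X. D p' \<subseteq> D p})\<^sup>2)"
    using T fT by (intro card_triples_le chain_total) auto
  then have "real ((card ?X) ^ 3) \<le> real (3 * (\<Sum>p\<in>?X. (card {p'\<in>?X. D p' \<subseteq> D p})\<^sup>2))"
    by (simp only: of_nat_le_iff)
  also have "\<dots> = 3 * (\<Sum>p\<in>?X. (real (card {p'\<in>?X. D p' \<subseteq> D p}))\<^sup>2)" by simp
  also have "(\<Sum>p\<in>?X. (real (card {p'\<in>?X. D p' \<subseteq> D p}))\<^sup>2) = (\<Sum>p\<in>?X. (count (below T p) x)\<^sup>2)"
    using fT by (intro sum.cong refl) (simp add: count_eq_card below_def conj_ac cong: conj_cong)
  also have "\<dots> \<le> (\<Sum>p\<in>T. (count (below T p) x)\<^sup>2)"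
    using fT by (intro sum_mono2) auto
  finally show ?thesis using fT by (simp add: count_eq_card)
qed

lemma integral_count_square:
  assumes T: "T \<subseteq> S"
  shows "(LINT x|M. (count T x)\<^sup>2) \<le> 2 * \<Lambda> * (\<Sum>p\<in>T. measure M (D p))"
proof -
  have sub: "below T p \<subseteq> S" for p using T by (auto simp: below_def)
  have i: "integrable M (\<lambda>x. count (below T p) x)" for p
    using integrable_count_power[OF sub, of 1] by simp
  have "(LINT x|M. (count T x)\<^sup>2) \<le> (LINT x|M. 2 * (\<Sum>p\<in>T. count (below T p) x))"
    using T by (intro integral_mono integrable_count_power count_below_square integrable_mult_right Bochner_Integration.integrable_sum i) auto
  also have "\<dots> = 2 * (\<Sum>p\<in>T. \<Sum>p'\<in>below T p. measure M (D p'))"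
    by (simp add: Bochner_Integration.integral_sum i integral_count[OF sub])
  also have "\<dots> \<le> 2 * (\<Sum>p\<in>T. \<Lambda> * measure M (D p))"
    using T by (intro mult_left_mono sum_mono carleson_below) auto
  finally show ?thesis by (simp add: sum_distrib_left mult.assoc)
qed

text \<open>The second moment bound is applied to each family \<open>below T p\<close>, and the
  Carleson condition once more; this yields the two factors \<Lambda> and the constant 3 *
  2.\<close>

lemma integral_count_cube:
  assumes T: "T \<subseteq> S"
  shows "(LINT x|M. (count T x) ^ 3) \<le> 6 * \<Lambda>\<^sup>2 * (\<Sum>p\<in>T. measure M (D p))"
proof -
  have sub: "below T p \<subseteq> S" for p using T by (auto simp: below_def)
  have i: "integrable M (\<lambda>x. (count (below T p) x)\<^sup>2)" for p
    by (rule integrable_count_power[OF sub]) simp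
  have "(LINT x|M. (count T x) ^ 3) \<le> (LINT x|M. 3 * (\<Sum>p\<in>T. (count (below T p) x)\<^sup>2))"
    using T by (intro integral_mono integrable_count_power count_below_cube integrable_mult_right Bochner_Integration.integrable_sum i) auto
  also have "\<dots> = 3 * (\<Sum>p\<in>T. LINT x|M. (count (below T p) x)\<^sup>2)"
    by (simp add: Bochner_Integration.integral_sum i)
  also have "\<dots> \<le> 3 * (\<Sum>p\<in>T. 2 * \<Lambda> * (\<Lambda> * measure M (D p)))"
  proof (intro mult_left_mono sum_mono)
    fix p assume "p \<in> T"
    then have "2 * \<Lambda> * (\<Sum>p'\<in>below T p. measure M (D p')) \<le> 2 * \<Lambda> * (\<Lambda> * measure M (D p))"
      using T \<Lambda>_ge by (intro mult_left_mono carleson_below) auto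
    with integral_count_square[OF sub, of p] show "(LINT x|M. (count (below T p) x)\<^sup>2) \<le> 2 * \<Lambda> * (\<Lambda> * measure M (D p))"
      by linarith
  qed simp
  finally show ?thesis by (simp add: sum_distrib_left power2_eq_square mult_ac)
qed

lemma chebyshev_count:
  assumes T: "T \<subseteq> S" and c: "0 < c"
  shows "c ^ 3 * measure M {x\<in>space M. c < count T x} \<le> 6 * \<Lambda>\<^sup>2 * (\<Sum>p\<in>T. measure M (D p))"
    and "{x\<in>space M. c < count T x} \<in> fmeasurable M"
proof -
  let ?A = "{x\<in>space M. c < count T x}"
  have A [measurable]: "?A \<in> sets M" using borel_measurable_count[OF T] by measurable
  have "?A \<subseteq> (\<Union>p\<in>S. D p)"
  proof
    fix x assume "x \<in> ?A"
    then have pos: "0 < real (card S) * indicator (\<Union>p\<in>S. D p) x"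
      using count_bound[OF T, of x] c by auto
    show "x \<in> (\<Union>p\<in>S. D p)"
    proof (rule ccontr)
      assume "x \<notin> (\<Union>p\<in>S. D p)"
      then have "indicator (\<Union>p\<in>S. D p) x = (0::real)" by (rule indicator_simps(2))
      with pos show False by (simp only: mult_zero_right less_irrefl)
    qed
  qed
  then show fA: "?A \<in> fmeasurable M"
    using finite_S D_meas by (intro fmeasurableI2[OF fmeasurable.finite_UN[of S D M] _ A]) auto
  have "c ^ 3 * measure M ?A = (LINT x|M. c ^ 3 * indicator ?A x)"
    using sets.sets_into_space[OF A] by (simp add: Int_absorb2)
  also have "\<dots> \<le> (LINT x|M. (count T x) ^ 3)"
  proof (rule integral_mono)
    show "integrable M (\<lambda>x. c ^ 3 * indicator ?A x)"
      using fA by (intro integrable_mult_right) (auto simp: integrable_indicator_iff fmeasurable_def)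
    show "integrable M (\<lambda>x. (count T x) ^ 3)" by (rule integrable_count_power[OF T]) simp
    show "c ^ 3 * indicator ?A x \<le> (count T x) ^ 3" for x
      using c count_nonneg[of T x] by (auto simp: indicator_def intro!: power_mono)
  qed
  also have "\<dots> \<le> 6 * \<Lambda>\<^sup>2 * (\<Sum>p\<in>T. measure M (D p))" by (rule integral_count_cube[OF T])
  finally show "c ^ 3 * measure M ?A \<le> 6 * \<Lambda>\<^sup>2 * (\<Sum>p\<in>T. measure M (D p))" .
qed

lemma dyadic_level:
  fixes \<beta> :: real
  assumes "1 / 2 ^ n < \<beta>" "\<beta> \<le> 1"
  shows "\<exists>j<Suc n. 1 / 2 ^ Suc j < \<beta> \<and> \<beta> \<le> 1 / 2 ^ j"
proof -
  let ?P = "\<lambda>j. 1 / 2 ^ Suc j < \<beta>"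
  have "(1::real) / 2 ^ Suc n \<le> 1 / 2 ^ n" by (simp add: field_simps)
  then have Pn: "?P n" using assms(1) by linarith
  define j where "j = (LEAST j. ?P j)"
  have "?P j" unfolding j_def by (rule LeastI[of ?P, OF Pn])
  moreover have "j \<le> n" unfolding j_def by (rule Least_le[of ?P, OF Pn])
  moreover have "\<beta> \<le> 1 / 2 ^ j"
  proof (cases j)
    case (Suc j')
    then have "\<not> ?P j'" unfolding j_def using not_less_Least[of j' ?P] by simp
    then show ?thesis using Suc by simp
  qed (use assms in simp)
  ultimately show ?thesis by (meson less_Suc_eq_le)
qed

text \<open>Above the height \<open>1 / \<Lambda>\<close> the coefficients contribute a convergent geometric series of first
  moments, below it a convergent geometric series of third moments; no logarithm is lost.\<close>
lemma sparse_weak_type: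
  fixes \<alpha> :: "'i \<Rightarrow> real"
  assumes \<alpha>: "\<And>p. p \<in> S \<Longrightarrow> 0 \<le> \<alpha> p"
    and large: "\<And>t. 0 < t \<Longrightarrow> t\<^sup>2 * (\<Sum>p\<in>{p\<in>S. t \<le> \<alpha> p}. measure M (D p)) \<le> G"
  shows "measure M {x\<in>space M. 1 < (\<Sum>p\<in>S. \<alpha> p * indicator (D p) x)} \<le> 1000000 * \<Lambda> * G"
proof -
  have G: "0 \<le> G"
    using large[of 1] by (rule order.trans[rotated]) (auto intro!: sum_nonneg)
  obtain J :: nat where J: "\<Lambda> \<le> 2 ^ J" "2 ^ J \<le> 2 * \<Lambda>"
  \<comment> \<open>J is chosen with 2^J comparable to \<Lambda>: it separates the levels treated by
    first moments from those treated by third moments.\<close>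
  proof -
    have ex: "\<exists>J. \<Lambda> \<le> 2 ^ J" using real_arch_pow[of 2 \<Lambda>] by (auto intro: less_imp_le)
    define J where "J = (LEAST J. \<Lambda> \<le> 2 ^ J)"
    have 1: "\<Lambda> \<le> 2 ^ J" unfolding J_def using ex by (rule LeastI_ex)
    moreover have "2 ^ J \<le> 2 * \<Lambda>"
    proof (cases J)
      case (Suc J')
      then have "\<not> \<Lambda> \<le> 2 ^ J'" unfolding J_def using not_less_Least[of J' "\<lambda>J. \<Lambda> \<le> 2 ^ J"] by simp
      then show ?thesis using Suc by simp
    qed (use \<Lambda>_ge in simp)
    ultimately show ?thesis by (rule that)
  qed
  \<comment> \<open>The family is finite, so only finitely many dyadic levels of coefficients occur;
    the final bound does not involve n.\<close>
  obtain n :: nat where n: "\<And>p. p \<in> S \<Longrightarrow> 0 < \<alpha> p \<Longrightarrow> 1 / 2 ^ n < \<alpha> p"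
  proof -
    have "\<forall>\<^sub>F n in sequentially. \<forall>p\<in>{p\<in>S. 0 < \<alpha> p}. (1 / 2) ^ n < \<alpha> p"
      using finite_S
      by (intro eventually_ball_finite ballI order_tendstoD(2)[OF LIMSEQ_power_zero]) auto
    then obtain n where "\<forall>p\<in>{p\<in>S. 0 < \<alpha> p}. (1 / 2) ^ n < \<alpha> p" by (auto simp: eventually_sequentially)
    then show ?thesis by (intro that[of n]) (auto simp: power_divide)
  qed
  define lev where "lev j = {p\<in>S. 1 / 2 ^ Suc j < \<alpha> p \<and> \<alpha> p \<le> 1 / 2 ^ j}" for j :: nat
  have lev: "lev j \<subseteq> S" for j by (auto simp: lev_def)
  have lev_sum: "(\<Sum>p\<in>lev j. measure M (D p)) \<le> 4 * 4 ^ j * G" for j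
  proof -
    let ?t = "1 / 2 ^ Suc j :: real"
    have "?t\<^sup>2 * (\<Sum>p\<in>lev j. measure M (D p)) \<le> ?t\<^sup>2 * (\<Sum>p\<in>{p\<in>S. ?t \<le> \<alpha> p}. measure M (D p))"
      using finite_S by (intro mult_left_mono sum_mono2) (auto simp: lev_def)
    also have "\<dots> \<le> G" by (rule large) simp
    also have "?t\<^sup>2 = 1 / (4 * 4 ^ j)"
      by (simp add: power_divide power_mult_distrib power2_eq_square flip: power_mult_distrib)
    finally show ?thesis by (simp add: field_simps)
  qed
  \<comment> \<open>Weights of total at most 1 that share out the height 1/2 among the deep levels.
    They must decay slowly: third moments gain 1/2 per level and lose (10/9)^3, and the ratio
    500/729 is still below 1.\<close>
  define \<rho> :: "nat \<Rightarrow> real" where "\<rho> i = 1 / 10 * (9 / 10) ^ i" for i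
  have \<rho>_pos: "0 < \<rho> i" for i by (simp add: \<rho>_def)
  have \<rho>_sum: "(\<Sum>i<N. \<rho> i) \<le> 1" for N
  proof -
    have "(\<Sum>i<N. \<rho> i) = 1 - (9 / 10) ^ N" unfolding \<rho>_def by (induction N) auto
    then show ?thesis by simp
  qed
  let ?n = "Suc n"
  define A0 where "A0 = (\<Union>p\<in>{p\<in>S. 1 \<le> \<alpha> p}. D p)"
  define F1 where "F1 x = (\<Sum>j<J. count (lev j) x / 2 ^ j)" for x
  define A1 where "A1 = {x\<in>space M. 1 / 2 < F1 x}"
  define c where "c i = \<rho> i * 2 ^ (J + i) / 2" for i
  have c_pos: "0 < c i" for i using \<rho>_pos by (simp add: c_def)
  define A2 where "A2 i = {x\<in>space M. c i < count (lev (J + i)) x}" for i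
  have fA0: "A0 \<in> fmeasurable M"
    unfolding A0_def using finite_S D_meas by (intro fmeasurable.finite_UN) auto
  have mA0: "measure M A0 \<le> G"
  proof -
    have "measure M A0 \<le> (\<Sum>p\<in>{p\<in>S. 1 \<le> \<alpha> p}. measure M (D p))"
      unfolding A0_def using finite_S measurable_D by (intro measure_UNION_le) auto
    also have "\<dots> \<le> G" using large[of 1] by simp
    finally show ?thesis .
  qed
  have iF1: "integrable M F1"
    unfolding F1_def using integrable_count_power[OF lev, of 1] by (intro Bochner_Integration.integrable_sum) simp
  have [measurable]: "F1 \<in> borel_measurable M" using iF1 by auto
  have F1_nonneg: "0 \<le> F1 x" for x unfolding F1_def by (intro sum_nonneg) (simp add: count_nonneg)
  \<comment> \<open>First moments: level j contributes 4 * 4^j G / 2^j, and the sum over j < J is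
    below 4 * 2^J G, at most 8 \<Lambda> G; the threshold 1/2 doubles this.\<close>
  have fA1: "A1 \<in> fmeasurable M" and mA1: "measure M A1 \<le> 16 * \<Lambda> * G"
  proof -
    have sA1 [measurable]: "A1 \<in> sets M" unfolding A1_def by measurable
    have le: "indicator A1 x \<le> 2 * F1 x" for x using F1_nonneg[of x] by (auto simp: A1_def indicator_def)
    have "integrable M (indicator A1 :: 'x \<Rightarrow> real)"
      by (rule Bochner_Integration.integrable_bound[OF integrable_mult_right[OF iF1, of 2]])
        (use le F1_nonneg in \<open>auto simp: abs_mult\<close>)
    then show "A1 \<in> fmeasurable M" by (auto simp: integrable_indicator_iff fmeasurable_def)
    then have "measure M A1 = (LINT x|M. indicator A1 x)"
      using sets.sets_into_space[OF sA1] by (simp add: Int_absorb2)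
    also have "\<dots> \<le> (LINT x|M. 2 * F1 x)"
      using iF1 \<open>integrable M (indicator A1 :: 'x \<Rightarrow> real)\<close> by (intro integral_mono le) auto
    also have "\<dots> = 2 * (\<Sum>j<J. (\<Sum>p\<in>lev j. measure M (D p)) / 2 ^ j)"
      unfolding F1_def using integrable_count_power[OF lev, of 1]
      by (simp add: Bochner_Integration.integral_sum integral_count[OF lev])
    also have "\<dots> \<le> 2 * (\<Sum>j<J. (4 * 4 ^ j * G) / 2 ^ j)"
      by (intro mult_left_mono sum_mono divide_right_mono lev_sum) auto
    also have "\<dots> = 2 * (\<Sum>j<J. 4 * G * 2 ^ j)"
    proof -
      have "(4::real) ^ j / 2 ^ j = 2 ^ j" for j by (simp flip: power_divide)
      then have "(4 * 4 ^ j * G) / 2 ^ j = 4 * G * 2 ^ j" for j by (simp add: mult.commute mult.left_commute flip: times_divide_eq_right)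
      then show ?thesis by simp
    qed
    also have "\<dots> = 8 * G * (2 ^ J - 1)"
    proof -
      have "(\<Sum>j<N. (2::real) ^ j) = 2 ^ N - 1" for N by (induction N) auto
      then show ?thesis by (simp add: sum_distrib_left[symmetric])
    qed
    also have "\<dots> \<le> 8 * G * (2 * \<Lambda>)" using J G by (intro mult_left_mono) auto
    finally show "measure M A1 \<le> 16 * \<Lambda> * G" by (simp add: mult_ac)
  qed
  have fA2: "A2 i \<in> fmeasurable M" for i
    unfolding A2_def by (rule chebyshev_count(2)[OF lev c_pos])
  \<comment> \<open>Of the two factors \<Lambda> in the third moment one is bounded by 2^J, which
    the cube of the threshold \<open>c i\<close> absorbs. The constant is 24 * 8000, where 8000 =
    20^3 comes from the factor 1/20 in \<open>c i\<close>.\<close>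
  have mA2: "measure M (A2 i) \<le> 192000 * \<Lambda> * G * (500 / 729) ^ i" for i
  proof -
    have "(c i) ^ 3 * measure M (A2 i) \<le> 6 * \<Lambda>\<^sup>2 * (\<Sum>p\<in>lev (J + i). measure M (D p))"
      unfolding A2_def by (rule chebyshev_count(1)[OF lev c_pos])
    also have "\<dots> \<le> 6 * \<Lambda>\<^sup>2 * (4 * 4 ^ (J + i) * G)"
      by (intro mult_left_mono lev_sum) auto
    also have "\<dots> = 24 * G * \<Lambda> * 4 ^ (J + i) * \<Lambda>" by (simp add: power2_eq_square)
    also have "\<dots> \<le> 24 * G * \<Lambda> * 4 ^ (J + i) * 2 ^ J"
      using J G \<Lambda>_ge by (intro mult_left_mono) auto
    also have "\<dots> = (c i) ^ 3 * (192000 * \<Lambda> * G * (500 / 729) ^ i)"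
    proof -
      have e1: "((2::real) ^ J) ^ 3 = 4 ^ J * 2 ^ J" and e2: "((2::real) ^ i) ^ 3 = 8 ^ i"
        by (simp_all flip: power_mult_distrib add: power3_eq_cube)
      have e3: "((9 / 10 :: real) ^ i) ^ 3 = (729 / 1000) ^ i" by (simp add: power3_eq_cube flip: power_mult_distrib)
      have "(c i) ^ 3 = (729 / 1000) ^ i * (4 ^ J * 2 ^ J) * 8 ^ i / 8000"
      proof -
        have "(1 / 10 * X * (Y * Z) / 2) ^ 3 = X ^ 3 * Y ^ 3 * Z ^ 3 / 8000" for X Y Z :: real
          by (simp add: power3_eq_cube)
        then show ?thesis unfolding c_def \<rho>_def power_add e1[symmetric] e2[symmetric] e3[symmetric] .
      qed
      then have "(c i) ^ 3 * (192000 * \<Lambda> * G * (500 / 729) ^ i) = 24 * \<Lambda> * G * (4 ^ J * 2 ^ J) * ((729 / 1000) ^ i * 8 ^ i * (500 / 729) ^ i)"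
        by (simp only:) (simp add: mult_ac)
      also have "(729 / 1000) ^ i * 8 ^ i * (500 / 729 :: real) ^ i = 4 ^ i" by (simp flip: power_mult_distrib)
      finally have E: "(c i) ^ 3 * (192000 * \<Lambda> * G * (500 / 729) ^ i) = 24 * \<Lambda> * G * (4 ^ J * 2 ^ J) * 4 ^ i" .
      show ?thesis unfolding E power_add by (simp only: mult_ac)
    qed
    finally show ?thesis using c_pos[of i] by simp
  qed
  \<comment> \<open>Off the exceptional sets all coefficients at \<open>x\<close> are below 1, the
    levels below J add up to at most 1/2, and level J + i contributes at most \<rho>(i)/2.\<close>
  have "{x\<in>space M. 1 < (\<Sum>p\<in>S. \<alpha> p * indicator (D p) x)} \<subseteq> A0 \<union> (A1 \<union> (\<Union>i<?n. A2 i))" (is "?L \<subseteq> _")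
  proof (rule subsetI, rule ccontr)
    fix x assume x: "x \<in> ?L" and not: "x \<notin> A0 \<union> (A1 \<union> (\<Union>i<?n. A2 i))"
    let ?g = "\<lambda>p. \<alpha> p * indicator (D p) x"
    have g0: "0 \<le> ?g p" if "p \<in> S" for p using \<alpha>[OF that] by simp
    have "(\<Sum>p\<in>S. ?g p) \<le> (\<Sum>p\<in>S. \<Sum>j<J + ?n. if p \<in> lev j then ?g p else 0)"
    proof (rule sum_mono)
      fix p assume p: "p \<in> S"
      show "?g p \<le> (\<Sum>j<J + ?n. if p \<in> lev j then ?g p else 0)"
      proof (cases "?g p = 0")
        case True
        have "0 \<le> (\<Sum>j<J + ?n. if p \<in> lev j then ?g p else 0)"
          using g0[OF p] by (intro sum_nonneg) auto
        then show ?thesis unfolding True by (simp only:)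
      next
        case False
        then have xp: "x \<in> D p" and pos: "0 < \<alpha> p" using \<alpha>[OF p] by (auto simp: less_le indicator_def split: if_splits)
        have "\<alpha> p \<le> 1" using not xp p by (force simp: A0_def)
        then obtain j where j: "j < ?n" "p \<in> lev j"
          using dyadic_level[OF n[OF p pos]] p by (auto simp: lev_def)
        have "?g p = (if p \<in> lev j then ?g p else 0)" using j by simp
        also have "\<dots> \<le> (\<Sum>j<J + ?n. if p \<in> lev j then ?g p else 0)"
          using j g0[OF p] by (intro member_le_sum) auto
        finally show ?thesis .
      qed
    qed
    also have "\<dots> = (\<Sum>j<J + ?n. \<Sum>p\<in>S. if p \<in> lev j then ?g p else 0)" by (rule sum.swap)
    also have "\<dots> \<le> (\<Sum>j<J + ?n. count (lev j) x / 2 ^ j)"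
    proof (rule sum_mono)
      fix j
      have "(\<Sum>p\<in>S. if p \<in> lev j then ?g p else 0) = (\<Sum>p\<in>lev j. ?g p)"
        using finite_S lev[of j] by (simp add: sum.If_cases Int_absorb1)
      also have "\<dots> \<le> (\<Sum>p\<in>lev j. (1 / 2 ^ j) * indicator (D p) x)"
        by (intro sum_mono mult_right_mono) (auto simp: lev_def)
      also have "\<dots> = count (lev j) x / 2 ^ j" unfolding count_def by (simp add: sum_distrib_left sum_divide_distrib)
      finally show "(\<Sum>p\<in>S. if p \<in> lev j then ?g p else 0) \<le> count (lev j) x / 2 ^ j" .
    qed
    also have "\<dots> = F1 x + (\<Sum>i<?n. count (lev (J + i)) x / 2 ^ (J + i))"
    proof -
      have "sum h {..<J + N} = sum h {..<J} + (\<Sum>i<N. h (J + i))" for h :: "nat \<Rightarrow> real" and N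
        by (induction N) auto
      then show ?thesis unfolding F1_def .
    qed
    also have "\<dots> \<le> 1 / 2 + (\<Sum>i<?n. \<rho> i / 2)"
    proof (intro add_mono sum_mono)
      show "F1 x \<le> 1 / 2" using not x by (auto simp: A1_def)
      fix i assume "i \<in> {..<?n}"
      then have "count (lev (J + i)) x \<le> c i" using not x by (force simp: A2_def)
      then show "count (lev (J + i)) x / 2 ^ (J + i) \<le> \<rho> i / 2" by (simp add: c_def field_simps)
    qed
    also have "\<dots> \<le> 1" using \<rho>_sum[of ?n] by (simp only: sum_divide_distrib[symmetric])
    finally show False using x by simp
  qed
  then have "measure M ?L \<le> measure M (A0 \<union> (A1 \<union> (\<Union>i<?n. A2 i)))"
  proof (rule measure_mono_fmeasurable)
    show "?L \<in> sets M"
    proof -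
      have "(\<lambda>x. \<Sum>p\<in>S. \<alpha> p * indicator (D p) x) \<in> borel_measurable M"
        using measurable_D by (intro borel_measurable_sum) auto
      then show ?thesis by measurable
    qed
  qed (intro fmeasurable.Un fmeasurable.finite_UN fA0 fA1 fA2; simp)
  also have "\<dots> \<le> measure M A0 + (measure M A1 + (\<Sum>i<?n. measure M (A2 i)))"
    using fA0 fA1 fA2
    by (intro order.trans[OF measure_Un_le] add_mono order.refl measure_UNION_le) (auto intro!: sets.Un sets.finite_UN)
  also have "\<dots> \<le> \<Lambda> * G + (16 * \<Lambda> * G + (\<Sum>i<?n. 192000 * \<Lambda> * G * (500 / 729) ^ i))"
  proof (intro add_mono sum_mono mA1 mA2)
    have "1 * G \<le> \<Lambda> * G" using \<Lambda>_ge G by (rule mult_right_mono)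
    then show "measure M A0 \<le> \<Lambda> * G" using mA0 by simp
  qed
  also have "(\<Sum>i<?n. 192000 * \<Lambda> * G * (500 / 729) ^ i) \<le> 192000 * \<Lambda> * G * 4"
  proof -
    have e: "(\<Sum>i<N. (500 / 729) ^ i) = (1 - (500 / 729) ^ N) * (729 / 229 :: real)" for N
      by (simp add: sum_gp_strict)
    have l: "(1 - (500 / 729) ^ ?n) * (729 / 229 :: real) \<le> 1 * 4"
      by (intro mult_mono) auto
    have "(\<Sum>i<?n. (500 / 729 :: real) ^ i) \<le> 4" unfolding e using l by (simp only: mult_1)
    then show ?thesis unfolding sum_distrib_left[symmetric] using \<Lambda>_ge G by (intro mult_left_mono) auto
  qed
  \<comment> \<open>1 + 16 + 768000, rounded up.\<close>
  also have "\<Lambda> * G + (16 * \<Lambda> * G + 192000 * \<Lambda> * G * 4) \<le> 1000000 * \<Lambda> * G"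
    using mult_nonneg_nonneg[of \<Lambda> G] \<Lambda>_ge G by simp
  finally show ?thesis by simp
qed

end

subsection \<open>From ramps to frequency projections\<close>

lemma (in A1_weight) weighted_energy_finite:
  fixes f :: "real \<Rightarrow> complex"
  assumes f_bound: "\<And>x. cmod (f x) \<le> F" and f_supp: "\<And>x. f x \<noteq> 0 \<Longrightarrow> x \<in> S"
    and S: "bounded S" "S \<in> sets lebesgue"
  shows "weighted_energy f < \<infinity>"
proof -
  have "weighted_energy f
    \<le> (\<integral>\<^sup>+x. ennreal (F\<^sup>2) * (ennreal (w x) * indicator S x) \<partial>lebesgue)"
  proof (rule nn_integral_mono)
    fix x
    show "ennreal ((cmod (f x))\<^sup>2) * ennreal (w x) \<le> ennreal (F\<^sup>2) * (ennreal (w x) * indicator S x)"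
    proof (cases "f x = 0")
      case False
      then have "x \<in> S" by (rule f_supp)
      then show ?thesis using f_bound[of x] by (auto intro!: mult_right_mono ennreal_leI power_mono)
    qed simp
  qed
  also have "\<dots> = ennreal (F\<^sup>2) * emeasure \<mu> S"
  proof -
    have "(\<lambda>x. ennreal (w x) * indicator S x) \<in> borel_measurable lebesgue"
      by (intro borel_measurable_times_ennreal borel_measurable_indicator S(2)) measurable
    then show ?thesis unfolding emeasure_weight[OF S(2)] by (rule nn_integral_cmult)
  qed
  also have "\<dots> < \<infinity>" using emeasure_weight_finite[OF S] by (simp add: ennreal_mult_less_top)
  finally show ?thesis .
qed

context weighted_tree
begin

lemma bounded_root: "bounded root" "root \<in> sets lebesgue"
  by (auto simp: root_def)

text \<open>The abstract estimate applies with Carleson constant 2 [w]_Ainf and G equal to 30 [w]_A1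
  times the weighted energy: 60000000 = 1000000 * 2 * 30.\<close>

lemma weak_type_root:
  "emeasure \<mu> {x\<in>root. 2 * step_const < ramp_norm f x}
    \<le> ennreal 60000000 * A1_const w * Ainf_const w * weighted_energy f"
proof (cases "emeasure \<mu> {q<..<q + len} = 0")
  case True
  have "emeasure \<mu> root = emeasure \<mu> {q<..<q + len}"
  proof (rule emeasure_weight_cong)
    show "AE x in lebesgue. x \<in> root \<longleftrightarrow> x \<in> {q<..<q + len}"
      using AE_lebesgue_singleton[of q]
      by eventually_elim (simp only: root_def atLeastLessThan_iff greaterThanLessThan_iff, linarith)
  qed (auto simp: root_def)
  moreover have "emeasure \<mu> {x\<in>root. 2 * step_const < ramp_norm f x} \<le> emeasure \<mu> root"
    by (rule emeasure_mono) (auto simp: root_def)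
  ultimately show ?thesis using True by simp
next
  case False
  have Ainf1: "1 \<le> Ainf_const w" by (rule Ainf_ge_1[OF _ False]) (use len_pos in simp)
  obtain A where A: "A1_const w = ennreal A" "0 \<le> A" using A1_finite by (cases "A1_const w") auto
  obtain L where L: "Ainf_const w = ennreal L" "0 \<le> L" using Ainf_finite by (cases "Ainf_const w") auto
  have L1: "1 \<le> L" using Ainf1 L by (simp flip: ennreal_1)
  obtain E where E: "weighted_energy f = ennreal E" "0 \<le> E"
    using weighted_energy_finite[of f, OF f_bound f_supp bounded_root] by (cases "weighted_energy f") auto
  obtain N where N: "{x\<in>root. 2 * step_const < ramp_norm f x}
     \<subseteq> {x\<in>root. 1 < (\<Sum>(n, i)\<in>tree N. \<alpha> n i * indicator (node n i) x)}" using superlevel_subset by blast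
  let ?D = "\<lambda>p. node (fst p) (snd p)"
  have fm: "?D p \<in> fmeasurable \<mu>" for p
    using emeasure_node_finite(1) by (intro fmeasurableI) auto
  have em: "emeasure \<mu> (?D p) = ennreal (measure \<mu> (?D p))" for p
    using fm by (rule emeasure_eq_measure2)
  interpret laminar_family \<mu> "tree N" ?D "2 * L"
  proof
    fix p p' assume p: "p \<in> tree N" "p' \<in> tree N"
    then show "?D p \<inter> ?D p' \<noteq> {} \<Longrightarrow> ?D p \<subseteq> ?D p' \<or> ?D p' \<subseteq> ?D p"
      by (intro node_laminar) auto
    have "ennreal (\<Sum>p'\<in>{p'\<in>tree N. ?D p' \<subseteq> ?D p}. measure \<mu> (?D p')) \<le> ennreal (2 * L * measure \<mu> (?D p))"
      using carleson_packing[OF p(1)] L unfolding em by (simp add: sum_ennreal ennreal_mult)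
    then show "(\<Sum>p'\<in>{p'\<in>tree N. ?D p' \<subseteq> ?D p}. measure \<mu> (?D p')) \<le> 2 * L * measure \<mu> (?D p)"
      using L by (subst (asm) ennreal_le_iff) auto
  qed (use fm L1 in auto)
  define U where "U = {x. 1 < (\<Sum>p\<in>tree N. \<alpha> (fst p) (snd p) * indicator (?D p) x)}"
  have meas: "measure \<mu> {x\<in>space \<mu>. 1 < (\<Sum>p\<in>tree N. \<alpha> (fst p) (snd p) * indicator (?D p) x)}
    \<le> 1000000 * (2 * L) * (30 * A * E)"
  proof (rule sparse_weak_type)
    fix t :: real assume t: "0 < t"
    have "ennreal (t\<^sup>2 * (\<Sum>p\<in>{p\<in>tree N. t \<le> \<alpha> (fst p) (snd p)}. measure \<mu> (?D p))) \<le> ennreal (30 * A * E)"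
      using weighted_large_mass[OF t, of N] A E unfolding em
      by (simp add: sum_ennreal ennreal_mult sum_nonneg mult.assoc)
    then show "t\<^sup>2 * (\<Sum>p\<in>{p\<in>tree N. t \<le> \<alpha> (fst p) (snd p)}. measure \<mu> (?D p)) \<le> 30 * A * E"
      using A E by (subst (asm) ennreal_le_iff) auto
  qed simp
  have mS: "U \<in> sets lebesgue"
  proof -
    have "(\<lambda>x. \<Sum>p\<in>tree N. \<alpha> (fst p) (snd p) * indicator (?D p) x) \<in> borel_measurable lebesgue"
      by (intro borel_measurable_sum) auto
    then have "{x\<in>space lebesgue. 1 < (\<Sum>p\<in>tree N. \<alpha> (fst p) (snd p) * indicator (?D p) x)} \<in> sets lebesgue"
      by measurable
    then show ?thesis by (simp add: U_def)
  qed
  have rU: "root \<inter> U \<in> sets lebesgue"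
    by (intro sets.Int mS) (simp add: root_def)
  have "emeasure \<mu> {x\<in>root. 2 * step_const < ramp_norm f x} \<le> emeasure \<mu> (root \<inter> U)"
  proof (rule emeasure_mono)
    show "{x\<in>root. 2 * step_const < ramp_norm f x} \<subseteq> root \<inter> U"
      using N unfolding case_prod_unfold U_def by blast
    show "root \<inter> U \<in> sets \<mu>" using rU by simp
  qed
  also have "\<dots> = ennreal (measure \<mu> (root \<inter> U))"
  proof (rule emeasure_eq_ennreal_measure)
    have "emeasure \<mu> (root \<inter> U) < \<infinity>"
      by (rule emeasure_weight_finite[OF bounded_subset[of root] rU]) (auto simp: root_def)
    then show "emeasure \<mu> (root \<inter> U) \<noteq> top" by simp
  qed
  also have "measure \<mu> (root \<inter> U) \<le> measure \<mu> U"
  proof (rule measure_mono_fmeasurable)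
    have sub: "U \<subseteq> (\<Union>p\<in>tree N. ?D p)"
    proof (rule subsetI, rule ccontr)
      fix x assume x: "x \<in> U" "x \<notin> (\<Union>p\<in>tree N. ?D p)"
      then have "(\<Sum>p\<in>tree N. \<alpha> (fst p) (snd p) * indicator (?D p) x) = 0"
        by (intro sum.neutral) auto
      with x(1) show False unfolding U_def mem_Collect_eq by (simp only: not_one_less_zero)
    qed
    have "(\<Union>p\<in>tree N. ?D p) \<in> fmeasurable \<mu>"
      by (rule fmeasurable.finite_UN[OF finite_tree fm])
    then show "U \<in> fmeasurable \<mu>"
      by (rule fmeasurableI2[OF _ sub]) (use mS in simp)
  qed (use rU in auto)
  also have "measure \<mu> U \<le> 1000000 * (2 * L) * (30 * A * E)" using meas by (simp only: U_def space_weight UNIV_I simp_thms)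
  also have "ennreal (1000000 * (2 * L) * (30 * A * E)) = ennreal 60000000 * A1_const w * Ainf_const w * ennreal E"
  proof -
    have "1000000 * (2 * L) * (30 * A * E) = 60000000 * A * L * E" by simp
    then show ?thesis using A L E by (simp only: ennreal_mult mult_nonneg_nonneg zero_le_numeral)
  qed
  finally show ?thesis unfolding E by (simp add: ennreal_leI)
qed

end

text \<open>Outside its locale \<open>step_const\<close> is a function of \<open>B\<close> alone,
  which expresses that the constant is independent of the family, the weight and the
  function.\<close>

definition weak_const :: "real \<Rightarrow> real" where
  "weak_const B = 60000000 * (2 * stopping_tree.step_const B)\<^sup>2"

lemma weak_const_nonneg [simp]: "0 \<le> weak_const B"
  by (simp add: weak_const_def)

locale weighted_family = interval_family K a b B + A1_weight w
  for K :: "'k set" and a b :: "'k \<Rightarrow> real" and B :: real and w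
begin

text \<open>A tree sees the superlevel set only inside its root. The bound does not depend on the
  root, so roots exhausting the line are used and monotone continuity of the measure
  concludes.\<close>

lemma weak_type_ramp:
  assumes f_meas [measurable]: "f \<in> borel_measurable borel" and f_bound: "\<And>x. cmod (f x) \<le> F"
    and f_supp: "\<And>x. f x \<noteq> 0 \<Longrightarrow> \<bar>x\<bar> < R" and t: "0 < t"
  shows "emeasure \<mu> {x. t < ramp_norm f x}
    \<le> ennreal (weak_const B / t\<^sup>2) * A1_const w * Ainf_const w * weighted_energy f" (is "_ \<le> ?bound")
proof -
  define R' where "R' = max R 1"
  let ?X = "\<lambda>n::nat. {- (R' + real n)..<R' + real n}"
  let ?A = "\<lambda>n::nat. {x\<in>?X n. t < ramp_norm f x}"
  have bound: "emeasure \<mu> (?A n) \<le> ?bound" for n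
  proof -
    \<comment> \<open>Rescaling by \<open>s\<close> moves the level \<open>t\<close> to the fixed
      level \<open>2 * step_const\<close> of \<open>weak_type_root\<close>, which is where 1 / t^2
      comes from.\<close>
    define s where "s = 2 * stopping_tree.step_const B / t"
    define g where "g x = of_real s * f x" for x
    have tree: "stopping_tree K a b B (- (R' + real n)) (2 * (R' + real n)) g (\<bar>s\<bar> * F)"
    proof (unfold_locales)
      show "0 < 2 * (R' + real n)" by (simp add: R'_def)
      show "g \<in> borel_measurable borel" unfolding g_def by measurable
      show "cmod (g x) \<le> \<bar>s\<bar> * F" for x unfolding g_def norm_mult norm_of_real by (intro mult_left_mono f_bound) simp
      show "x \<in> dyadic_root.root (- (R' + real n)) (2 * (R' + real n))" if "g x \<noteq> 0" for x
      proof -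
        have "\<bar>x\<bar> < R" using that by (intro f_supp) (auto simp: g_def)
        then show ?thesis unfolding dyadic_root.root_def[OF dyadic_root.intro[OF \<open>0 < 2 * (R' + real n)\<close>]] by (auto simp: R'_def)
      qed
    qed
    interpret T: weighted_tree K a b B "- (R' + real n)" "2 * (R' + real n)" g "\<bar>s\<bar> * F" w
      by (intro weighted_tree.intro tree) unfold_locales
    have s: "0 < s" using T.step_const_pos t by (simp add: s_def)
    have root: "T.root = ?X n" unfolding T.root_def by simp
    have "?A n = {x\<in>T.root. 2 * stopping_tree.step_const B < ramp_norm g x}"
    proof -
      have "t < ramp_norm f x \<longleftrightarrow> 2 * stopping_tree.step_const B < ramp_norm g x" for x
      proof -
        have "ramp_norm g x = s * ramp_norm f x" unfolding g_def ramp_norm_cmult using s by simp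
        moreover have "2 * stopping_tree.step_const B = s * t" using t by (simp add: s_def)
        ultimately show ?thesis using s by simp
      qed
      then show ?thesis unfolding root by simp
    qed
    then have "emeasure \<mu> (?A n) \<le> ennreal 60000000 * A1_const w * Ainf_const w * weighted_energy g"
      using T.weak_type_root by simp
    also have "weighted_energy g = ennreal (s\<^sup>2) * weighted_energy f"
    proof -
      have [measurable]: "f \<in> borel_measurable lebesgue" by (rule measurable_completion) simp
      have "ennreal ((cmod (g x))\<^sup>2) * ennreal (w x) = ennreal (s\<^sup>2) * (ennreal ((cmod (f x))\<^sup>2) * ennreal (w x))" for x
        by (simp add: g_def norm_mult power_mult_distrib ennreal_mult mult.assoc)
      then show ?thesis by (simp add: nn_integral_cmult)
    qed
    also have "ennreal 60000000 * A1_const w * Ainf_const w * (ennreal (s\<^sup>2) * weighted_energy f)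
      = (ennreal 60000000 * ennreal (s\<^sup>2)) * A1_const w * Ainf_const w * weighted_energy f"
      by (simp only: mult_ac)
    also have "ennreal 60000000 * ennreal (s\<^sup>2) = ennreal (weak_const B / t\<^sup>2)"
      by (subst ennreal_mult[symmetric]) (auto simp: weak_const_def s_def power_divide)
    finally show ?thesis .
  qed
  have "incseq ?A" by (auto simp: incseq_def)
  moreover have "?A n \<in> sets \<mu>" for n
  proof -
    have "{x\<in>space lborel. x \<in> ?X n \<and> t < ramp_norm f x} \<in> sets lborel" by measurable
    then show ?thesis by (auto intro: sets_completionI_sets)
  qed
  ultimately have "(SUP n. emeasure \<mu> (?A n)) = emeasure \<mu> (\<Union>n. ?A n)"
    by (intro SUP_emeasure_incseq) auto
  moreover have "(\<Union>n. ?A n) = {x. t < ramp_norm f x}"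
  proof -
    have "\<exists>n. x \<in> ?X n" for x
    proof -
      obtain n where "\<bar>x\<bar> \<le> real n" using real_arch_simple by blast
      then show ?thesis by (intro exI[of _ n]) (auto simp: R'_def)
    qed
    then show ?thesis by blast
  qed
  ultimately have "emeasure \<mu> {x. t < ramp_norm f x} = (SUP n. emeasure \<mu> (?A n))" by simp
  also have "\<dots> \<le> ?bound" by (intro SUP_least bound)
  finally show ?thesis .
qed

end

definition freq_proj :: "real set \<Rightarrow> (real \<Rightarrow> complex) \<Rightarrow> real \<Rightarrow> complex" where
  "freq_proj I f x = (LINT \<xi>|lborel. indicator I \<xi> * (fourier f \<xi> * cis (2 * pi * x * \<xi>)))"

lemma inverse_fourier_reflect:
  "inverse_fourier (\<lambda>y. f (x - y)) \<xi> = fourier f \<xi> * cis (2 * pi * x * \<xi>)"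
proof -
  have "inverse_fourier (\<lambda>y. f (x - y)) \<xi> = (LINT y|lborel. f (x - y) * cis (2 * pi * \<xi> * y))"
    unfolding inverse_fourier_def cis_conv_exp by (simp add: mult_ac)
  also have "\<dots> = (LINT y|lborel. f y * cis (2 * pi * \<xi> * (x - y)))"
    by (subst lborel_integral_real_affine[of "-1" _ x]) auto
  also have "\<dots> = (LINT y|lborel. f y * cis (- (2 * pi * y * \<xi>)) * cis (2 * pi * x * \<xi>))"
  proof (intro Bochner_Integration.integral_cong refl)
    fix y
    have "cis (2 * pi * \<xi> * (x - y)) = cis (- (2 * pi * y * \<xi>)) * cis (2 * pi * x * \<xi>)"
      unfolding cis_mult by (simp add: algebra_simps)
    then show "f y * cis (2 * pi * \<xi> * (x - y)) = f y * cis (- (2 * pi * y * \<xi>)) * cis (2 * pi * x * \<xi>)"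
      by (simp only: mult.assoc)
  qed
  finally show ?thesis unfolding fourier_def by simp
qed

text \<open>Reflecting and translating \<open>f\<close> turns its inverse transform into a modulated
  \<open>fourier f\<close>, so the convolution with a distribution is the multiplier with symbol the
  indicator of \<open>I\<close>.\<close>

lemma distr_conv_eq_freq_proj:
  "distr_conv f (distr_inverse_fourier (indicator I)) x = freq_proj I f x"
  unfolding distr_conv_def distr_inverse_fourier_def freq_proj_def inverse_fourier_reflect ..

lemma borel_measurable_freq_proj [measurable]:
  assumes [measurable]: "f \<in> borel_measurable borel" "I \<in> sets borel"
  shows "freq_proj I f \<in> borel_measurable borel"
  unfolding freq_proj_def[abs_def] by measurable

lemma cnj_fourier: "cnj (fourier f \<xi>) = fourier (\<lambda>y. cnj (f y)) (- \<xi>)"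
  unfolding fourier_def Bochner_Integration.integral_cnj[symmetric]
  by (simp add: cis_cnj del: Bochner_Integration.integral_cnj)

text \<open>The indicator of an interval is the sum of two ramps; the increasing one is reduced to a decreasing
  one by complex conjugation.\<close>
lemma freq_proj_le_ramps:
  assumes f: "integrable lborel f" and ab: "a < b"
  shows "cmod (freq_proj {a<..<b} f x) \<le> cmod (ramp a b f x) + cmod (ramp (- b) (- a) (\<lambda>y. cnj (f y)) x)"
proof -
  let ?c = "\<lambda>y. cnj (f y)"
  have c: "integrable lborel ?c" using f by simp
  let ?e = "\<lambda>\<xi>. fourier f \<xi> * cis (2 * pi * x * \<xi>)"
  let ?r = "\<lambda>\<xi>. complex_of_real (ramp_symbol a b \<xi>) * ?e \<xi>"
  let ?l = "\<lambda>\<xi>. complex_of_real (ramp_symbol (- b) (- a) (- \<xi>)) * ?e \<xi>"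
  have r_eq: "?r = (\<lambda>\<xi>. cis (2 * pi * x * a) * (complex_of_real (ramp_symbol a b \<xi>) * fourier f \<xi> * cis (2 * pi * x * (\<xi> - a))))"
  proof
    fix \<xi>
    have "cis (2 * pi * x * \<xi>) = cis (2 * pi * x * a) * cis (2 * pi * x * (\<xi> - a))"
      unfolding cis_mult by (simp add: algebra_simps)
    then show "?r \<xi> = cis (2 * pi * x * a) * (complex_of_real (ramp_symbol a b \<xi>) * fourier f \<xi> * cis (2 * pi * x * (\<xi> - a)))"
      by (simp only: mult_ac)
  qed
  have ir: "integrable lborel ?r"
    unfolding r_eq by (intro integrable_mult_right integrable_ramp f ab)
  have Ir: "(LINT \<xi>|lborel. ?r \<xi>) = cis (2 * pi * x * a) * ramp a b f x"
    unfolding r_eq ramp_def by (rule integral_mult_right_zero)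
  let ?m = "\<lambda>\<eta>. cis (- (2 * pi * x * b)) * (complex_of_real (ramp_symbol (- b) (- a) \<eta>) * fourier ?c \<eta> * cis (2 * pi * x * (\<eta> - (- b))))"
  \<comment> \<open>Conjugation reflects frequencies: the ramp increasing on (a, b) becomes the ramp
    decreasing on (-b, -a), with its jump at the left end as \<open>ramp\<close> demands.\<close>
  have l_eq: "cnj (?l \<xi>) = ?m (0 + (-1) * \<xi>)" for \<xi>
  proof -
    have "cis (- (2 * pi * x * \<xi>)) = cis (- (2 * pi * x * b)) * cis (2 * pi * x * ((0 + (-1) * \<xi>) - (- b)))"
      unfolding cis_mult by (simp add: algebra_simps)
    then show ?thesis
      by (simp add: cnj_fourier cis_cnj mult_ac)
  qed
  have ba: "- b < - a" using ab by simp
  have im: "integrable lborel ?m" by (intro integrable_mult_right integrable_ramp c ba)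
  have icl: "integrable lborel (\<lambda>\<xi>. cnj (?l \<xi>))"
    unfolding l_eq by (rule lborel_integrable_real_affine[OF im]) simp
  then have il: "integrable lborel ?l" using integrable_bounded_linear[OF bounded_linear_cnj icl] by (simp only: complex_cnj_cnj)
  have Il: "cnj (LINT \<xi>|lborel. ?l \<xi>) = cis (- (2 * pi * x * b)) * ramp (- b) (- a) ?c x"
  proof -
    have "cnj (LINT \<xi>|lborel. ?l \<xi>) = (LINT \<xi>|lborel. ?m (0 + (-1) * \<xi>))"
      unfolding Bochner_Integration.integral_cnj[symmetric] l_eq ..
    also have "\<dots> = (LINT \<eta>|lborel. ?m \<eta>)"
      by (subst (2) lborel_integral_real_affine[of "-1" _ 0]) auto
    finally show ?thesis unfolding ramp_def by simp
  qed
  have split: "indicator {a<..<b} \<xi> * ?e \<xi> = ?r \<xi> + ?l \<xi>" for \<xi>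
  proof -
    have "indicator {a<..<b} \<xi> = ramp_symbol a b \<xi> + ramp_symbol (- b) (- a) (- \<xi>)"
    proof -
      have "(b - \<xi>) / (b - a) + (\<xi> - a) / (b - a) = 1"
        using ab by (simp add: add_divide_distrib[symmetric])
      then show ?thesis by (auto simp: ramp_symbol_def indicator_def)
    qed
    then have "(indicator {a<..<b} \<xi> :: complex) = complex_of_real (ramp_symbol a b \<xi>) + complex_of_real (ramp_symbol (- b) (- a) (- \<xi>))"
      by (metis of_real_add of_real_indicator)
    then show ?thesis by (simp only: distrib_right)
  qed
  have "freq_proj {a<..<b} f x = (LINT \<xi>|lborel. ?r \<xi>) + (LINT \<xi>|lborel. ?l \<xi>)"
    unfolding freq_proj_def split using ir il by (rule Bochner_Integration.integral_add)
  then have "cmod (freq_proj {a<..<b} f x) \<le> cmod (LINT \<xi>|lborel. ?r \<xi>) + cmod (cnj (LINT \<xi>|lborel. ?l \<xi>))"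
    using norm_triangle_ineq by simp
  then show ?thesis unfolding Ir Il by (simp add: norm_mult)
qed

context weighted_family
begin

lemma reflected_family: "weighted_family K (\<lambda>k. - b k) (\<lambda>k. - a k) B w"
proof unfold_locales
  fix \<xi> :: real
  have "(\<Sum>k\<in>K. indicator {- b k<..<- a k} \<xi>) = (\<Sum>k\<in>K. indicator {a k<..<b k} (- \<xi>) :: real)"
    by (intro sum.cong) (auto simp: indicator_def)
  then show "(\<Sum>k\<in>K. indicator {- b k<..<- a k} \<xi>) \<le> B" using overlap[of "- \<xi>"] by simp
qed (use less in auto)

text \<open>At least one of the two ramp norms exceeds t / 2; two sets and the square of 1/2 give
  the factor 8.\<close>

lemma weak_type_freq_proj:
  assumes f_meas [measurable]: "f \<in> borel_measurable borel" and f_bound: "\<And>x. cmod (f x) \<le> F"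
    and f_supp: "\<And>x. f x \<noteq> 0 \<Longrightarrow> \<bar>x\<bar> < R" and t: "0 < t"
  shows "emeasure \<mu> {x. t < L2_set (\<lambda>k. cmod (freq_proj {a k<..<b k} f x)) K}
    \<le> ennreal (8 * weak_const B / t\<^sup>2) * A1_const w * Ainf_const w * weighted_energy f"
proof -
  interpret R: weighted_family K "\<lambda>k. - b k" "\<lambda>k. - a k" B w by (rule reflected_family)
  let ?c = "\<lambda>y. cnj (f y)"
  have F: "0 \<le> F" using f_bound[of 0] norm_ge_zero order.trans by blast
  have int: "integrable lborel f"
  proof (rule Bochner_Integration.integrable_bound)
    show "integrable lborel (\<lambda>x. F * indicator {- R..R} x :: real)"
      by (intro integrable_mult_right) (simp add: integrable_indicator_iff emeasure_lborel_Icc_eq)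
    show "AE x in lborel. norm (f x) \<le> norm (F * indicator {- R..R} x :: real)"
    proof (rule AE_I2)
      fix x show "norm (f x) \<le> norm (F * indicator {- R..R} x :: real)"
        using f_bound[of x] f_supp[of x] F by (cases "f x = 0") (auto simp: indicator_def)
    qed
  qed simp
  have le: "L2_set (\<lambda>k. cmod (freq_proj {a k<..<b k} f x)) K \<le> ramp_norm f x + R.ramp_norm ?c x" for x
  proof -
    have "L2_set (\<lambda>k. cmod (freq_proj {a k<..<b k} f x)) K
      \<le> L2_set (\<lambda>k. cmod (ramp (a k) (b k) f x) + cmod (ramp (- b k) (- a k) ?c x)) K"
      by (intro L2_set_mono freq_proj_le_ramps int less) auto
    also have "\<dots> \<le> ramp_norm f x + R.ramp_norm ?c x"
      unfolding ramp_norm_def R.ramp_norm_def by (rule L2_set_triangle_ineq)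
    finally show ?thesis .
  qed
  have sets: "{x. t / 2 < ramp_norm f x} \<in> sets \<mu>" "{x. t / 2 < R.ramp_norm ?c x} \<in> sets \<mu>"
  proof -
    have "{x\<in>space lborel. t / 2 < ramp_norm f x} \<in> sets lborel" "{x\<in>space lborel. t / 2 < R.ramp_norm ?c x} \<in> sets lborel"
      by measurable
    then show "{x. t / 2 < ramp_norm f x} \<in> sets \<mu>" "{x. t / 2 < R.ramp_norm ?c x} \<in> sets \<mu>"
      by (auto intro: sets_completionI_sets)
  qed
  let ?b = "ennreal (weak_const B / (t / 2)\<^sup>2) * A1_const w * Ainf_const w * weighted_energy f"
  have "emeasure \<mu> {x. t < L2_set (\<lambda>k. cmod (freq_proj {a k<..<b k} f x)) K}
    \<le> emeasure \<mu> ({x. t / 2 < ramp_norm f x} \<union> {x. t / 2 < R.ramp_norm ?c x})"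
  proof (rule emeasure_mono)
    show "{x. t < L2_set (\<lambda>k. cmod (freq_proj {a k<..<b k} f x)) K} \<subseteq> {x. t / 2 < ramp_norm f x} \<union> {x. t / 2 < R.ramp_norm ?c x}"
    proof
      fix x assume "x \<in> {x. t < L2_set (\<lambda>k. cmod (freq_proj {a k<..<b k} f x)) K}"
      then show "x \<in> {x. t / 2 < ramp_norm f x} \<union> {x. t / 2 < R.ramp_norm ?c x}" using le[of x] by auto
    qed
  qed (use sets in auto)
  also have "\<dots> \<le> emeasure \<mu> {x. t / 2 < ramp_norm f x} + emeasure \<mu> {x. t / 2 < R.ramp_norm ?c x}"
    by (rule emeasure_subadditive[OF sets])
  also have "\<dots> \<le> ?b + ?b"
  proof (intro add_mono)
    show "emeasure \<mu> {x. t / 2 < ramp_norm f x} \<le> ?b"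
      by (rule weak_type_ramp[OF f_meas f_bound f_supp]) (use t in auto)
    have "emeasure \<mu> {x. t / 2 < R.ramp_norm ?c x} \<le> ennreal (weak_const B / (t / 2)\<^sup>2) * A1_const w * Ainf_const w *
      weighted_energy ?c"
      by (rule R.weak_type_ramp[of ?c F R]) (use f_bound f_supp t in auto)
    then show "emeasure \<mu> {x. t / 2 < R.ramp_norm ?c x} \<le> ?b" by simp
  qed
  also have "?b + ?b = ennreal (8 * weak_const B / t\<^sup>2) * A1_const w * Ainf_const w * weighted_energy f"
  proof -
    have "ennreal (8 * weak_const B / t\<^sup>2) = ennreal (weak_const B / (t / 2)\<^sup>2) + ennreal (weak_const B / (t / 2)\<^sup>2)"
      by (subst ennreal_plus[symmetric]) (auto simp: power_divide)
    then show ?thesis by (simp only: distrib_right)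
  qed
  finally show ?thesis .
qed

end

subsection \<open>The square function\<close>

lemma bounded_interval_ends:
  fixes I :: "real set"
  assumes I: "is_interval I" "bounded I"
  shows "\<exists>a b. a \<le> b \<and> {a<..<b} \<subseteq> I \<and> I \<subseteq> {a..b}"
proof (cases "I = {}")
  case False
  have bdd: "bdd_below I" "bdd_above I" using I(2) by (auto intro: bounded_imp_bdd_below bounded_imp_bdd_above)
  have sub: "I \<subseteq> {Inf I..Sup I}" using bdd by (auto intro: cInf_lower cSup_upper)
  moreover have "{Inf I<..<Sup I} \<subseteq> I"
  proof
    fix x assume "x \<in> {Inf I<..<Sup I}"
    then obtain y z where "y \<in> I" "y < x" "z \<in> I" "x < z"
      using False bdd by (auto simp: cInf_less_iff less_cSup_iff)
    then show "x \<in> I" using I(1) by (meson less_imp_le mem_is_interval_1_I)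
  qed
  moreover have "Inf I \<le> Sup I" using False bdd by (meson cInf_le_cSup)
  ultimately show ?thesis by blast
qed (auto intro: exI[of _ 0])

lemma freq_proj_AE_cong:
  assumes "AE \<xi> in lborel. \<xi> \<in> I \<longleftrightarrow> \<xi> \<in> I'" "I \<in> sets borel" "I' \<in> sets borel" "f \<in> borel_measurable borel"
  shows "freq_proj I f x = freq_proj I' f x"
proof -
  note [measurable] = assms(2-4)
  show ?thesis unfolding freq_proj_def
  proof (rule integral_cong_AE)
    show "AE \<xi> in lborel. indicator I \<xi> * (fourier f \<xi> * cis (2 * pi * x * \<xi>))
      = indicator I' \<xi> * (fourier f \<xi> * cis (2 * pi * x * \<xi>))"
      using assms(1) by eventually_elim (auto simp: indicator_def)
  qed measurable
qed

text \<open>A Bochner integral with nonzero value is that of an integrable function, so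
  \<open>nz\<close> provides the majorant for dominated convergence.\<close>

lemma freq_proj_tendsto:
  assumes [measurable]: "I \<in> sets borel" "f \<in> borel_measurable borel" and nz: "freq_proj I f x \<noteq> 0"
  shows "(\<lambda>m. freq_proj (I \<inter> {- real m..real m}) f x) \<longlonglongrightarrow> freq_proj I f x"
proof -
  let ?g = "\<lambda>\<xi>. fourier f \<xi> * cis (2 * pi * x * \<xi>)"
  have int: "integrable lborel (\<lambda>\<xi>. indicator I \<xi> * ?g \<xi>)"
    using nz unfolding freq_proj_def by (metis not_integrable_integral_eq)
  show ?thesis unfolding freq_proj_def
  proof (rule integral_dominated_convergence[where w="\<lambda>\<xi>. norm (indicator I \<xi> * ?g \<xi>)"])
    show "integrable lborel (\<lambda>\<xi>. norm (indicator I \<xi> * ?g \<xi>))" using int by (rule integrable_norm)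
    show "AE \<xi> in lborel. (\<lambda>m. indicator (I \<inter> {- real m..real m}) \<xi> * ?g \<xi>) \<longlonglongrightarrow> indicator I \<xi> * ?g \<xi>"
    proof (rule AE_I2)
      fix \<xi> :: real
      obtain n where n: "\<bar>\<xi>\<bar> \<le> real n" using real_arch_simple by blast
      have "\<forall>\<^sub>F m in sequentially. indicator (I \<inter> {- real m..real m}) \<xi> * ?g \<xi> = indicator I \<xi> * ?g \<xi>"
        using eventually_ge_at_top[of n]
      proof eventually_elim
        case (elim m)
        then have "\<xi> \<in> {- real m..real m}" using n by auto
        then show ?case by (simp add: indicator_def)
      qed
      then show "(\<lambda>m. indicator (I \<inter> {- real m..real m}) \<xi> * ?g \<xi>) \<longlonglongrightarrow> indicator I \<xi> * ?g \<xi>"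
        by (rule tendsto_eventually)
    qed
    show "AE \<xi> in lborel. norm (indicator (I \<inter> {- real m..real m}) \<xi> * ?g \<xi>) \<le> norm (indicator I \<xi> * ?g \<xi>)" for m
      by (auto simp: indicator_def)
  qed measurable
qed

lemma square_function_greaterE:
  assumes "ennreal t < square_function \<omega> f x" "0 < t"
  obtains T where "finite T" "t < L2_set (\<lambda>k. cmod (freq_proj (\<omega> k) f x)) T"
proof -
  let ?h = "\<lambda>k. (cmod (freq_proj (\<omega> k) f x))\<^sup>2"
  define s where "s = (\<Sum>\<^sub>\<infinity>k. ennreal (?h k))"
  have sq: "square_function \<omega> f x = ennreal_sqrt s"
    unfolding square_function_def distr_conv_eq_freq_proj s_def ..
  have "ennreal (t\<^sup>2) < s"
  proof (cases s)
    case (real r)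
    then have "ennreal t < ennreal (sqrt r)" using assms(1) by (simp add: sq ennreal_sqrt_def)
    then have "t < sqrt r" using assms(2) by (simp add: ennreal_less_iff)
    then have "t\<^sup>2 < r" using assms(2) real(1) by (metis less_imp_le power_strict_mono real_sqrt_pow2 zero_less_numeral)
    then show ?thesis using real by (simp add: ennreal_less_iff)
  qed simp
  also have "s = (SUP T\<in>{T. finite T \<and> T \<subseteq> UNIV}. \<Sum>k\<in>T. ennreal (?h k))"
    unfolding s_def by (rule nonneg_infsum_complete) simp
  finally obtain T where T: "finite T" "ennreal (t\<^sup>2) < (\<Sum>k\<in>T. ennreal (?h k))"
    by (auto simp: less_SUP_iff)
  then have "t\<^sup>2 < (\<Sum>k\<in>T. ?h k)" by (simp add: sum_ennreal ennreal_less_iff)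
  then have "t < L2_set (\<lambda>k. cmod (freq_proj (\<omega> k) f x)) T"
    unfolding L2_set_def by (rule real_less_rsqrt)
  with T(1) show ?thesis by (rule that)
qed

text \<open>Truncated projections need not grow with \<open>m\<close>, so the level is shown to be
  exceeded for all large \<open>m\<close>; the superlevel set is then inside a lower limit of
  sets.\<close>

lemma square_function_truncation:
  assumes \<omega>: "\<And>k. \<omega> k \<in> sets borel" and f: "f \<in> borel_measurable borel"
    and big: "ennreal t < square_function \<omega> f x" and t: "0 < t"
  shows "\<exists>M. \<forall>m\<ge>M. t < L2_set (\<lambda>k. cmod (freq_proj (\<omega> k \<inter> {- real m..real m}) f x)) {- int m..int m}"
proof -
  obtain T where T: "finite T" "t < L2_set (\<lambda>k. cmod (freq_proj (\<omega> k) f x)) T"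
    using square_function_greaterE[OF big t] by blast
  \<comment> \<open>Indices with vanishing projection add nothing to the sum and are dropped, since
    \<open>freq_proj_tendsto\<close> concerns nonzero values.\<close>
  define T' where "T' = {k\<in>T. freq_proj (\<omega> k) f x \<noteq> 0}"
  have T': "finite T'" using T(1) by (simp add: T'_def)
  have eq: "L2_set (\<lambda>k. cmod (freq_proj (\<omega> k) f x)) T = L2_set (\<lambda>k. cmod (freq_proj (\<omega> k) f x)) T'"
    unfolding L2_set_def using T(1) by (intro arg_cong[of _ _ sqrt] sum.mono_neutral_right) (auto simp: T'_def)
  have "(\<lambda>m. L2_set (\<lambda>k. cmod (freq_proj (\<omega> k \<inter> {- real m..real m}) f x)) T')
    \<longlonglongrightarrow> L2_set (\<lambda>k. cmod (freq_proj (\<omega> k) f x)) T'"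
    unfolding L2_set_def
    by (intro tendsto_intros freq_proj_tendsto \<omega> f) (auto simp: T'_def)
  then have "\<forall>\<^sub>F m in sequentially. t < L2_set (\<lambda>k. cmod (freq_proj (\<omega> k \<inter> {- real m..real m}) f x)) T'"
    by (rule order_tendstoD(1)) (use T(2) eq in simp)
  then obtain M1 where M1: "\<And>m. m \<ge> M1 \<Longrightarrow> t < L2_set (\<lambda>k. cmod (freq_proj (\<omega> k \<inter> {- real m..real m}) f x)) T'"
    by (auto simp: eventually_sequentially)
  define M2 where "M2 = nat (\<Sum>k\<in>T'. \<bar>k\<bar>)"
  have M2: "T' \<subseteq> {- int m..int m}" if "M2 \<le> m" for m
  proof
    fix k assume k: "k \<in> T'"
    have "\<bar>k\<bar> \<le> (\<Sum>k\<in>T'. \<bar>k\<bar>)" using k T' by (intro member_le_sum) auto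
    also have "\<dots> \<le> int m" using that by (simp add: M2_def)
    finally show "k \<in> {- int m..int m}" by auto
  qed
  show ?thesis
  proof (intro exI[of _ "max M1 M2"] allI impI)
    fix m assume m: "max M1 M2 \<le> m"
    have "t < L2_set (\<lambda>k. cmod (freq_proj (\<omega> k \<inter> {- real m..real m}) f x)) T'" using M1 m by simp
    also have "\<dots> \<le> L2_set (\<lambda>k. cmod (freq_proj (\<omega> k \<inter> {- real m..real m}) f x)) {- int m..int m}"
      unfolding L2_set_def using M2[of m] m by (intro real_sqrt_le_mono sum_mono2) auto
    finally show "t < \<dots>" .
  qed
qed

context A1_weight
begin

text \<open>Cutting the frequencies to [-m, m] makes every interval bounded, hence open up to a null
  set, which no frequency integral sees. Degenerate intervals have projection 0 and are left out of
  \<open>K\<close>.\<close>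

lemma weak_type_truncated:
  fixes \<omega> :: "int \<Rightarrow> real set"
  assumes \<omega>: "\<And>k. is_interval (\<omega> k)" and ov: "\<And>x. (\<Sum>\<^sub>\<infinity>k. indicator (\<omega> k) x :: ennreal) \<le> ennreal B" and B: "0 \<le> B"
    and f: "f \<in> borel_measurable borel" "\<And>x. cmod (f x) \<le> F" "\<And>x. f x \<noteq> 0 \<Longrightarrow> \<bar>x\<bar> < R" and t: "0 < t"
  shows "emeasure \<mu> {x. t < L2_set (\<lambda>k. cmod (freq_proj (\<omega> k \<inter> {- real m..real m}) f x)) {- int m..int m}}
    \<le> ennreal (8 * weak_const B / t\<^sup>2) * A1_const w * Ainf_const w
        * weighted_energy f"
proof -
  let ?I = "\<lambda>k. \<omega> k \<inter> {- real m..real m}"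
  have I: "is_interval (?I k)" "bounded (?I k)" for k
    by (rule is_interval_Int[OF \<omega> is_interval_cc], rule bounded_subset[OF bounded_closed_interval]) auto
  obtain a b where ab: "\<And>k. a k \<le> b k" "\<And>k. {a k<..<b k} \<subseteq> ?I k" "\<And>k. ?I k \<subseteq> {a k..b k}"
    using bounded_interval_ends[OF I] by metis
  define K where "K = {k\<in>{- int m..int m}. a k < b k}"
  have finK: "finite K" by (rule finite_subset[of _ "{- int m..int m}"]) (auto simp: K_def)
  interpret weighted_family K a b B w
  proof unfold_locales
    show "finite K" by (rule finK)
    show "\<And>k. k \<in> K \<Longrightarrow> a k < b k" by (simp add: K_def)
    fix \<xi> :: real
    have "(\<Sum>k\<in>K. indicator {a k<..<b k} \<xi> :: ennreal) \<le> (\<Sum>k\<in>K. indicator (\<omega> k) \<xi>)"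
      using ab(2) by (intro sum_mono indicator_leI) blast
    also have "\<dots> \<le> (SUP T\<in>{T. finite T \<and> T \<subseteq> UNIV}. \<Sum>k\<in>T. indicator (\<omega> k) \<xi>)"
      by (rule SUP_upper) (simp add: finK)
    also have "\<dots> = (\<Sum>\<^sub>\<infinity>k. indicator (\<omega> k) \<xi>)"
      by (rule nonneg_infsum_complete[symmetric]) simp
    also have "\<dots> \<le> ennreal B" by (rule ov)
    finally have "(\<Sum>k\<in>K. ennreal (indicator {a k<..<b k} \<xi>)) \<le> ennreal B" by (simp add: ennreal_indicator)
    then have "ennreal (\<Sum>k\<in>K. indicator {a k<..<b k} \<xi>) \<le> ennreal B" by (subst (asm) sum_ennreal) auto
    then show "(\<Sum>k\<in>K. indicator {a k<..<b k} \<xi>) \<le> B" using B by (subst (asm) ennreal_le_iff) auto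
  qed
  have eq: "freq_proj (?I k) f x = freq_proj {a k<..<b k} f x" for k x
  proof (rule freq_proj_AE_cong)
    show "AE \<xi> in lborel. \<xi> \<in> ?I k \<longleftrightarrow> \<xi> \<in> {a k<..<b k}"
      using AE_lborel_singleton[of "a k"] AE_lborel_singleton[of "b k"]
    proof eventually_elim
      case (elim \<xi>)
      have "\<xi> \<in> {a k<..<b k}" if "\<xi> \<in> ?I k"
        using subsetD[OF ab(3)[of k] that] elim by auto
      then show ?case using subsetD[OF ab(2)[of k], of \<xi>] by (rule iffI)
    qed
    show "?I k \<in> sets borel" using I(1) by (rule real_interval_borel_measurable)
  qed (use f in auto)
  have "L2_set (\<lambda>k. cmod (freq_proj (?I k) f x)) {- int m..int m} = L2_set (\<lambda>k. cmod (freq_proj {a k<..<b k} f x)) K" for x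
    unfolding eq L2_set_def
    by (intro arg_cong[of _ _ sqrt] sum.mono_neutral_right) (use ab(1) in \<open>auto simp: K_def freq_proj_def not_less\<close>)
  then show ?thesis using weak_type_freq_proj[OF f t] by simp
qed

lemma weak_type_square_function:
  fixes \<omega> :: "int \<Rightarrow> real set"
  assumes \<omega>: "\<And>k. is_interval (\<omega> k)" and ov: "\<And>x. (\<Sum>\<^sub>\<infinity>k. indicator (\<omega> k) x :: ennreal) \<le> ennreal B" and B: "0 \<le> B"
    and f: "f \<in> borel_measurable borel" "\<And>x. cmod (f x) \<le> F" "\<And>x. f x \<noteq> 0 \<Longrightarrow> \<bar>x\<bar> < R" and t: "0 < t"
  shows "emeasure \<mu> {x. ennreal t < square_function \<omega> f x}
    \<le> ennreal (8 * weak_const B / t\<^sup>2) * A1_const w * Ainf_const w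
        * weighted_energy f" (is "_ \<le> ?bound")
proof -
  note [measurable] = f(1)
  have \<omega>_sets [measurable]: "\<omega> k \<in> sets borel" for k using \<omega> by (rule real_interval_borel_measurable)
  define A where "A m = {x. t < L2_set (\<lambda>k. cmod (freq_proj (\<omega> k \<inter> {- real m..real m}) f x)) {- int m..int m}}" for m
  have A_sets: "A m \<in> sets \<mu>" for m
  proof -
    have "{x\<in>space lborel. t < L2_set (\<lambda>k. cmod (freq_proj (\<omega> k \<inter> {- real m..real m}) f x)) {- int m..int m}} \<in> sets lborel"
      unfolding L2_set_def by measurable
    then show ?thesis by (auto simp: A_def intro: sets_completionI_sets)
  qed
  let ?U = "\<lambda>M. \<Inter>m\<in>{M..}. A m"
  have U_sets: "?U M \<in> sets \<mu>" for M using A_sets by (intro sets.countable_INT') auto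
  \<comment> \<open>A Fatou argument for sets: the intersections \<open>?U M\<close> increase with
    \<open>M\<close>, and each lies in \<open>A M\<close>, whose weight is bounded
    uniformly.\<close>
  have "emeasure \<mu> {x. ennreal t < square_function \<omega> f x} \<le> emeasure \<mu> (\<Union>M. ?U M)"
  proof (rule emeasure_mono)
    show "{x. ennreal t < square_function \<omega> f x} \<subseteq> (\<Union>M. ?U M)"
    proof
      fix x assume "x \<in> {x. ennreal t < square_function \<omega> f x}"
      then obtain M where "\<forall>m\<ge>M. t < L2_set (\<lambda>k. cmod (freq_proj (\<omega> k \<inter> {- real m..real m}) f x)) {- int m..int m}"
        using square_function_truncation[of \<omega> f t x, OF \<omega>_sets f(1) _ t] by blast
      then show "x \<in> (\<Union>M. ?U M)" by (auto simp: A_def)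
    qed
    show "(\<Union>M. ?U M) \<in> sets \<mu>" using U_sets by auto
  qed
  also have "\<dots> = (SUP M. emeasure \<mu> (?U M))"
    using U_sets by (intro SUP_emeasure_incseq[symmetric]) (auto simp: incseq_def)
  also have "\<dots> \<le> ?bound"
  proof (rule SUP_least)
    fix M
    have "emeasure \<mu> (?U M) \<le> emeasure \<mu> (A M)" using A_sets by (intro emeasure_mono) auto
    also have "\<dots> \<le> ?bound" unfolding A_def by (rule weak_type_truncated[OF \<omega> ov B f t])
    finally show "emeasure \<mu> (?U M) \<le> ?bound" .
  qed
  finally show ?thesis .
qed

end

lemma test_function_bounded:
  assumes "test_function f"
  shows "f \<in> borel_measurable borel" "\<exists>F. \<forall>x. cmod (f x) \<le> F" "\<exists>R. \<forall>x. f x \<noteq> 0 \<longrightarrow> \<bar>x\<bar> < R"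
proof -
  from assms obtain D where D: "D 0 = f" "\<And>n x. (D n has_vector_derivative D (Suc n) x) (at x)"
    and cpt: "compact (closure {x. f x \<noteq> 0})" unfolding test_function_def by auto
  have cont: "continuous_on UNIV f"
    using D(2)[of 0] D(1) by (intro continuous_at_imp_continuous_on ballI) (auto intro: has_vector_derivative_continuous)
  then show "f \<in> borel_measurable borel" by (rule borel_measurable_continuous_onI)
  have "bounded (f ` closure {x. f x \<noteq> 0})"
    by (intro compact_imp_bounded compact_continuous_image cpt continuous_on_subset[OF cont]) simp
  then obtain F where F: "\<And>x. x \<in> closure {x. f x \<noteq> 0} \<Longrightarrow> cmod (f x) \<le> F"
    unfolding bounded_iff by auto
  have "cmod (f x) \<le> max F 0" for x
    using F[of x] closure_subset[of "{x. f x \<noteq> 0}"] by (cases "f x = 0") auto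
  then show "\<exists>F. \<forall>x. cmod (f x) \<le> F" by blast
  obtain R where "\<And>x. x \<in> closure {x. f x \<noteq> 0} \<Longrightarrow> \<bar>x\<bar> \<le> R"
    using compact_imp_bounded[OF cpt] unfolding bounded_iff by auto
  then have "f x \<noteq> 0 \<longrightarrow> \<bar>x\<bar> < R + 1" for x using closure_subset[of "{x. f x \<noteq> 0}"] by force
  then show "\<exists>R. \<forall>x. f x \<noteq> 0 \<longrightarrow> \<bar>x\<bar> < R" by blast
qed

lemma ennreal_sqrt_ennreal: "0 \<le> r \<Longrightarrow> ennreal_sqrt (ennreal r) = ennreal (sqrt r)"
  by (simp add: ennreal_sqrt_def)

lemma ennreal_sqrt_mono: "x \<le> y \<Longrightarrow> ennreal_sqrt x \<le> ennreal_sqrt y"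
  by (cases x; cases y) (auto simp: ennreal_sqrt_def top_unique)

theorem corollary1p6:
  fixes B :: real
  assumes "0 \<le> B"
  shows "\<exists>C::real. 0 < C \<and>
    (\<forall>\<omega> :: int \<Rightarrow> real set.
      (\<forall>k. is_interval (\<omega> k)) \<longrightarrow>
      (\<forall>x. (\<Sum>\<^sub>\<infinity>k. indicator (\<omega> k) x :: ennreal) \<le> ennreal B) \<longrightarrow>
      (\<forall>w \<in> A1_class.
        weak_op_norm w (square_function \<omega>)
          \<le> ennreal C * ennreal_sqrt (A1_const w) * ennreal_sqrt (Ainf_const w)
             * ennreal (ln (exp 1 + enn2real (Ainf_const w)))))"
proof -
  define c where "c = 8 * weak_const B"
  \<comment> \<open>The summand 1 makes \<open>C\<close> positive even when c = 0.\<close>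
  define C where "C = sqrt c + 1"
  have c: "0 \<le> c" by (simp add: c_def)
  then have C: "0 < C" by (simp add: C_def add_nonneg_pos)
  have main: "weak_op_norm w (square_function \<omega>)
      \<le> ennreal C * ennreal_sqrt (A1_const w) * ennreal_sqrt (Ainf_const w) * ennreal (ln (exp 1 + enn2real (Ainf_const w)))"
    if \<omega>: "\<forall>k. is_interval (\<omega> k)" and ov: "\<forall>x. (\<Sum>\<^sub>\<infinity>k. indicator (\<omega> k) x :: ennreal) \<le> ennreal B"
      and w: "w \<in> A1_class" for \<omega> w
  proof -
    interpret A1_weight w by (rule A1_weight.intro[OF w])
    obtain A where A: "A1_const w = ennreal A" "0 \<le> A" using A1_finite by (cases "A1_const w") auto
    obtain L where L: "Ainf_const w = ennreal L" "0 \<le> L" using Ainf_finite by (cases "Ainf_const w") auto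
    \<comment> \<open>The estimate is proved without the logarithm, which enters here as a factor
      that is at least 1.\<close>
    have log: "1 \<le> ln (exp 1 + L)"
      using L by (subst ln_ge_iff) (auto intro: add_pos_nonneg)
    show ?thesis unfolding weak_op_norm_def
    proof (rule Inf_lower, rule CollectI, intro allI impI)
      fix f assume "test_function f"
      from test_function_bounded[OF this] obtain F R
        where f: "f \<in> borel_measurable borel" "\<And>x. cmod (f x) \<le> F" "\<And>x. f x \<noteq> 0 \<Longrightarrow> \<bar>x\<bar> < R" by blast
      let ?N = "ennreal C * ennreal_sqrt (A1_const w) * ennreal_sqrt (Ainf_const w) * ennreal (ln (exp 1 + enn2real (Ainf_const w)))"
      have f_leb: "f \<in> borel_measurable lebesgue" by (rule measurable_completion) (use f(1) in simp)
      define E where "E = weighted_energy f"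
      have L2: "L2_norm w f = ennreal_sqrt E"
        unfolding L2_norm_def weight_measure_def E_def using f_leb
        by (subst nn_integral_density) (auto simp: mult.commute)
      show "weak_L2_norm w (square_function \<omega> f) \<le> ?N * L2_norm w f"
      proof (cases E)
        case (real e)
        show ?thesis unfolding weak_L2_norm_def
        proof (rule SUP_least)
          fix t :: real assume "t \<in> {0<..}"
          then have t: "0 < t" by simp
          have "emeasure \<mu> {x. ennreal t < square_function \<omega> f x} \<le> ennreal (c / t\<^sup>2) * A1_const w * Ainf_const w * E"
            unfolding c_def E_def using \<omega> ov by (intro weak_type_square_function[OF _ _ assms f t]) auto
          also have "\<dots> = ennreal (c / t\<^sup>2 * A * L * e)"
            unfolding A L real using A L real c
            by (simp add: ennreal_mult del: times_divide_eq_left times_divide_eq_right)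
          finally have "ennreal_sqrt (emeasure \<mu> {x. ennreal t < square_function \<omega> f x}) \<le> ennreal (sqrt (c / t\<^sup>2 * A * L * e))"
            using ennreal_sqrt_mono[of _ "ennreal (c / t\<^sup>2 * A * L * e)"] A L real c by (simp add: ennreal_sqrt_ennreal)
          then have "ennreal t * ennreal_sqrt (emeasure \<mu> {x. ennreal t < square_function \<omega> f x}) \<le> ennreal t * ennreal (sqrt (c / t\<^sup>2 * A * L * e))"
            by (rule mult_left_mono) simp
          also have "\<dots> = ennreal (sqrt c * sqrt A * sqrt L * 1 * sqrt e)"
            using t by (simp add: ennreal_mult[symmetric] real_sqrt_mult real_sqrt_divide A L real c)
          also have "\<dots> \<le> ennreal (C * sqrt A * sqrt L * ln (exp 1 + L) * sqrt e)"
            using A L real c log by (intro ennreal_leI mult_mono) (auto simp: C_def)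
          also have "\<dots> = ?N * L2_norm w f"
            unfolding L2 A L real using A L real C log
            by (simp add: ennreal_sqrt_ennreal ennreal_mult)
          finally show "ennreal t * ennreal_sqrt (emeasure \<mu> {x. ennreal t < square_function \<omega> f x}) \<le> ?N * L2_norm w f" .
        qed
      next
        \<comment> \<open>Impossible: a bounded function of compact support has finite energy
          against a locally integrable weight.\<close>
        case top
        have "E < \<infinity>" unfolding E_def
          by (rule weighted_energy_finite[OF f(2), where S="{- R..R}"]) (use f(3) in force)+
        with top show ?thesis by simp
      qed
    qed
  qed
  show ?thesis using C main by blast
qed

end
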